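(* Let $\Lambda$ be a ring which is complete with respect to the $\mathfrak{m}$-adic topology for some two-sided ideal $\mathfrak{m}$ such that $\Lambda/\mathfrak{m}^i$ has finite length for all $i\ge1$. Then: (a) the category $\mathsf{C}^{\rm b}(\mathsf{proj}\,\Lambda)$ of bounded complexes of finitely generated projective $\Lambda$-modules is a Krull-Schmidt category; (b) the homotopy category $\mathsf{K}^{\rm b}(\mathsf{proj}\,\Lambda)$ of bounded complexes of finitely generated projective $\Lambda$-modules is a Krull-Schmidt category.
   Context: Modules are left modules and finite length means finite length as a left $\Lambda$-module. $\Lambda$ is complete with respect to the $\mathfrak{m}$-adic topology if the natural morphism $\Lambda\to\varprojlim\Lambda/\mathfrak{m}^i$ is an isomorphism. An additive category is Krull-Schmidt if every object decomposes into a finite direct sum of objects having local endomorphism rings. *)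

theory Defs
  imports "HOL-Algebra.Module" "HOL-Algebra.Ideal_Product" "HOL-Algebra.QuotRing"
begin

section \<open>Left modules over a ring that need not be commutative\<close>

text \<open>
  The locale \<^locale>\<open>module\<close> of the library requires a commutative ring of scalars; the record
  \<^typ>\<open>('a, 'b) module\<close> and the locale \<^locale>\<open>submodule\<close> do not, and are reused.
  The fields \<open>mult\<close> and \<open>one\<close> that the record inherits from \<^typ>\<open>'b ring\<close> carry no meaning.
\<close>

locale left_module = R?: ring R + M?: abelian_group M 
    for R :: "('a, 'r) ring_scheme" (structure) and M :: "('a, 'b, 'm) module_scheme" (structure) +
  assumes smult_closed [simp, intro]:
      "\<lbrakk>a \<in> carrier R; x \<in> carrier M\<rbrakk> \<Longrightarrow> a \<odot>\<^bsub>M\<^esub> x \<in> carrier M"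
    and smult_l_distr:
      "\<lbrakk>a \<in> carrier R; b \<in> carrier R; x \<in> carrier M\<rbrakk> \<Longrightarrow>
        (a \<oplus> b) \<odot>\<^bsub>M\<^esub> x = a \<odot>\<^bsub>M\<^esub> x \<oplus>\<^bsub>M\<^esub> b \<odot>\<^bsub>M\<^esub> x"
    and smult_r_distr:
      "\<lbrakk>a \<in> carrier R; x \<in> carrier M; y \<in> carrier M\<rbrakk> \<Longrightarrow>
        a \<odot>\<^bsub>M\<^esub> (x \<oplus>\<^bsub>M\<^esub> y) = a \<odot>\<^bsub>M\<^esub> x \<oplus>\<^bsub>M\<^esub> a \<odot>\<^bsub>M\<^esub> y"
    and smult_assoc1:
      "\<lbrakk>a \<in> carrier R; b \<in> carrier R; x \<in> carrier M\<rbrakk> \<Longrightarrow>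
        (a \<otimes> b) \<odot>\<^bsub>M\<^esub> x = a \<odot>\<^bsub>M\<^esub> (b \<odot>\<^bsub>M\<^esub> x)"
    and smult_one [simp]:
      "x \<in> carrier M \<Longrightarrow> \<one> \<odot>\<^bsub>M\<^esub> x = x"

text \<open>Homomorphisms are extensional, so that equality of functions is equality of morphisms.\<close>

definition left_hom ::
    "('a, 'r) ring_scheme \<Rightarrow> ('a, 'b, 'm) module_scheme \<Rightarrow> ('a, 'c, 'n) module_scheme \<Rightarrow> ('b \<Rightarrow> 'c) set"
  where "left_hom R M N = {f \<in> carrier M \<rightarrow>\<^sub>E carrier N.
    (\<forall>x\<in>carrier M. \<forall>y\<in>carrier M. f (x \<oplus>\<^bsub>M\<^esub> y) = f x \<oplus>\<^bsub>N\<^esub> f y) \<and>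
    (\<forall>a\<in>carrier R. \<forall>x\<in>carrier M. f (a \<odot>\<^bsub>M\<^esub> x) = a \<odot>\<^bsub>N\<^esub> f x)}"

definition regular_module :: "('a, 'r) ring_scheme \<Rightarrow> ('a, 'a) module"
  where "regular_module R =
    \<lparr>carrier = carrier R, mult = mult R, one = one R, zero = zero R, add = add R,
     smult = mult R\<rparr>"

definition quot_module :: "('a, 'b, 'm) module_scheme \<Rightarrow> 'b set \<Rightarrow> ('a, 'b set) module"
  where "quot_module M H =
    \<lparr>carrier = a_rcosets\<^bsub>M\<^esub> H, mult = undefined, one = undefined, zero = H, add = set_add M,
     smult = (\<lambda>a X. \<Union>x\<in>X. H +>\<^bsub>M\<^esub> (a \<odot>\<^bsub>M\<^esub> x))\<rparr>"

text \<open>Finite length: existence of a composition series.\<close>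

definition finite_length :: "('a, 'r) ring_scheme \<Rightarrow> ('a, 'b, 'm) module_scheme \<Rightarrow> bool"
  where "finite_length R M \<longleftrightarrow> (\<exists>(n::nat) N. N 0 = {\<zero>\<^bsub>M\<^esub>} \<and> N n = carrier M \<and>
    (\<forall>i\<le>n. submodule (N i) R M) \<and>
    (\<forall>i<n. N i \<subset> N (Suc i) \<and> \<not> (\<exists>H. submodule H R M \<and> N i \<subset> H \<and> H \<subset> N (Suc i))))"

definition finitely_generated :: "('a, 'r) ring_scheme \<Rightarrow> ('a, 'b, 'm) module_scheme \<Rightarrow> bool"
  where "finitely_generated R M \<longleftrightarrow>
    (\<exists>S. finite S \<and> S \<subseteq> carrier M \<and> \<Inter>{H. submodule H R M \<and> S \<subseteq> H} = carrier M)"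

text \<open>
  A definition cannot quantify over the carrier types of the test modules in the lifting property.
  For a finitely generated module it is enough to test on modules with carrier in
  \<^typ>\<open>nat \<Rightarrow> 'a\<close>, as every quotient of a module \<open>R\<^sup>n\<close> has an isomorphic copy there;
  the lemma \<open>fg_projective_lift\<close> below derives the lifting property for arbitrary carrier types.
\<close>

definition fg_projective :: "('a, 'r) ring_scheme \<Rightarrow> ('a, 'b, 'm) module_scheme \<Rightarrow> bool"
  where "fg_projective R P \<longleftrightarrow> left_module R P \<and> finitely_generated R P \<and>
    (\<forall>(N :: ('a, nat \<Rightarrow> 'a) module) (L :: ('a, nat \<Rightarrow> 'a) module) g f.
       left_module R N \<and> left_module R L \<and>
       g \<in> left_hom R N L \<and> g ` carrier N = carrier L \<and> f \<in> left_hom R P L \<longrightarrow>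
       (\<exists>h\<in>left_hom R P N. \<forall>x\<in>carrier P. g (h x) = f x))"


lemma (in left_module) smult_r_null [simp]: "a \<in> carrier R \<Longrightarrow> a \<odot>\<^bsub>M\<^esub> \<zero>\<^bsub>M\<^esub> = \<zero>\<^bsub>M\<^esub>"
  by (metis M.add.l_cancel_one M.zero_closed smult_closed smult_r_distr M.l_zero)

lemma (in left_module) smult_l_null [simp]: "x \<in> carrier M \<Longrightarrow> \<zero> \<odot>\<^bsub>M\<^esub> x = \<zero>\<^bsub>M\<^esub>"
  by (metis M.add.l_cancel_one R.l_zero R.zero_closed smult_closed smult_l_distr)

lemma (in left_module) smult_minus_one: "x \<in> carrier M \<Longrightarrow> (\<ominus> \<one>) \<odot>\<^bsub>M\<^esub> x = \<ominus>\<^bsub>M\<^esub> x"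
  by (metis M.minus_equality R.add.inv_closed R.l_neg R.one_closed smult_closed smult_l_distr
      smult_l_null smult_one)

lemma (in left_module) left_submoduleI:
  assumes "H \<subseteq> carrier M" "\<zero>\<^bsub>M\<^esub> \<in> H"
    and "\<And>x y. \<lbrakk>x \<in> H; y \<in> H\<rbrakk> \<Longrightarrow> x \<oplus>\<^bsub>M\<^esub> y \<in> H"
    and sc: "\<And>a x. \<lbrakk>a \<in> carrier R; x \<in> H\<rbrakk> \<Longrightarrow> a \<odot>\<^bsub>M\<^esub> x \<in> H"
  shows "submodule H R M"
proof -
  have "\<ominus>\<^bsub>M\<^esub> x \<in> H" if "x \<in> H" for x
    using sc[of "\<ominus> \<one>" x] that assms(1) by (auto simp: smult_minus_one subset_iff)
  then show ?thesis
    using assms by (intro submodule.intro subgroup.intro submodule_axioms.intro) (auto simp: a_inv_def)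
qed

lemma submodule_props:
  assumes "submodule H R M"
  shows "H \<subseteq> carrier M" "\<zero>\<^bsub>M\<^esub> \<in> H"
    and "\<And>x y. \<lbrakk>x \<in> H; y \<in> H\<rbrakk> \<Longrightarrow> x \<oplus>\<^bsub>M\<^esub> y \<in> H"
    and "\<And>a x. \<lbrakk>a \<in> carrier R; x \<in> H\<rbrakk> \<Longrightarrow> a \<odot>\<^bsub>M\<^esub> x \<in> H"
    and "\<And>x. x \<in> H \<Longrightarrow> \<ominus>\<^bsub>M\<^esub> x \<in> H"
proof -
  interpret submodule H R M by fact
  show "H \<subseteq> carrier M" "\<zero>\<^bsub>M\<^esub> \<in> H" using subset one_closed by auto
  show "\<And>x y. \<lbrakk>x \<in> H; y \<in> H\<rbrakk> \<Longrightarrow> x \<oplus>\<^bsub>M\<^esub> y \<in> H" using m_closed by auto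
  show "\<And>a x. \<lbrakk>a \<in> carrier R; x \<in> H\<rbrakk> \<Longrightarrow> a \<odot>\<^bsub>M\<^esub> x \<in> H" by auto
  show "\<And>x. x \<in> H \<Longrightarrow> \<ominus>\<^bsub>M\<^esub> x \<in> H" using m_inv_closed by (auto simp: a_inv_def)
qed

lemma (in left_module) finite_subset_coded:
  assumes "finite S" "S \<subseteq> carrier M"
  shows "\<exists>H (\<epsilon> :: (nat \<Rightarrow> 'a) \<Rightarrow> 'b). submodule H R M \<and> S \<subseteq> H \<and> H \<subseteq> range \<epsilon>"
  using assms
proof (induction S rule: finite_induct)
  case empty
  have "submodule {\<zero>\<^bsub>M\<^esub>} R M" by (rule left_submoduleI) auto
  then show ?case by (intro exI[of _ "{\<zero>\<^bsub>M\<^esub>}"] exI[of _ "\<lambda>_. \<zero>\<^bsub>M\<^esub>"]) auto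
next
  case (insert s S)
  then obtain H and \<epsilon> :: "(nat \<Rightarrow> 'a) \<Rightarrow> 'b"
    where H: "submodule H R M" "S \<subseteq> H" "H \<subseteq> range \<epsilon>" by auto
  note Hp = submodule_props[OF H(1)]
  have s: "s \<in> carrier M" using insert by auto
  define H' where "H' = {h \<oplus>\<^bsub>M\<^esub> a \<odot>\<^bsub>M\<^esub> s | h a. h \<in> H \<and> a \<in> carrier R}"
  define \<epsilon>' where "\<epsilon>' c = \<epsilon> (\<lambda>i. c (Suc i)) \<oplus>\<^bsub>M\<^esub> c 0 \<odot>\<^bsub>M\<^esub> s" for c :: "nat \<Rightarrow> 'a"
  have Hc: "h \<in> carrier M" if "h \<in> H" for h using Hp(1) that by auto
  have 1: "h \<in> H'" if "h \<in> H" for h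
    unfolding H'_def using that s by (auto intro!: exI[of _ h] exI[of _ \<zero>] simp: Hc)
  have "submodule H' R M"
  proof (rule left_submoduleI)
    show "H' \<subseteq> carrier M" using Hc s by (auto simp: H'_def)
    show "\<zero>\<^bsub>M\<^esub> \<in> H'" using 1 Hp(2) by auto
    fix x y assume "x \<in> H'" "y \<in> H'"
    then obtain h a k b where e: "x = h \<oplus>\<^bsub>M\<^esub> a \<odot>\<^bsub>M\<^esub> s" "y = k \<oplus>\<^bsub>M\<^esub> b \<odot>\<^bsub>M\<^esub> s" "h \<in> H" "k \<in> H"
      "a \<in> carrier R" "b \<in> carrier R" by (auto simp: H'_def)
    then have "x \<oplus>\<^bsub>M\<^esub> y = (h \<oplus>\<^bsub>M\<^esub> k) \<oplus>\<^bsub>M\<^esub> (a \<oplus> b) \<odot>\<^bsub>M\<^esub> s"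
      using s by (simp add: Hc smult_l_distr M.add.m_ac)
    then show "x \<oplus>\<^bsub>M\<^esub> y \<in> H'" unfolding H'_def using e Hp(3) by blast
  next
    fix a x assume "a \<in> carrier R" "x \<in> H'"
    then obtain h b where e: "x = h \<oplus>\<^bsub>M\<^esub> b \<odot>\<^bsub>M\<^esub> s" "h \<in> H" "b \<in> carrier R" by (auto simp: H'_def)
    then have "a \<odot>\<^bsub>M\<^esub> x = a \<odot>\<^bsub>M\<^esub> h \<oplus>\<^bsub>M\<^esub> (a \<otimes> b) \<odot>\<^bsub>M\<^esub> s"
      using s \<open>a \<in> carrier R\<close> by (simp add: Hc smult_r_distr smult_assoc1)
    then show "a \<odot>\<^bsub>M\<^esub> x \<in> H'" unfolding H'_def using e Hp(4) \<open>a \<in> carrier R\<close> by blast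
  qed
  moreover have "s \<in> H'"
    unfolding H'_def using s Hp(2) by (auto intro!: exI[of _ "\<zero>\<^bsub>M\<^esub>"] exI[of _ \<one>])
  moreover have "S \<subseteq> H'" using H(2) 1 by auto
  moreover have "H' \<subseteq> range \<epsilon>'"
  proof
    fix x assume "x \<in> H'"
    then obtain h a where e: "x = h \<oplus>\<^bsub>M\<^esub> a \<odot>\<^bsub>M\<^esub> s" "h \<in> H" by (auto simp: H'_def)
    then obtain c where "h = \<epsilon> c" using H(3) by auto
    then have "x = \<epsilon>' (case_nat a c)" using e by (simp add: \<epsilon>'_def)
    then show "x \<in> range \<epsilon>'" by auto
  qed
  ultimately show ?case by blast
qed

lemma (in left_module) submodule_copy:
  fixes e :: "'b \<Rightarrow> 'c" and d :: "'c \<Rightarrow> 'b"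
  assumes H: "submodule H R M" and d: "\<And>x. x \<in> H \<Longrightarrow> d (e x) = x"
  shows "left_module R \<lparr>carrier = e ` H, mult = undefined, one = undefined, zero = e \<zero>\<^bsub>M\<^esub>,
    add = (\<lambda>u v. e (d u \<oplus>\<^bsub>M\<^esub> d v)), smult = (\<lambda>a u. e (a \<odot>\<^bsub>M\<^esub> d u))\<rparr>" (is "left_module R ?N")
proof -
  note Hp = submodule_props[OF H]
  have Hc: "h \<in> carrier M" if "h \<in> H" for h using Hp(1) that by auto
  have "abelian_group ?N"
  proof (rule abelian_groupI, goal_cases)
    case (6 x)
    then obtain h where "h \<in> H" "x = e h" by auto
    then show ?case using Hp(5)[of h] by (auto simp: d Hc M.l_neg intro!: bexI[of _ "\<ominus>\<^bsub>M\<^esub> h"])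
  qed (auto simp: d Hp(2-4) Hc M.add.m_ac)
  then show ?thesis
    using R.ring_axioms
    by (intro left_module.intro left_module_axioms.intro)
      (auto simp: d Hp(2-4) Hc smult_l_distr smult_r_distr smult_assoc1)
qed

lemma left_homD:
  assumes "f \<in> left_hom R M N"
  shows "\<And>x. x \<in> carrier M \<Longrightarrow> f x \<in> carrier N"
    and "\<And>x y. \<lbrakk>x \<in> carrier M; y \<in> carrier M\<rbrakk> \<Longrightarrow> f (x \<oplus>\<^bsub>M\<^esub> y) = f x \<oplus>\<^bsub>N\<^esub> f y"
    and "\<And>a x. \<lbrakk>a \<in> carrier R; x \<in> carrier M\<rbrakk> \<Longrightarrow> f (a \<odot>\<^bsub>M\<^esub> x) = a \<odot>\<^bsub>N\<^esub> f x"
  using assms by (auto simp: left_hom_def)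

lemma left_hom_zero:
  assumes "left_module R M" "left_module R N" "f \<in> left_hom R M N"
  shows "f \<zero>\<^bsub>M\<^esub> = \<zero>\<^bsub>N\<^esub>"
proof -
  interpret M: left_module R M by fact
  interpret N: left_module R N by fact
  show ?thesis
    using left_homD(3)[OF assms(3), of "\<zero>\<^bsub>R\<^esub>" "\<zero>\<^bsub>M\<^esub>"] left_homD(1)[OF assms(3), of "\<zero>\<^bsub>M\<^esub>"] by simp
qed

lemma fg_projective_lift:
  fixes P :: "('a, 'b, 'm) module_scheme"
    and N :: "('a, 'c, 'n) module_scheme" and L :: "('a, 'd, 'l) module_scheme"
  assumes P: "fg_projective R P" and N: "left_module R N" and L: "left_module R L"
    and g: "g \<in> left_hom R N L" and surj: "g ` carrier N = carrier L" and f: "f \<in> left_hom R P L"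
  shows "\<exists>h\<in>left_hom R P N. \<forall>x\<in>carrier P. g (h x) = f x"
proof -
  interpret P: left_module R P using P by (simp add: fg_projective_def)
  interpret N: left_module R N by fact
  interpret L: left_module R L by fact
  obtain S where S: "finite S" "S \<subseteq> carrier P" "\<Inter>{H. submodule H R P \<and> S \<subseteq> H} = carrier P"
    using P by (auto simp: fg_projective_def finitely_generated_def)
  have gen: "H = carrier P" if "submodule H R P" "S \<subseteq> H" for H
    using S(3) that submodule_props(1)[OF that(1)] by blast
  obtain H0 and \<epsilon>P :: "(nat \<Rightarrow> 'a) \<Rightarrow> 'b" where "submodule H0 R P" "S \<subseteq> H0" "H0 \<subseteq> range \<epsilon>P"
    using P.finite_subset_coded[OF S(1,2)] by auto
  then have \<epsilon>P: "carrier P \<subseteq> range \<epsilon>P" using gen by auto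
  note fD = left_homD[OF f] and gD = left_homD[OF g]
  define W :: "('a, 'b \<times> 'c) module" where
    "W = \<lparr>carrier = {(p, x). p \<in> carrier P \<and> x \<in> carrier N \<and> f p = g x},
      mult = undefined, one = undefined, zero = (\<zero>\<^bsub>P\<^esub>, \<zero>\<^bsub>N\<^esub>),
      add = (\<lambda>(p, x) (q, y). (p \<oplus>\<^bsub>P\<^esub> q, x \<oplus>\<^bsub>N\<^esub> y)), smult = (\<lambda>a (p, x). (a \<odot>\<^bsub>P\<^esub> p, a \<odot>\<^bsub>N\<^esub> x))\<rparr>"
  have "abelian_group W"
  proof (rule abelian_groupI, goal_cases)
    case (6 w)
    then obtain p x where w: "w = (p, x)" "p \<in> carrier P" "x \<in> carrier N" "f p = g x"
      by (auto simp: W_def)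
    have "f (\<ominus>\<^bsub>P\<^esub> p) = g (\<ominus>\<^bsub>N\<^esub> x)"
      using w fD(3)[of "\<ominus>\<^bsub>R\<^esub> \<one>\<^bsub>R\<^esub>" p] gD(3)[of "\<ominus>\<^bsub>R\<^esub> \<one>\<^bsub>R\<^esub>" x]
      by (simp add: P.smult_minus_one N.smult_minus_one)
    then show ?case
      using w by (intro bexI[of _ "(\<ominus>\<^bsub>P\<^esub> p, \<ominus>\<^bsub>N\<^esub> x)"]) (auto simp: W_def P.M.l_neg N.M.l_neg)
  qed (auto simp: W_def P.M.add.m_ac N.M.add.m_ac fD gD
      left_hom_zero[OF P.left_module_axioms L f] left_hom_zero[OF N L g])
  then have "left_module R W"
    using P.R.ring_axioms
    by (intro left_module.intro left_module_axioms.intro)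
      (auto simp: W_def P.smult_l_distr P.smult_r_distr P.smult_assoc1
        N.smult_l_distr N.smult_r_distr N.smult_assoc1 fD gD)
  then interpret W: left_module R W .
  have "\<exists>x\<in>carrier N. g x = f s" if "s \<in> S" for s
  proof -
    have "f s \<in> g ` carrier N" unfolding surj using that S(2) fD(1) by auto
    then show ?thesis by force
  qed
  then obtain \<xi> where \<xi>: "\<And>s. s \<in> S \<Longrightarrow> \<xi> s \<in> carrier N \<and> g (\<xi> s) = f s" by metis
  have "(\<lambda>s. (s, \<xi> s)) ` S \<subseteq> carrier W" using \<xi> S(2) by (auto simp: W_def)
  then obtain H and \<epsilon> :: "(nat \<Rightarrow> 'a) \<Rightarrow> 'b \<times> 'c"
    where H: "submodule H R W" "(\<lambda>s. (s, \<xi> s)) ` S \<subseteq> H" "H \<subseteq> range \<epsilon>"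
    using W.finite_subset_coded[OF finite_imageI[OF S(1)]] by metis
  note Hp = submodule_props[OF H(1)]
  have fstH: "fst ` H = carrier P"
  proof (rule gen[OF P.left_submoduleI])
    show "fst ` H \<subseteq> carrier P" using Hp(1) by (auto simp: W_def)
    show "\<zero>\<^bsub>P\<^esub> \<in> fst ` H" using Hp(2) by (force simp: W_def)
    show "x \<oplus>\<^bsub>P\<^esub> y \<in> fst ` H" if "x \<in> fst ` H" "y \<in> fst ` H" for x y
      using that Hp(3) by (force simp: W_def)
    show "a \<odot>\<^bsub>P\<^esub> x \<in> fst ` H" if "a \<in> carrier R" "x \<in> fst ` H" for a x
      using that Hp(4) by (force simp: W_def)
    show "S \<subseteq> fst ` H" using H(2) by force
  qed
  define eH where "eH = inv_into UNIV \<epsilon>"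
  define eP where "eP = inv_into UNIV \<epsilon>P"
  have eH: "\<epsilon> (eH w) = w" if "w \<in> H" for w
    unfolding eH_def using that H(3) f_inv_into_f[of w \<epsilon> UNIV] by blast
  have eP: "\<epsilon>P (eP p) = p" if "p \<in> carrier P" for p
    unfolding eP_def using that \<epsilon>P f_inv_into_f[of p \<epsilon>P UNIV] by blast
  define N' :: "('a, nat \<Rightarrow> 'a) module" where
    "N' = \<lparr>carrier = eH ` H, mult = undefined, one = undefined, zero = eH \<zero>\<^bsub>W\<^esub>,
      add = (\<lambda>u v. eH (\<epsilon> u \<oplus>\<^bsub>W\<^esub> \<epsilon> v)), smult = (\<lambda>a u. eH (a \<odot>\<^bsub>W\<^esub> \<epsilon> u))\<rparr>"
  define L' :: "('a, nat \<Rightarrow> 'a) module" where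
    "L' = \<lparr>carrier = eP ` carrier P, mult = undefined, one = undefined, zero = eP \<zero>\<^bsub>P\<^esub>,
      add = (\<lambda>u v. eP (\<epsilon>P u \<oplus>\<^bsub>P\<^esub> \<epsilon>P v)), smult = (\<lambda>a u. eP (a \<odot>\<^bsub>P\<^esub> \<epsilon>P u))\<rparr>"
  have N': "left_module R N'" unfolding N'_def by (rule W.submodule_copy[OF H(1)]) (rule eH)
  have "submodule (carrier P) R P" by (rule P.left_submoduleI) auto
  then have L': "left_module R L'" unfolding L'_def by (rule P.submodule_copy) (rule eP)
  have Hc: "fst w \<in> carrier P" "snd w \<in> carrier N" "f (fst w) = g (snd w)" if "w \<in> H" for w
    using Hp(1) that by (auto simp: W_def)
  have sum: "fst (v \<oplus>\<^bsub>W\<^esub> w) = fst v \<oplus>\<^bsub>P\<^esub> fst w" "snd (v \<oplus>\<^bsub>W\<^esub> w) = snd v \<oplus>\<^bsub>N\<^esub> snd w"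
      "fst (a \<odot>\<^bsub>W\<^esub> w) = a \<odot>\<^bsub>P\<^esub> fst w" "snd (a \<odot>\<^bsub>W\<^esub> w) = a \<odot>\<^bsub>N\<^esub> snd w" for v w a
    by (auto simp: W_def split: prod.splits)
  define g' where "g' = (\<lambda>u\<in>carrier N'. eP (fst (\<epsilon> u)))"
  define f' where "f' = (\<lambda>p\<in>carrier P. eP p)"
  have Hfst: "p \<in> carrier P" if "(p, x) \<in> H" for p x
    using Hc(1)[OF that] by simp
  have g': "g' \<in> left_hom R N' L'"
    unfolding left_hom_def g'_def
    by (auto simp: N'_def L'_def eH eP Hc Hp(3,4) sum intro!: imageI dest: Hfst)
  have f': "f' \<in> left_hom R P L'"
    unfolding left_hom_def f'_def by (auto simp: L'_def eP)
  have "g' ` carrier N' = (\<lambda>w. eP (fst w)) ` H"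
  proof -
    have "g' (eH w) = eP (fst w)" if "w \<in> H" for w
      using that eH[OF that] by (simp add: g'_def N'_def)
    moreover have "g' ` carrier N' = (\<lambda>w. g' (eH w)) ` H"
      by (simp only: N'_def partial_object.select_convs image_image)
    ultimately show ?thesis by simp
  qed
  also have "\<dots> = eP ` (fst ` H)" by (simp only: image_image)
  finally have "g' ` carrier N' = eP ` (fst ` H)" .
  then have surj': "g' ` carrier N' = carrier L'" by (simp add: fstH L'_def)
  obtain h where h: "h \<in> left_hom R P N'" "\<And>x. x \<in> carrier P \<Longrightarrow> g' (h x) = f' x"
    using P[unfolded fg_projective_def, THEN conjunct2, THEN conjunct2, THEN spec[of _ N'],
        THEN spec[of _ L'], THEN spec[of _ g'], THEN spec[of _ f']] N' L' g' surj' f' by blast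
  note hD = left_homD[OF h(1)]
  have hH: "\<epsilon> (h x) \<in> H" "h x \<in> carrier N'" if "x \<in> carrier P" for x
    using hD(1)[OF that] by (auto simp: N'_def eH)
  have hfst: "fst (\<epsilon> (h x)) = x" if "x \<in> carrier P" for x
  proof -
    have "eP (fst (\<epsilon> (h x))) = eP x" using h(2)[OF that] that hH(2)[OF that] by (simp add: g'_def f'_def)
    then show ?thesis using eP[OF that] eP[OF Hc(1)[OF hH(1)[OF that]]] by metis
  qed
  define k where "k = (\<lambda>x\<in>carrier P. snd (\<epsilon> (h x)))"
  have "\<epsilon> (h (x \<oplus>\<^bsub>P\<^esub> y)) = \<epsilon> (h x) \<oplus>\<^bsub>W\<^esub> \<epsilon> (h y)" if "x \<in> carrier P" "y \<in> carrier P" for x y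
    using hD(2)[OF that] that hH Hp(3) by (simp add: N'_def eH)
  moreover have "\<epsilon> (h (a \<odot>\<^bsub>P\<^esub> x)) = a \<odot>\<^bsub>W\<^esub> \<epsilon> (h x)" if "a \<in> carrier R" "x \<in> carrier P" for a x
    using hD(3)[OF that] that hH Hp(4) by (simp add: N'_def eH)
  ultimately have "k \<in> left_hom R P N"
    unfolding left_hom_def k_def by (auto simp: sum Hc hH)
  moreover have "g (k x) = f x" if "x \<in> carrier P" for x
    using Hc(3)[OF hH(1)[OF that]] hfst[OF that] that by (simp add: k_def)
  ultimately show ?thesis by blast
qed


section \<open>Adic completeness\<close>

primrec ideal_pow :: "('a, 'r) ring_scheme \<Rightarrow> 'a set \<Rightarrow> nat \<Rightarrow> 'a set"
  where
    "ideal_pow R I 0 = carrier R"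
  | "ideal_pow R I (Suc i) = ideal_prod R (ideal_pow R I i) I"

text \<open>
  The inverse limit of the rings \<open>R / I\<^sup>i\<close> inside their product. The transition map
  \<open>R / I\<^bsup>i+1\<^esup> \<rightarrow> R / I\<^sup>i\<close> sends a coset \<open>X\<close> to \<open>I\<^sup>i + X\<close>. The factor for \<open>i = 0\<close> is the zero
  ring and does not affect the limit.
\<close>

definition adic_limit :: "('a, 'r) ring_scheme \<Rightarrow> 'a set \<Rightarrow> (nat \<Rightarrow> 'a set) ring"
  where "adic_limit R I =
    \<lparr>carrier = {s. (\<forall>i. s i \<in> carrier (R Quot ideal_pow R I i)) \<and>
                   (\<forall>i. ideal_pow R I i <+>\<^bsub>R\<^esub> s (Suc i) = s i)},
     mult = (\<lambda>s t i. s i \<otimes>\<^bsub>R Quot ideal_pow R I i\<^esub> t i),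
     one = (\<lambda>i. \<one>\<^bsub>R Quot ideal_pow R I i\<^esub>),
     zero = (\<lambda>i. \<zero>\<^bsub>R Quot ideal_pow R I i\<^esub>),
     add = (\<lambda>s t i. s i \<oplus>\<^bsub>R Quot ideal_pow R I i\<^esub> t i)\<rparr>"

definition adic_complete :: "('a, 'r) ring_scheme \<Rightarrow> 'a set \<Rightarrow> bool"
  where "adic_complete R I \<longleftrightarrow>
    (\<lambda>r i. ideal_pow R I i +>\<^bsub>R\<^esub> r) \<in> ring_iso R (adic_limit R I)"


section \<open>Additive categories and Krull-Schmidt categories\<close>

text \<open>
  Composition, addition and zero take the objects as arguments, since hom sets of different pairs
  of objects are not required to be disjoint. \<open>Comp C X Y Z g f\<close> is the composite of
  \<open>f : X \<rightarrow> Y\<close> followed by \<open>g : Y \<rightarrow> Z\<close>.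
\<close>

record ('o, 'm) precat =
  Obj :: "'o set"
  Hom :: "'o \<Rightarrow> 'o \<Rightarrow> 'm set"
  Id :: "'o \<Rightarrow> 'm"
  Comp :: "'o \<Rightarrow> 'o \<Rightarrow> 'o \<Rightarrow> 'm \<Rightarrow> 'm \<Rightarrow> 'm"
  Add :: "'o \<Rightarrow> 'o \<Rightarrow> 'm \<Rightarrow> 'm \<Rightarrow> 'm"
  Zero :: "'o \<Rightarrow> 'o \<Rightarrow> 'm"

definition hom_group :: "('o, 'm) precat \<Rightarrow> 'o \<Rightarrow> 'o \<Rightarrow> 'm monoid"
  where "hom_group C X Y = \<lparr>carrier = Hom C X Y, mult = Add C X Y, one = Zero C X Y\<rparr>"

definition End_ring :: "('o, 'm) precat \<Rightarrow> 'o \<Rightarrow> 'm ring"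
  where "End_ring C X =
    \<lparr>carrier = Hom C X X, mult = Comp C X X X, one = Id C X, zero = Zero C X X, add = Add C X X\<rparr>"

locale preadditive_category =
  fixes C :: "('o, 'm) precat"
  assumes id_closed: "X \<in> Obj C \<Longrightarrow> Id C X \<in> Hom C X X"
    and comp_closed: "\<lbrakk>X \<in> Obj C; Y \<in> Obj C; Z \<in> Obj C; f \<in> Hom C X Y; g \<in> Hom C Y Z\<rbrakk> \<Longrightarrow>
      Comp C X Y Z g f \<in> Hom C X Z"
    and comp_assoc: "\<lbrakk>W \<in> Obj C; X \<in> Obj C; Y \<in> Obj C; Z \<in> Obj C;
        f \<in> Hom C W X; g \<in> Hom C X Y; h \<in> Hom C Y Z\<rbrakk> \<Longrightarrow>
      Comp C W X Z (Comp C X Y Z h g) f = Comp C W Y Z h (Comp C W X Y g f)"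
    and comp_id_left: "\<lbrakk>X \<in> Obj C; Y \<in> Obj C; f \<in> Hom C X Y\<rbrakk> \<Longrightarrow> Comp C X Y Y (Id C Y) f = f"
    and comp_id_right: "\<lbrakk>X \<in> Obj C; Y \<in> Obj C; f \<in> Hom C X Y\<rbrakk> \<Longrightarrow> Comp C X X Y f (Id C X) = f"
    and hom_comm_group: "\<lbrakk>X \<in> Obj C; Y \<in> Obj C\<rbrakk> \<Longrightarrow> comm_group (hom_group C X Y)"
    and comp_add_left: "\<lbrakk>X \<in> Obj C; Y \<in> Obj C; Z \<in> Obj C;
        f \<in> Hom C X Y; g \<in> Hom C Y Z; g' \<in> Hom C Y Z\<rbrakk> \<Longrightarrow>
      Comp C X Y Z (Add C Y Z g g') f = Add C X Z (Comp C X Y Z g f) (Comp C X Y Z g' f)"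
    and comp_add_right: "\<lbrakk>X \<in> Obj C; Y \<in> Obj C; Z \<in> Obj C;
        f \<in> Hom C X Y; f' \<in> Hom C X Y; g \<in> Hom C Y Z\<rbrakk> \<Longrightarrow>
      Comp C X Y Z g (Add C X Y f f') = Add C X Z (Comp C X Y Z g f) (Comp C X Y Z g f')"

text \<open>\<open>X\<close> is a biproduct of \<open>Y 0, \<dots>, Y (n - 1)\<close>; for \<open>n = 0\<close> this says that \<open>X\<close> is a zero object.\<close>

definition is_direct_sum :: "('o, 'm) precat \<Rightarrow> nat \<Rightarrow> (nat \<Rightarrow> 'o) \<Rightarrow> 'o \<Rightarrow> bool"
  where "is_direct_sum C n Y X \<longleftrightarrow> X \<in> Obj C \<and> (\<forall>i<n. Y i \<in> Obj C) \<and>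
    (\<exists>\<iota> \<pi>. (\<forall>i<n. \<iota> i \<in> Hom C (Y i) X \<and> \<pi> i \<in> Hom C X (Y i)) \<and>
      (\<forall>i<n. \<forall>j<n. Comp C (Y j) X (Y i) (\<pi> i) (\<iota> j) =
         (if i = j then Id C (Y i) else Zero C (Y j) (Y i))) \<and>
      finprod (hom_group C X X) (\<lambda>i. Comp C X (Y i) X (\<iota> i) (\<pi> i)) {..<n} = Id C X)"

locale additive_category = preadditive_category +
  assumes finite_direct_sums:
    "(\<And>i. i < n \<Longrightarrow> Y i \<in> Obj C) \<Longrightarrow> \<exists>X. is_direct_sum C n Y X"

text \<open>
  The non-units form a two-sided ideal. This excludes the zero ring, where the set of non-units
  is empty.
\<close>

definition local_ring :: "('a, 'r) ring_scheme \<Rightarrow> bool"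
  where "local_ring E \<longleftrightarrow> ring E \<and> ideal (carrier E - Units E) E"

definition krull_schmidt :: "('o, 'm) precat \<Rightarrow> bool"
  where "krull_schmidt C \<longleftrightarrow> additive_category C \<and>
    (\<forall>X\<in>Obj C. \<exists>n Y. is_direct_sum C n Y X \<and> (\<forall>i<n. local_ring (End_ring C (Y i))))"


section \<open>Bounded complexes of finitely generated projective modules\<close>

text \<open>
  All modules occurring in a complex are carried by one type \<^typ>\<open>'b\<close>, which plays the role of a
  universe. Finite direct sums of such complexes exist whenever \<^typ>\<open>'b\<close> is infinite. For
  \<^typ>\<open>'b\<close> admitting an injection from \<^typ>\<open>nat \<Rightarrow> 'a\<close>, every finitely generated module over a
  ring with elements in \<^typ>\<open>'a\<close> has an isomorphic copy carried by \<^typ>\<open>'b\<close>.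
\<close>

record ('a, 'b) cochain_complex =
  ob :: "int \<Rightarrow> ('a, 'b) module"
  diff :: "int \<Rightarrow> 'b \<Rightarrow> 'b"

definition bounded_proj_complex ::
    "('a, 'r) ring_scheme \<Rightarrow> ('a, 'b) cochain_complex \<Rightarrow> bool"
  where "bounded_proj_complex R X \<longleftrightarrow>
    (\<forall>n. fg_projective R (ob X n)) \<and>
    (\<forall>n. diff X n \<in> left_hom R (ob X n) (ob X (n + 1))) \<and>
    (\<forall>n. \<forall>x\<in>carrier (ob X n). diff X (n + 1) (diff X n x) = \<zero>\<^bsub>ob X (n + 2)\<^esub>) \<and>
    (\<exists>b. \<forall>n. b < \<bar>n\<bar> \<longrightarrow> carrier (ob X n) = {\<zero>\<^bsub>ob X n\<^esub>})"

definition chain_maps ::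
    "('a, 'r) ring_scheme \<Rightarrow> ('a, 'b) cochain_complex \<Rightarrow> ('a, 'b) cochain_complex \<Rightarrow> (int \<Rightarrow> 'b \<Rightarrow> 'b) set"
  where "chain_maps R X Y = {f. (\<forall>n. f n \<in> left_hom R (ob X n) (ob Y n)) \<and>
    (\<forall>n. \<forall>x\<in>carrier (ob X n). diff Y n (f n x) = f (n + 1) (diff X n x))}"

definition Cb_proj ::
    "('a, 'r) ring_scheme \<Rightarrow> (('a, 'b) cochain_complex, int \<Rightarrow> 'b \<Rightarrow> 'b) precat"
  where "Cb_proj R =
    \<lparr>Obj = {X. bounded_proj_complex R X},
     Hom = chain_maps R,
     Id = (\<lambda>X n. \<lambda>x\<in>carrier (ob X n). x),
     Comp = (\<lambda>X Y Z g f n. \<lambda>x\<in>carrier (ob X n). g n (f n x)),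
     Add = (\<lambda>X Y f g n. \<lambda>x\<in>carrier (ob X n). f n x \<oplus>\<^bsub>ob Y n\<^esub> g n x),
     Zero = (\<lambda>X Y n. \<lambda>x\<in>carrier (ob X n). \<zero>\<^bsub>ob Y n\<^esub>)\<rparr>"

definition homotopy_rel ::
    "('a, 'r) ring_scheme \<Rightarrow> ('a, 'b) cochain_complex \<Rightarrow> ('a, 'b) cochain_complex \<Rightarrow>
      ((int \<Rightarrow> 'b \<Rightarrow> 'b) \<times> (int \<Rightarrow> 'b \<Rightarrow> 'b)) set"
  where "homotopy_rel R X Y = {(f, g). f \<in> chain_maps R X Y \<and> g \<in> chain_maps R X Y \<and>
    (\<exists>h. (\<forall>n. h n \<in> left_hom R (ob X n) (ob Y (n - 1))) \<and>
      (\<forall>n. \<forall>x\<in>carrier (ob X n).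
         f n x \<ominus>\<^bsub>ob Y n\<^esub> g n x = diff Y (n - 1) (h n x) \<oplus>\<^bsub>ob Y n\<^esub> h (n + 1) (diff X n x)))}"

text \<open>Morphisms are homotopy classes; the operations on classes are induced by representatives.\<close>

definition Kb_proj ::
    "('a, 'r) ring_scheme \<Rightarrow> (('a, 'b) cochain_complex, (int \<Rightarrow> 'b \<Rightarrow> 'b) set) precat"
  where "Kb_proj R =
    \<lparr>Obj = Obj (Cb_proj R),
     Hom = (\<lambda>X Y. Hom (Cb_proj R) X Y // homotopy_rel R X Y),
     Id = (\<lambda>X. homotopy_rel R X X `` {Id (Cb_proj R) X}),
     Comp = (\<lambda>X Y Z G F. \<Union>g\<in>G. \<Union>f\<in>F. homotopy_rel R X Z `` {Comp (Cb_proj R) X Y Z g f}),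
     Add = (\<lambda>X Y F G. \<Union>f\<in>F. \<Union>g\<in>G. homotopy_rel R X Y `` {Add (Cb_proj R) X Y f g}),
     Zero = (\<lambda>X Y. homotopy_rel R X Y `` {Zero (Cb_proj R) X Y})\<rparr>"

end

theory Submission
  imports Defs
begin

text \<open>
  Let \<open>f\<close> be an endomorphism of a complex \<open>X\<close> and filter each term \<open>P\<close> of \<open>X\<close> by the submodules
  \<open>K\<^sub>i = \<mm>\<^sup>i P\<close>. As \<open>P / K\<^sub>i\<close> has finite length, Fitting's lemma splits it, and as \<open>P\<close> is complete,
  these splittings combine to \<open>P = P' \<oplus> P''\<close> with
  \<open>P' = \<Inter>\<^sub>i \<Inter>\<^sub>k (f\<^sup>k P + K\<^sub>i)\<close> and \<open>P'' = \<Inter>\<^sub>i \<Union>\<^sub>k (f\<^sup>k)\<^sup>-\<^sup>1 K\<^sub>i\<close>, where \<open>f\<close> is bijective on \<open>P'\<close> and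
  \<open>1 - f\<close> is bijective on \<open>P''\<close>. The submodules are natural in \<open>(P, f)\<close>, so they form subcomplexes
  of \<open>X\<close>. Hence a nonzero complex either has a local endomorphism ring or is a direct sum of two
  proper subcomplexes. By Nakayama's lemma, a strictly descending chain of direct summands stays strict
  modulo \<open>\<mm>\<close>, so the splitting process terminates, which proves (a). For (b), the quotient of a
  local ring by an ideal is local or zero, and a complex whose identity is null-homotopic is a
  zero object that can be dropped from the decomposition.
\<close>

text \<open>The exponent at which the Fitting chains of f become stationary depends on the level i
  and on the degree, so no single power of f gives the splitting; this is why the formulas for P'
  and P'' run over all levels and all powers. They involve no choice, which is what makes them
  natural. The levelwise splittings are glued by one device: at level i the admissible elements form
  a coset of \<open>K i\<close>, and nested cosets have a common point by completeness. On P'' the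
  map f is nilpotent modulo each level, so 1 - f is inverted by a geometric series. Units among f
  and 1 - f are exactly what the locality criterion asks for: a nonzero ring is local if for every a
  one of a and 1 - a is a unit. If f yields no proper splitting, then P' or P'' is everything in all
  degrees at once. Finite length is given only modulo powers of \<mm>, so termination must be read
  off there; the retractions onto two nested summands that agree modulo \<mm> combine to an
  idempotent with image in \<mm> P, and this must vanish.\<close>

section \<open>Local rings\<close>

context ring
begin

lemma unit_if_mult_unit_left:
  assumes "a \<in> Units R" "b \<in> carrier R" "a \<otimes> b \<in> Units R"
  shows "b \<in> Units R"
proof -
  have "b = inv a \<otimes> (a \<otimes> b)"
    using assms(1,2) by (simp add: m_assoc[symmetric] Units_closed)
  then show ?thesis
    using assms by (metis Units_inv_Units Units_m_closed)
qed

text \<open>An idempotent e satisfies (1 - e) e = 0, and cancelling the unit among e and 1 - e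
  leaves e = 1 or e = 0. Hence one-sided inverses are two-sided: if a b = 1, then b a is idempotent,
  and it is nonzero because 1 = a (b a) b. So factors of units are units, and a sum a + b = u with u
  a unit rescales to a \<open>inv u\<close> + b \<open>inv u\<close> = 1, where the dichotomy
  applies.\<close>

lemma local_ringI:
  assumes nz: "\<one> \<noteq> \<zero>"
    and alt: "\<And>a. a \<in> carrier R \<Longrightarrow> a \<in> Units R \<or> \<one> \<ominus> a \<in> Units R"
  shows "local_ring R"
proof -
  have idem: "e = \<one> \<or> e = \<zero>" if e: "e \<in> carrier R" "e \<otimes> e = e" for e
  proof -
    have z: "(\<one> \<ominus> e) \<otimes> e = \<zero>"
      using e by (simp add: a_minus_def l_distr l_minus r_neg)
    show ?thesis
    proof (cases "e \<in> Units R")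
      case True
      then show ?thesis using e Units_l_cancel[of e e \<one>] by simp
    next
      case False
      then have "\<one> \<ominus> e \<in> Units R" using alt e by blast
      then show ?thesis using z e Units_l_cancel[of "\<one> \<ominus> e" e \<zero>] by (simp add: Units_closed)
    qed
  qed
  have inv_r: "a \<in> Units R" if ab: "a \<in> carrier R" "b \<in> carrier R" "a \<otimes> b = \<one>" for a b
  proof -
    have "(b \<otimes> a) \<otimes> (b \<otimes> a) = b \<otimes> ((a \<otimes> b) \<otimes> a)"
      using ab(1,2) by (simp add: m_assoc)
    then have "(b \<otimes> a) \<otimes> (b \<otimes> a) = b \<otimes> a" using ab by simp
    then have "b \<otimes> a = \<one> \<or> b \<otimes> a = \<zero>" using idem ab by simp
    moreover have "b \<otimes> a \<noteq> \<zero>"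
    proof
      assume z: "b \<otimes> a = \<zero>"
      have "\<one> = (a \<otimes> b) \<otimes> (a \<otimes> b)" using ab by simp
      also have "\<dots> = a \<otimes> (b \<otimes> a) \<otimes> b" using ab(1,2) by (simp add: m_assoc)
      also have "\<dots> = \<zero>" using z ab by simp
      finally show False using nz by simp
    qed
    ultimately show ?thesis using ab by (auto simp: Units_def)
  qed
  have prod: "a \<in> Units R \<and> b \<in> Units R"
    if ab: "a \<in> carrier R" "b \<in> carrier R" "a \<otimes> b \<in> Units R" for a b
  proof -
    have "a \<otimes> (b \<otimes> inv (a \<otimes> b)) = \<one>"
      using ab by (simp add: m_assoc[symmetric])
    then have "a \<in> Units R" using ab inv_r by (metis Units_inv_closed m_closed)
    then show ?thesis using unit_if_mult_unit_left ab by blast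
  qed
  have sum: "a \<in> Units R \<or> b \<in> Units R"
    if ab: "a \<in> carrier R" "b \<in> carrier R" "a \<oplus> b \<in> Units R" for a b
  proof -
    define u where "u = a \<oplus> b"
    have u: "u \<in> Units R" "inv u \<in> carrier R" using ab by (auto simp: u_def)
    have "a \<otimes> inv u \<oplus> b \<otimes> inv u = \<one>"
      using ab u by (metis Units_r_inv l_distr u_def)
    then have "b \<otimes> inv u = \<one> \<ominus> a \<otimes> inv u"
      using ab(1,2) u(2) r_neg1[of "a \<otimes> inv u" "b \<otimes> inv u"]
      by (metis a_minus_def add.inv_closed local.add.m_comm m_closed one_closed)
    then have "a \<otimes> inv u \<in> Units R \<or> b \<otimes> inv u \<in> Units R"
      using alt[of "a \<otimes> inv u"] ab(1) u(2) by simp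
    then show ?thesis
      using prod[of a "inv u"] prod[of b "inv u"] ab(1,2) u(2) by blast
  qed
  have "ideal (carrier R - Units R) R"
  proof (rule idealI)
    show "ring R" by (rule ring_axioms)
    have zero: "\<zero> \<notin> Units R" using nz by (metis Units_r_inv_ex l_null)
    show "subgroup (carrier R - Units R) (add_monoid R)"
    proof (rule add.subgroupI)
      show "carrier R - Units R \<noteq> {}" using zero by blast
      show "\<ominus> a \<in> carrier R - Units R" if "a \<in> carrier R - Units R" for a
      proof -
        have "\<ominus> \<one> \<in> carrier R" "\<ominus> \<one> \<otimes> \<ominus> \<one> = \<one>" by (simp_all add: l_minus r_minus)
        then have "\<ominus> \<one> \<in> Units R" by (auto simp: Units_def)
        moreover have "\<ominus> a = \<ominus> \<one> \<otimes> a" using that by (simp add: l_minus)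
        ultimately show ?thesis using unit_if_mult_unit_left[of "\<ominus> \<one>" a] that by auto
      qed
      show "a \<oplus> b \<in> carrier R - Units R" if "a \<in> carrier R - Units R" "b \<in> carrier R - Units R" for a b
        using sum[of a b] that by blast
    qed blast
  qed (use prod m_closed in blast)+
  then show ?thesis using ring_axioms by (simp add: local_ring_def)
qed

end

text \<open>Two non-units a and 1 - a would put their sum 1 into the ideal of non-units.\<close>

lemma local_ring_unit_or_one_minus:
  assumes "local_ring E" "a \<in> carrier E"
  shows "a \<in> Units E \<or> \<one>\<^bsub>E\<^esub> \<ominus>\<^bsub>E\<^esub> a \<in> Units E"
proof (rule ccontr)
  interpret ring E using assms by (simp add: local_ring_def)
  interpret I: ideal "carrier E - Units E" E using assms by (simp add: local_ring_def)
  assume "\<not> ?thesis"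
  then have "(\<one>\<^bsub>E\<^esub> \<ominus>\<^bsub>E\<^esub> a) \<oplus>\<^bsub>E\<^esub> a \<in> carrier E - Units E"
    using assms(2) by (intro I.a_closed) auto
  moreover have "(\<one>\<^bsub>E\<^esub> \<ominus>\<^bsub>E\<^esub> a) \<oplus>\<^bsub>E\<^esub> a = \<one>\<^bsub>E\<^esub>"
    using assms(2) by (simp add: a_minus_def a_assoc l_neg)
  ultimately show False by auto
qed

text \<open>Ring homomorphisms preserve units, so the dichotomy between a and 1 - a passes to the
  image; together with 1 being nonzero it gives locality by \<open>local_ringI\<close>.\<close>

lemma local_ring_hom_image:
  assumes E: "local_ring E" and F: "ring F" and h: "h \<in> ring_hom E F"
    and surj: "h ` carrier E = carrier F" and nz: "\<one>\<^bsub>F\<^esub> \<noteq> \<zero>\<^bsub>F\<^esub>"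
  shows "local_ring F"
proof (rule ring.local_ringI[OF F nz])
  interpret E: ring E using E by (simp add: local_ring_def)
  interpret F: ring F by fact
  interpret h: ring_hom_ring E F h
    using h by (intro ring_hom_ring.intro ring_hom_ring_axioms.intro E.ring_axioms F.ring_axioms)
  have unit: "h x \<in> Units F" if x: "x \<in> Units E" for x
  proof -
    have "h x \<otimes>\<^bsub>F\<^esub> h (inv\<^bsub>E\<^esub> x) = \<one>\<^bsub>F\<^esub>" "h (inv\<^bsub>E\<^esub> x) \<otimes>\<^bsub>F\<^esub> h x = \<one>\<^bsub>F\<^esub>"
      using x by (simp_all add: E.Units_closed flip: h.hom_mult)
    then show ?thesis using h.hom_closed[OF E.Units_inv_closed[OF x]] h.hom_closed[OF E.Units_closed[OF x]]
      unfolding Units_def by blast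
  qed
  fix b assume "b \<in> carrier F"
  then obtain a where a: "a \<in> carrier E" "b = h a" using surj by auto
  have "\<one>\<^bsub>F\<^esub> \<ominus>\<^bsub>F\<^esub> b = h (\<one>\<^bsub>E\<^esub> \<ominus>\<^bsub>E\<^esub> a)"
    using a by (simp add: a_minus_def)
  then show "b \<in> Units F \<or> \<one>\<^bsub>F\<^esub> \<ominus>\<^bsub>F\<^esub> b \<in> Units F"
    using local_ring_unit_or_one_minus[OF E a(1)] unit a(2) by auto
qed

section \<open>Biproducts and quotients of preadditive categories\<close>

lemma (in comm_monoid) hom_finprod_gen:
  assumes H: "comm_monoid H" and h: "\<And>x. x \<in> carrier G \<Longrightarrow> h x \<in> carrier H"
    "\<And>x y. \<lbrakk>x \<in> carrier G; y \<in> carrier G\<rbrakk> \<Longrightarrow> h (x \<otimes> y) = h x \<otimes>\<^bsub>H\<^esub> h y" "h \<one> = \<one>\<^bsub>H\<^esub>"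
    and f: "f \<in> A \<rightarrow> carrier G"
  shows "h (finprod G f A) = finprod H (\<lambda>i. h (f i)) A"
  using f
proof (induction A rule: infinite_finite_induct)
  case (infinite A)
  \<comment> \<open>By convention a product over an infinite set is the unit, and h preserves the
    unit.\<close>
  then show ?case by (simp add: comm_monoid.finprod_infinite[OF H] h)
next
  case empty
  then show ?case by (simp add: comm_monoid.finprod_empty[OF H] h)
next
  case (insert a A)
  then have "(\<lambda>i. h (f i)) \<in> A \<rightarrow> carrier H" "h (f a) \<in> carrier H" using h(1) by auto
  then show ?case using insert by (simp add: comm_monoid.finprod_insert[OF H] h finprod_closed Pi_iff)
qed

text \<open>The two-summand case, free of indices and \<open>finprod\<close>: the form in which
  complements of submodules are checked. \<open>is_direct_sum_append\<close> converts it to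
  \<open>is_direct_sum\<close>.\<close>

definition is_biproduct :: "('o, 'm) precat \<Rightarrow> 'o \<Rightarrow> 'o \<Rightarrow> 'o \<Rightarrow> bool"
  where "is_biproduct C X1 X2 X \<longleftrightarrow> X1 \<in> Obj C \<and> X2 \<in> Obj C \<and> X \<in> Obj C \<and>
    (\<exists>i1 i2 p1 p2. i1 \<in> Hom C X1 X \<and> i2 \<in> Hom C X2 X \<and> p1 \<in> Hom C X X1 \<and> p2 \<in> Hom C X X2 \<and>
      Comp C X1 X X1 p1 i1 = Id C X1 \<and> Comp C X2 X X2 p2 i2 = Id C X2 \<and>
      Comp C X1 X X2 p2 i1 = Zero C X1 X2 \<and> Comp C X2 X X1 p1 i2 = Zero C X2 X1 \<and>
      Add C X X (Comp C X X1 X i1 p1) (Comp C X X2 X i2 p2) = Id C X)"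

definition ks_decomposable :: "('o, 'm) precat \<Rightarrow> 'o \<Rightarrow> bool"
  where "ks_decomposable C X \<longleftrightarrow>
    (\<exists>n Y. is_direct_sum C n Y X \<and> (\<forall>i<n. local_ring (End_ring C (Y i))))"

lemma is_direct_sumE:
  assumes "is_direct_sum C n Y X"
  obtains \<iota> \<pi> where "\<And>i. i < n \<Longrightarrow> \<iota> i \<in> Hom C (Y i) X" "\<And>i. i < n \<Longrightarrow> \<pi> i \<in> Hom C X (Y i)"
    "\<And>i j. i < n \<Longrightarrow> j < n \<Longrightarrow> Comp C (Y j) X (Y i) (\<pi> i) (\<iota> j) =
         (if i = j then Id C (Y i) else Zero C (Y j) (Y i))"
    "finprod (hom_group C X X) (\<lambda>i. Comp C X (Y i) X (\<iota> i) (\<pi> i)) {..<n} = Id C X"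
  using assms unfolding is_direct_sum_def by (elim conjE exE) (rule that; simp)

context preadditive_category
begin

lemma hom_group_simps [simp]:
  "carrier (hom_group C X Y) = Hom C X Y" "mult (hom_group C X Y) = Add C X Y"
  "one (hom_group C X Y) = Zero C X Y"
  by (simp_all add: hom_group_def)

lemma zero_closed: "X \<in> Obj C \<Longrightarrow> Y \<in> Obj C \<Longrightarrow> Zero C X Y \<in> Hom C X Y"
  using monoid.one_closed[OF group.is_monoid[OF comm_group.axioms(2)[OF hom_comm_group]]] by simp

lemma add_closed:
  assumes "X \<in> Obj C" "Y \<in> Obj C" "f \<in> Hom C X Y" "g \<in> Hom C X Y"
  shows "Add C X Y f g \<in> Hom C X Y"
proof -
  interpret G: comm_group "hom_group C X Y" using hom_comm_group assms by simp
  show ?thesis using G.m_closed[of f g] assms by simp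
qed

lemma add_self_zero:
  assumes "X \<in> Obj C" "Y \<in> Obj C" "f \<in> Hom C X Y" "Add C X Y f f = f"
  shows "f = Zero C X Y"
proof -
  interpret G: comm_group "hom_group C X Y" using hom_comm_group assms by simp
  show ?thesis using G.l_cancel_one[of f f] assms by simp
qed

lemma comp_zero_right:
  assumes "X \<in> Obj C" "Y \<in> Obj C" "Z \<in> Obj C" "g \<in> Hom C Y Z"
  shows "Comp C X Y Z g (Zero C X Y) = Zero C X Z"
proof -
  interpret G: comm_group "hom_group C X Y" using hom_comm_group assms by simp
  have "Add C X Y (Zero C X Y) (Zero C X Y) = Zero C X Y" using G.l_one[OF G.one_closed] by simp
  then show ?thesis
    using comp_add_right[OF assms(1-3) _ _ assms(4)] zero_closed[of X Y] assms
    by (intro add_self_zero comp_closed) metis+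
qed

lemma comp_zero_left:
  assumes "X \<in> Obj C" "Y \<in> Obj C" "Z \<in> Obj C" "f \<in> Hom C X Y"
  shows "Comp C X Y Z (Zero C Y Z) f = Zero C X Z"
proof -
  interpret G: comm_group "hom_group C Y Z" using hom_comm_group assms by simp
  have "Add C Y Z (Zero C Y Z) (Zero C Y Z) = Zero C Y Z" using G.l_one[OF G.one_closed] by simp
  then show ?thesis
    using comp_add_left[OF assms(1-4)] zero_closed[of Y Z] assms
    by (intro add_self_zero comp_closed) metis+
qed

lemma comp_finprod:
  assumes "W \<in> Obj C" "X \<in> Obj C" "Y \<in> Obj C" "Z \<in> Obj C" "g \<in> Hom C Y Z" "f \<in> Hom C W X"
    and "a \<in> A \<rightarrow> Hom C X Y"
  shows "Comp C W X Z (Comp C X Y Z g (finprod (hom_group C X Y) a A)) f =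
    finprod (hom_group C W Z) (\<lambda>i. Comp C W X Z (Comp C X Y Z g (a i)) f) A"
proof -
  interpret G: comm_group "hom_group C X Y" using hom_comm_group assms by simp
  show ?thesis
    by (rule G.hom_finprod_gen[where h = "\<lambda>x. Comp C W X Z (Comp C X Y Z g x) f"])
      (use assms hom_comm_group[of W Z] in \<open>auto simp: comm_group_def comp_add_right comp_add_left
        comp_zero_right comp_zero_left comp_closed\<close>)
qed

lemma ring_End:
  assumes "X \<in> Obj C"
  shows "ring (End_ring C X)"
proof (rule ringI)
  have "add_monoid (End_ring C X) = hom_group C X X" by (simp add: End_ring_def hom_group_def)
  then have "comm_group (add_monoid (End_ring C X))" using hom_comm_group assms by simp
  then show "abelian_group (End_ring C X)" by (rule comm_group_abelian_groupI)
  show "Group.monoid (End_ring C X)"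
    using assms by (intro monoidI)
      (auto simp: End_ring_def comp_closed id_closed comp_assoc comp_id_left comp_id_right)
qed (use assms in \<open>auto simp: End_ring_def comp_add_left comp_add_right\<close>)

text \<open>All injections and projections factor through X1 or X2. Inserting the given
  decompositions of the identities of X1 and X2 into i1 p1 + i2 p2 = 1 expands the identity of X
  into n + m terms.\<close>

lemma is_direct_sum_append:
  assumes Y: "is_direct_sum C n Y X1" and Z: "is_direct_sum C m Z X2" and X: "is_biproduct C X1 X2 X"
  shows "is_direct_sum C (n + m) (\<lambda>i. if i < n then Y i else Z (i - n)) X"
proof -
  have ob: "X1 \<in> Obj C" "X2 \<in> Obj C" "X \<in> Obj C" "\<And>i. i < n \<Longrightarrow> Y i \<in> Obj C" "\<And>i. i < m \<Longrightarrow> Z i \<in> Obj C"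
    using assms by (auto simp: is_direct_sum_def is_biproduct_def)
  obtain i1 i2 p1 p2 where b: "i1 \<in> Hom C X1 X" "i2 \<in> Hom C X2 X" "p1 \<in> Hom C X X1" "p2 \<in> Hom C X X2"
    and pi: "Comp C X1 X X1 p1 i1 = Id C X1" "Comp C X2 X X2 p2 i2 = Id C X2"
      "Comp C X1 X X2 p2 i1 = Zero C X1 X2" "Comp C X2 X X1 p1 i2 = Zero C X2 X1"
    and ip: "Add C X X (Comp C X X1 X i1 p1) (Comp C X X2 X i2 p2) = Id C X"
    using X by (auto simp: is_biproduct_def)
  obtain \<iota> \<pi> where Y1: "\<And>i. i < n \<Longrightarrow> \<iota> i \<in> Hom C (Y i) X1" "\<And>i. i < n \<Longrightarrow> \<pi> i \<in> Hom C X1 (Y i)"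
    and Y2: "\<And>i j. i < n \<Longrightarrow> j < n \<Longrightarrow> Comp C (Y j) X1 (Y i) (\<pi> i) (\<iota> j) =
         (if i = j then Id C (Y i) else Zero C (Y j) (Y i))"
    and Y3: "finprod (hom_group C X1 X1) (\<lambda>i. Comp C X1 (Y i) X1 (\<iota> i) (\<pi> i)) {..<n} = Id C X1"
    by (rule is_direct_sumE[OF Y]) (rule that; assumption)
  obtain \<kappa> \<rho> where Z1: "\<And>i. i < m \<Longrightarrow> \<kappa> i \<in> Hom C (Z i) X2" "\<And>i. i < m \<Longrightarrow> \<rho> i \<in> Hom C X2 (Z i)"
    and Z2: "\<And>i j. i < m \<Longrightarrow> j < m \<Longrightarrow> Comp C (Z j) X2 (Z i) (\<rho> i) (\<kappa> j) =
         (if i = j then Id C (Z i) else Zero C (Z j) (Z i))"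
    and Z3: "finprod (hom_group C X2 X2) (\<lambda>i. Comp C X2 (Z i) X2 (\<kappa> i) (\<rho> i)) {..<m} = Id C X2"
    by (rule is_direct_sumE[OF Z]) (rule that; assumption)
  define W where "W i = (if i < n then Y i else Z (i - n))" for i
  define \<alpha> where "\<alpha> i = (if i < n then Comp C (Y i) X1 X i1 (\<iota> i)
    else Comp C (Z (i - n)) X2 X i2 (\<kappa> (i - n)))" for i
  define \<beta> where "\<beta> i = (if i < n then Comp C X X1 (Y i) (\<pi> i) p1
    else Comp C X X2 (Z (i - n)) (\<rho> (i - n)) p2)" for i
  have 1: "\<alpha> i \<in> Hom C (W i) X \<and> \<beta> i \<in> Hom C X (W i)" if "i < n + m" for i
    using that by (auto simp: \<alpha>_def \<beta>_def W_def intro!: comp_closed ob b Y1 Z1)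
  \<comment> \<open>Rebracketing moves the composite through X into the middle, where it is one of
    the four known composites of p1, p2 with i1, i2.\<close>
  have swap: "Comp C B X A (Comp C X U A q p) (Comp C B V X j k) =
      Comp C B U A q (Comp C B V U (Comp C V X U p j) k)"
    if "B \<in> Obj C" "A \<in> Obj C" "U \<in> Obj C" "V \<in> Obj C" "q \<in> Hom C U A" "p \<in> Hom C X U"
      "j \<in> Hom C V X" "k \<in> Hom C B V" for A B U V q p j k
    using that ob(3) by (simp add: comp_assoc comp_closed)
  have 2: "Comp C (W j) X (W i) (\<beta> i) (\<alpha> j) = (if i = j then Id C (W i) else Zero C (W j) (W i))"
    if "i < n + m" "j < n + m" for i j
  proof -
    have "i - n = j - n \<longleftrightarrow> i = j" if "\<not> i < n" "\<not> j < n" using that by auto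
    moreover have "i - n < m" "j - n < m" if "\<not> i < n" "\<not> j < n" using that \<open>i < n + m\<close> \<open>j < n + m\<close> by auto
    moreover have "i - n < m" if "\<not> i < n" using that \<open>i < n + m\<close> by auto
    moreover have "j - n < m" if "\<not> j < n" using that \<open>j < n + m\<close> by auto
    ultimately consider "i < n" "j < n" | "i < n" "\<not> j < n" "j - n < m"
      | "\<not> i < n" "i - n < m" "j < n"
      | "\<not> i < n" "i - n < m" "\<not> j < n" "j - n < m" "i - n = j - n \<longleftrightarrow> i = j" by blast
    then show ?thesis
    proof cases
      case 1
      then show ?thesis
        by (simp add: \<alpha>_def \<beta>_def W_def swap ob b Y1 pi comp_id_left Y2)
    next
      case 2
      then have "i \<noteq> j" by auto
      with 2 show ?thesis
        by (simp add: \<alpha>_def \<beta>_def W_def swap ob b Y1 Z1 pi comp_zero_left comp_zero_right)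
    next
      case 3
      then have "i \<noteq> j" by auto
      with 3 show ?thesis
        by (simp add: \<alpha>_def \<beta>_def W_def swap ob b Y1 Z1 pi comp_zero_left comp_zero_right)
    next
      case 4
      then show ?thesis
        by (simp add: \<alpha>_def \<beta>_def W_def swap ob b Z1 pi comp_id_left Z2)
    qed
  qed
  interpret G: comm_group "hom_group C X X" using hom_comm_group ob by simp
  let ?t = "\<lambda>i. Comp C X (W i) X (\<alpha> i) (\<beta> i)"
  have tc: "?t i \<in> Hom C X X" if "i < n + m" for i
    using 1[OF that] that ob by (intro comp_closed) (auto simp: W_def)
  have un: "{..<n + m} = {..<n} \<union> (\<lambda>i. i + n) ` {..<m}"
  proof (intro equalityI subsetI)
    show "i \<in> {..<n} \<union> (\<lambda>i. i + n) ` {..<m}" if "i \<in> {..<n + m}" for i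
      using that by (cases "i < n") (auto intro!: image_eqI[of _ _ "i - n"])
  qed auto
  have "finprod (hom_group C X X) ?t {..<n + m} = Add C X X
      (finprod (hom_group C X X) ?t {..<n}) (finprod (hom_group C X X) ?t ((\<lambda>i. i + n) ` {..<m}))"
    unfolding un using tc by (subst G.finprod_Un_disjoint) auto
  also have "finprod (hom_group C X X) ?t ((\<lambda>i. i + n) ` {..<m}) =
      finprod (hom_group C X X) (\<lambda>i. ?t (i + n)) {..<m}"
    using tc by (intro G.finprod_reindex) (auto simp: inj_on_def)
  also have "\<dots> = finprod (hom_group C X X)
      (\<lambda>i. Comp C X X2 X (Comp C X2 X2 X i2 (Comp C X2 (Z i) X2 (\<kappa> i) (\<rho> i))) p2) {..<m}"
    using Z1 b ob
    by (intro G.finprod_cong') (auto simp: W_def \<alpha>_def \<beta>_def comp_assoc comp_closed)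
  also have "\<dots> = Comp C X X2 X (Comp C X2 X2 X i2 (Id C X2)) p2"
    unfolding Z3[symmetric] using Z1 b ob by (intro comp_finprod[symmetric]) (auto simp: comp_closed)
  also have "\<dots> = Comp C X X2 X i2 p2" using ob b by (simp add: comp_id_right)
  also have "finprod (hom_group C X X) ?t {..<n} = finprod (hom_group C X X)
      (\<lambda>i. Comp C X X1 X (Comp C X1 X1 X i1 (Comp C X1 (Y i) X1 (\<iota> i) (\<pi> i))) p1) {..<n}"
    using Y1 b ob
    by (intro G.finprod_cong') (auto simp: W_def \<alpha>_def \<beta>_def comp_assoc comp_closed)
  also have "\<dots> = Comp C X X1 X (Comp C X1 X1 X i1 (Id C X1)) p1"
    unfolding Y3[symmetric] using Y1 b ob by (intro comp_finprod[symmetric]) (auto simp: comp_closed)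
  also have "\<dots> = Comp C X X1 X i1 p1" using ob b by (simp add: comp_id_right)
  finally have 3: "finprod (hom_group C X X) ?t {..<n + m} = Id C X" using ip by simp
  have "is_direct_sum C (n + m) W X"
    unfolding is_direct_sum_def using 1 2 3 ob(3) by (intro conjI exI[of _ \<alpha>] exI[of _ \<beta>])
      (auto simp: W_def ob)
  then show ?thesis unfolding W_def .
qed

lemma is_direct_sum_0:
  assumes "X \<in> Obj C" "Id C X = Zero C X X"
  shows "is_direct_sum C 0 Y X"
proof -
  interpret G: comm_group "hom_group C X X" using hom_comm_group assms by simp
  show ?thesis using assms G.finprod_empty by (simp add: is_direct_sum_def)
qed

lemma is_direct_sum_1:
  assumes "X \<in> Obj C"
  shows "is_direct_sum C (Suc 0) (\<lambda>_. X) X"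
proof -
  interpret G: comm_group "hom_group C X X" using hom_comm_group assms by simp
  have "finprod (hom_group C X X) (\<lambda>i. Comp C X X X (Id C X) (Id C X)) {0 :: nat} = Id C X"
    using G.finprod_insert[of "{}" 0 "\<lambda>_. Id C X"] assms G.r_one[of "Id C X"]
    by (simp add: comp_id_left id_closed)
  then show ?thesis
    using assms unfolding is_direct_sum_def
    by (intro conjI exI[of _ "\<lambda>_. Id C X"]) (auto simp: comp_id_left id_closed lessThan_Suc)
qed

lemma is_direct_sum_cong:
  assumes "is_direct_sum C n Y X" "\<And>i. i < n \<Longrightarrow> Y i = Z i"
  shows "is_direct_sum C n Z X"
proof -
  have ob: "X \<in> Obj C" "\<And>i. i < n \<Longrightarrow> Y i \<in> Obj C" using assms by (auto simp: is_direct_sum_def)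
  obtain \<iota> \<pi> where *: "\<forall>i<n. \<iota> i \<in> Hom C (Y i) X \<and> \<pi> i \<in> Hom C X (Y i)"
    "\<forall>i<n. \<forall>j<n. Comp C (Y j) X (Y i) (\<pi> i) (\<iota> j) = (if i = j then Id C (Y i) else Zero C (Y j) (Y i))"
    "finprod (hom_group C X X) (\<lambda>i. Comp C X (Y i) X (\<iota> i) (\<pi> i)) {..<n} = Id C X"
    using assms(1) unfolding is_direct_sum_def by (elim conjE exE) (rule that; assumption)
  interpret G: comm_group "hom_group C X X" using hom_comm_group ob by simp
  have "finprod (hom_group C X X) (\<lambda>i. Comp C X (Z i) X (\<iota> i) (\<pi> i)) {..<n} =
    finprod (hom_group C X X) (\<lambda>i. Comp C X (Y i) X (\<iota> i) (\<pi> i)) {..<n}"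
    using assms(2) * ob by (intro G.finprod_cong') (auto intro!: comp_closed)
  then show ?thesis
    using * ob assms(2) unfolding is_direct_sum_def by (intro conjI exI[of _ \<iota>] exI[of _ \<pi>]) auto
qed

lemma additive_categoryI:
  assumes zero: "\<exists>X\<in>Obj C. Id C X = Zero C X X"
    and biproduct: "\<And>X1 X2. \<lbrakk>X1 \<in> Obj C; X2 \<in> Obj C\<rbrakk> \<Longrightarrow> \<exists>X. is_biproduct C X1 X2 X"
  shows "additive_category C"
proof unfold_locales
  fix n :: nat and Y assume "\<And>i. i < n \<Longrightarrow> Y i \<in> Obj C"
  then show "\<exists>X. is_direct_sum C n Y X"
  proof (induction n)
    case 0
    then show ?case using zero is_direct_sum_0 by blast
  next
    case (Suc n)
    then obtain X1 where X1: "is_direct_sum C n Y X1" by force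
    then obtain X where X: "is_biproduct C X1 (Y n) X"
      using biproduct[of X1 "Y n"] Suc.prems by (auto simp: is_direct_sum_def)
    have "is_direct_sum C (n + Suc 0) (\<lambda>i. if i < n then Y i else Y n) X"
      using is_direct_sum_append[OF X1 is_direct_sum_1 X] Suc.prems by simp
    then have "is_direct_sum C (n + Suc 0) Y X"
      by (rule is_direct_sum_cong) (auto simp: less_Suc_eq)
    then show ?case by auto
  qed
qed

lemma ks_decomposable_zero:
  "X \<in> Obj C \<Longrightarrow> Id C X = Zero C X X \<Longrightarrow> ks_decomposable C X"
  unfolding ks_decomposable_def using is_direct_sum_0 by blast

lemma ks_decomposable_local:
  "X \<in> Obj C \<Longrightarrow> local_ring (End_ring C X) \<Longrightarrow> ks_decomposable C X"
  unfolding ks_decomposable_def using is_direct_sum_1 by blast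

lemma ks_decomposable_biproduct:
  assumes "is_biproduct C X1 X2 X" "ks_decomposable C X1" "ks_decomposable C X2"
  shows "ks_decomposable C X"
proof -
  obtain n Y m Z where "is_direct_sum C n Y X1" "is_direct_sum C m Z X2"
    and l: "\<forall>i<n. local_ring (End_ring C (Y i))" "\<forall>i<m. local_ring (End_ring C (Z i))"
    using assms(2,3) by (auto simp: ks_decomposable_def)
  then have "is_direct_sum C (n + m) (\<lambda>i. if i < n then Y i else Z (i - n)) X"
    using is_direct_sum_append assms(1) by blast
  moreover have "\<forall>i<n + m. local_ring (End_ring C (if i < n then Y i else Z (i - n)))"
    using l by auto
  ultimately show ?thesis unfolding ks_decomposable_def by blast
qed

end

text \<open>Built with the same terms as \<open>Kb_proj\<close>, but for an arbitrary family of
  relations, so that the passage of decompositions to the quotient is proved without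
  homotopies.\<close>

definition quot_cat :: "('o, 'm) precat \<Rightarrow> ('o \<Rightarrow> 'o \<Rightarrow> ('m \<times> 'm) set) \<Rightarrow> ('o, 'm set) precat"
  where "quot_cat C r =
    \<lparr>Obj = Obj C,
     Hom = (\<lambda>X Y. Hom C X Y // r X Y),
     Id = (\<lambda>X. r X X `` {Id C X}),
     Comp = (\<lambda>X Y Z G F. \<Union>g\<in>G. \<Union>f\<in>F. r X Z `` {Comp C X Y Z g f}),
     Add = (\<lambda>X Y F G. \<Union>f\<in>F. \<Union>g\<in>G. r X Y `` {Add C X Y f g}),
     Zero = (\<lambda>X Y. r X Y `` {Zero C X Y})\<rparr>"

text \<open>Well-definedness on classes: compatibility makes all members of the double union the
  same class, and both index sets are nonempty.\<close>

lemma UN_UN_equiv_class_eq: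
  assumes E: "equiv A r'" and F: "equiv B s'" "equiv D t'" and a: "a \<in> A" "b \<in> B"
    and c: "\<And>a a' b b'. \<lbrakk>(a, a') \<in> r'; (b, b') \<in> s'\<rbrakk> \<Longrightarrow> (h a b, h a' b') \<in> t'"
  shows "(\<Union>x\<in>r' `` {a}. \<Union>y\<in>s' `` {b}. t' `` {h x y}) = t' `` {h a b}"
proof -
  have "t' `` {h x y} = t' `` {h a b}" if "x \<in> r' `` {a}" "y \<in> s' `` {b}" for x y
    using c[of a x b y] that equiv_class_eq[OF F(2)] by auto
  moreover have "a \<in> r' `` {a}" "b \<in> s' `` {b}" using a E F equiv_class_self by metis+
  ultimately show ?thesis by blast
qed

locale category_congruence = preadditive_category +
  fixes r :: "'a \<Rightarrow> 'a \<Rightarrow> ('b \<times> 'b) set"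
  assumes equiv: "\<lbrakk>X \<in> Obj C; Y \<in> Obj C\<rbrakk> \<Longrightarrow> equiv (Hom C X Y) (r X Y)"
    and comp_cong: "\<lbrakk>X \<in> Obj C; Y \<in> Obj C; Z \<in> Obj C; (f, f') \<in> r X Y; (g, g') \<in> r Y Z\<rbrakk> \<Longrightarrow>
      (Comp C X Y Z g f, Comp C X Y Z g' f') \<in> r X Z"
    and add_cong: "\<lbrakk>X \<in> Obj C; Y \<in> Obj C; (f, f') \<in> r X Y; (g, g') \<in> r X Y\<rbrakk> \<Longrightarrow>
      (Add C X Y f g, Add C X Y f' g') \<in> r X Y"
begin

abbreviation Q where "Q \<equiv> quot_cat C r"

lemma Q_obj [simp]: "Obj Q = Obj C"
  by (simp add: quot_cat_def)

lemma Q_homI: "f \<in> Hom C X Y \<Longrightarrow> r X Y `` {f} \<in> Hom Q X Y"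
  by (simp add: quot_cat_def quotientI)

lemma Q_homE:
  assumes "F \<in> Hom Q X Y"
  obtains f where "f \<in> Hom C X Y" "F = r X Y `` {f}"
  using assms by (auto simp: quot_cat_def elim!: quotientE)

lemma Q_id: "Id Q X = r X X `` {Id C X}"
  and Q_zero: "Zero Q X Y = r X Y `` {Zero C X Y}"
  by (simp_all add: quot_cat_def)

lemma Q_comp:
  assumes "X \<in> Obj C" "Y \<in> Obj C" "Z \<in> Obj C" "f \<in> Hom C X Y" "g \<in> Hom C Y Z"
  shows "Comp Q X Y Z (r Y Z `` {g}) (r X Y `` {f}) = r X Z `` {Comp C X Y Z g f}"
  unfolding quot_cat_def using assms comp_cong
  by (simp) (rule UN_UN_equiv_class_eq[OF equiv equiv equiv]; simp)

lemma Q_add: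
  assumes "X \<in> Obj C" "Y \<in> Obj C" "f \<in> Hom C X Y" "g \<in> Hom C X Y"
  shows "Add Q X Y (r X Y `` {f}) (r X Y `` {g}) = r X Y `` {Add C X Y f g}"
  unfolding quot_cat_def using assms add_cong
  by (simp) (rule UN_UN_equiv_class_eq[OF equiv equiv equiv]; simp)

lemma quot_cat_preadditive: "preadditive_category Q"
proof (rule preadditive_category.intro, goal_cases)
  \<comment> \<open>Goal 6 is the group structure on morphisms; the other axioms hold because they
    hold for representatives.\<close>
  case (6 X Y)
  then have ob: "X \<in> Obj C" "Y \<in> Obj C" by simp_all
  interpret G: comm_group "hom_group C X Y" using hom_comm_group ob by simp
  note cl = add_closed[OF ob] zero_closed[OF ob]
  have carr: "carrier (hom_group Q X Y) = Hom Q X Y" "mult (hom_group Q X Y) = Add Q X Y"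
    "one (hom_group Q X Y) = Zero Q X Y" by (simp_all add: hom_group_def)
  show ?case
  proof (rule comm_groupI, unfold carr)
    fix F assume "F \<in> Hom Q X Y"
    then obtain f where f: "f \<in> Hom C X Y" "F = r X Y `` {f}" by (rule Q_homE)
    obtain g where "g \<in> Hom C X Y" "Add C X Y g f = Zero C X Y"
      using f G.l_inv_ex[of f] by auto
    then show "\<exists>G\<in>Hom Q X Y. Add Q X Y G F = Zero Q X Y"
      using f ob by (intro bexI[of _ "r X Y `` {g}"]) (auto simp: Q_add Q_zero Q_homI)
    show "Add Q X Y (Zero Q X Y) F = F"
      using f ob cl G.l_one[of f] by (simp add: Q_add Q_zero)
    fix H assume "H \<in> Hom Q X Y"
    then obtain h where h: "h \<in> Hom C X Y" "H = r X Y `` {h}" by (rule Q_homE)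
    show "Add Q X Y F H \<in> Hom Q X Y" using f h ob cl by (simp add: Q_add Q_homI)
    show "Add Q X Y F H = Add Q X Y H F" using f h ob G.m_comm[of f h] by (simp add: Q_add)
    fix K assume "K \<in> Hom Q X Y"
    then obtain k where k: "k \<in> Hom C X Y" "K = r X Y `` {k}" by (rule Q_homE)
    show "Add Q X Y (Add Q X Y F H) K = Add Q X Y F (Add Q X Y H K)"
      using f h k ob cl G.m_assoc[of f h k] by (simp add: Q_add)
  next
    show "Zero Q X Y \<in> Hom Q X Y" using cl by (simp add: Q_zero Q_homI)
  qed
qed (auto elim!: Q_homE simp: Q_id Q_comp Q_add Q_homI id_closed comp_closed comp_assoc comp_id_left
    comp_id_right add_closed comp_add_left comp_add_right)

lemma quot_cat_biproduct:
  assumes "is_biproduct C X1 X2 X"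
  shows "is_biproduct Q X1 X2 X"
proof -
  have ob: "X1 \<in> Obj C" "X2 \<in> Obj C" "X \<in> Obj C"
    using assms by (auto simp: is_biproduct_def)
  obtain i1 i2 p1 p2 where b: "i1 \<in> Hom C X1 X" "i2 \<in> Hom C X2 X" "p1 \<in> Hom C X X1" "p2 \<in> Hom C X X2"
    and pi: "Comp C X1 X X1 p1 i1 = Id C X1" "Comp C X2 X X2 p2 i2 = Id C X2"
      "Comp C X1 X X2 p2 i1 = Zero C X1 X2" "Comp C X2 X X1 p1 i2 = Zero C X2 X1"
    and ip: "Add C X X (Comp C X X1 X i1 p1) (Comp C X X2 X i2 p2) = Id C X"
    using assms by (auto simp: is_biproduct_def)
  show ?thesis
    unfolding is_biproduct_def
    by (intro conjI exI[of _ "r X1 X `` {i1}"] exI[of _ "r X2 X `` {i2}"]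
        exI[of _ "r X X1 `` {p1}"] exI[of _ "r X X2 `` {p2}"])
      (simp_all add: ob b pi ip Q_homI Q_comp Q_id Q_zero Q_add comp_closed)
qed

text \<open>Passing to classes is a surjective ring homomorphism, so its target is local unless 1 =
  0 there, that is, unless X becomes a zero object.\<close>

lemma quot_cat_local_or_zero:
  assumes X: "X \<in> Obj C" and l: "local_ring (End_ring C X)"
  shows "local_ring (End_ring Q X) \<or> Id Q X = Zero Q X X"
proof (cases "Id Q X = Zero Q X X")
  case False
  interpret Q: preadditive_category Q by (rule quot_cat_preadditive)
  have "(\<lambda>f. r X X `` {f}) \<in> ring_hom (End_ring C X) (End_ring Q X)"
    using X by (intro ring_hom_memI) (auto simp: End_ring_def Q_homI Q_comp Q_add Q_id)
  moreover have "(\<lambda>f. r X X `` {f}) ` carrier (End_ring C X) = carrier (End_ring Q X)"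
    by (auto simp: End_ring_def Q_homI elim!: Q_homE)
  ultimately have "local_ring (End_ring Q X)"
    by (intro local_ring_hom_image[OF l Q.ring_End]) (use X False in \<open>simp_all add: End_ring_def\<close>)
  then show ?thesis ..
qed auto

end

section \<open>Chain conditions\<close>

context left_module
begin

lemma smult_r_minus: "a \<in> carrier R \<Longrightarrow> x \<in> carrier M \<Longrightarrow> a \<odot>\<^bsub>M\<^esub> (\<ominus>\<^bsub>M\<^esub> x) = \<ominus>\<^bsub>M\<^esub> (a \<odot>\<^bsub>M\<^esub> x)"
  by (metis M.add.inv_closed M.minus_equality M.l_neg smult_closed smult_r_distr smult_r_null)

lemma submodule_closed:
  assumes "submodule H R M"
  shows "\<And>x. x \<in> H \<Longrightarrow> x \<in> carrier M"
    and "\<zero>\<^bsub>M\<^esub> \<in> H"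
    and "\<And>x y. \<lbrakk>x \<in> H; y \<in> H\<rbrakk> \<Longrightarrow> x \<oplus>\<^bsub>M\<^esub> y \<in> H"
    and "\<And>x y. \<lbrakk>x \<in> H; y \<in> H\<rbrakk> \<Longrightarrow> x \<ominus>\<^bsub>M\<^esub> y \<in> H"
    and "\<And>x. x \<in> H \<Longrightarrow> \<ominus>\<^bsub>M\<^esub> x \<in> H"
    and "\<And>a x. \<lbrakk>a \<in> carrier R; x \<in> H\<rbrakk> \<Longrightarrow> a \<odot>\<^bsub>M\<^esub> x \<in> H"
  using submodule_props[OF assms] by (auto simp: a_minus_def)

lemma submodule_carrier: "submodule (carrier M) R M"
  by (rule left_submoduleI) auto

lemma submodule_Int:
  assumes "submodule A R M" "submodule B R M"
  shows "submodule (A \<inter> B) R M"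
  by (rule left_submoduleI) (use submodule_closed[OF assms(1)] submodule_closed[OF assms(2)] in auto)

lemma submodule_INT:
  assumes "\<And>i. submodule (A i) R M"
  shows "submodule (\<Inter>i. A i) R M"
  by (rule left_submoduleI) (use submodule_closed[OF assms] in auto)

lemma submodule_set_add:
  assumes A: "submodule A R M" and B: "submodule B R M"
  shows "submodule (A <+>\<^bsub>M\<^esub> B) R M"
proof -
  note c = submodule_closed[OF A] submodule_closed[OF B]
  have mem: "x \<in> A <+>\<^bsub>M\<^esub> B \<longleftrightarrow> (\<exists>a\<in>A. \<exists>b\<in>B. x = a \<oplus>\<^bsub>M\<^esub> b)" for x
    by (auto simp: set_add_def')
  show ?thesis
  proof (rule left_submoduleI)
    show "A <+>\<^bsub>M\<^esub> B \<subseteq> carrier M" using c by (auto simp: mem)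
    show "\<zero>\<^bsub>M\<^esub> \<in> A <+>\<^bsub>M\<^esub> B" unfolding mem using c(2,8) by (metis M.l_zero M.zero_closed)
    fix x y assume "x \<in> A <+>\<^bsub>M\<^esub> B" "y \<in> A <+>\<^bsub>M\<^esub> B"
    then obtain a b a' b' where e: "a \<in> A" "b \<in> B" "a' \<in> A" "b' \<in> B" "x = a \<oplus>\<^bsub>M\<^esub> b" "y = a' \<oplus>\<^bsub>M\<^esub> b'"
      by (auto simp: mem)
    then have "x \<oplus>\<^bsub>M\<^esub> y = (a \<oplus>\<^bsub>M\<^esub> a') \<oplus>\<^bsub>M\<^esub> (b \<oplus>\<^bsub>M\<^esub> b')"
      using c by (simp add: M.add.m_ac)
    then show "x \<oplus>\<^bsub>M\<^esub> y \<in> A <+>\<^bsub>M\<^esub> B" unfolding mem using c(3)[OF e(1,3)] c(9)[OF e(2,4)] by blast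
  next
    fix r x assume r: "r \<in> carrier R" "x \<in> A <+>\<^bsub>M\<^esub> B"
    then obtain a b where "a \<in> A" "b \<in> B" "x = a \<oplus>\<^bsub>M\<^esub> b" by (auto simp: mem)
    then show "r \<odot>\<^bsub>M\<^esub> x \<in> A <+>\<^bsub>M\<^esub> B" unfolding mem
      using r(1) c(6)[of r a] c(12)[of r b] c(1)[of a] c(7)[of b] by (auto simp: smult_r_distr)
  qed
qed

lemma set_add_upper:
  assumes A: "submodule A R M" and B: "submodule B R M"
  shows "A \<subseteq> A <+>\<^bsub>M\<^esub> B" "B \<subseteq> A <+>\<^bsub>M\<^esub> B"
proof -
  note c = submodule_closed[OF A] submodule_closed[OF B]
  show "A \<subseteq> A <+>\<^bsub>M\<^esub> B"
  proof
    fix x assume "x \<in> A"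
    then show "x \<in> A <+>\<^bsub>M\<^esub> B" unfolding set_add_def' using c(1,8) by (intro UN_I[of x] UN_I[of "\<zero>\<^bsub>M\<^esub>"]) simp_all
  qed
  show "B \<subseteq> A <+>\<^bsub>M\<^esub> B"
  proof
    fix x assume "x \<in> B"
    then show "x \<in> A <+>\<^bsub>M\<^esub> B" unfolding set_add_def' using c(2,7) by (intro UN_I[of "\<zero>\<^bsub>M\<^esub>"] UN_I[of x]) simp_all
  qed
qed

lemma set_add_least:
  assumes "submodule C R M" "A \<subseteq> C" "B \<subseteq> C"
  shows "A <+>\<^bsub>M\<^esub> B \<subseteq> C"
  using submodule_closed(3)[OF assms(1)] assms(2,3) by (auto simp: set_add_def')

end

text \<open>
  Both the ascending and the descending chain condition for the submodules between \<open>A\<close> and \<open>C\<close>;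
  counting the steps of a chain makes the two cases uniform.
\<close>

definition chain_finite :: "('a, 'r) ring_scheme \<Rightarrow> ('a, 'b, 'm) module_scheme \<Rightarrow> 'b set \<Rightarrow> 'b set \<Rightarrow> bool"
  where "chain_finite R M A C \<longleftrightarrow>
    (\<forall>H :: nat \<Rightarrow> 'b set. (\<forall>i. submodule (H i) R M \<and> A \<subseteq> H i \<and> H i \<subseteq> C) \<and> (mono H \<or> antimono H) \<longrightarrow>
      finite {i. H i \<noteq> H (Suc i)})"

lemma chain_finiteD:
  assumes "chain_finite R M A C" "\<And>i. submodule (H i) R M" "\<And>i. A \<subseteq> H i" "\<And>i. H i \<subseteq> C"
    and "mono H \<or> antimono H"
  shows "finite {i. H i \<noteq> H (Suc i)}"
  using assms by (simp add: chain_finite_def)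

lemma chain_finite_stable:
  fixes H :: "nat \<Rightarrow> _ set"
  assumes "chain_finite R M A C" "\<And>i. submodule (H i) R M" "\<And>i. A \<subseteq> H i" "\<And>i. H i \<subseteq> C"
    and "mono H \<or> antimono H"
  shows "\<exists>k. \<forall>j\<ge>k. H j = H k"
proof -
  have "finite {i. H i \<noteq> H (Suc i)}" using chain_finiteD[OF assms] .
  then obtain k where k: "\<And>i. H i \<noteq> H (Suc i) \<Longrightarrow> i < k"
    by (auto simp: finite_nat_set_iff_bounded)
  have "H j = H k" if "k \<le> j" for j
    using that
  proof (induction j rule: dec_induct)
    case (step j)
    then show ?case using k[of j] by auto
  qed simp
  then show ?thesis by blast
qed

lemma chain_finite_refl: "chain_finite R M A A"
proof -
  have "finite {i. H i \<noteq> H (Suc i)}" if "\<And>i. A \<subseteq> H i \<and> H i \<subseteq> A" for H :: "nat \<Rightarrow> _ set"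
  proof -
    have "H i = A" for i using that by blast
    then show ?thesis by simp
  qed
  then show ?thesis by (auto simp: chain_finite_def)
qed

text \<open>A monotone \<Phi> that separates nested submodules sends chains to chains and loses no
  step. Separation is asked for nested pairs because consecutive members of a chain are
  nested.\<close>

lemma chain_finite_transfer:
  assumes fin: "chain_finite R' M' A' C'"
    and sub: "\<And>H. \<lbrakk>submodule H R M; A \<subseteq> H; H \<subseteq> C\<rbrakk> \<Longrightarrow> submodule (\<Phi> H) R' M' \<and> A' \<subseteq> \<Phi> H \<and> \<Phi> H \<subseteq> C'"
    and mono: "\<And>H H'. \<lbrakk>submodule H R M; A \<subseteq> H; H \<subseteq> H'; H' \<subseteq> C; submodule H' R M\<rbrakk> \<Longrightarrow> \<Phi> H \<subseteq> \<Phi> H'"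
    and inj: "\<And>H H'. \<lbrakk>submodule H R M; A \<subseteq> H; H \<subseteq> H'; H' \<subseteq> C; submodule H' R M; \<Phi> H = \<Phi> H'\<rbrakk> \<Longrightarrow> H = H'"
  shows "chain_finite R M A C"
  unfolding chain_finite_def
proof (intro allI impI, elim conjE)
  fix H :: "nat \<Rightarrow> _ set"
  assume H: "\<forall>i. submodule (H i) R M \<and> A \<subseteq> H i \<and> H i \<subseteq> C" and m: "mono H \<or> antimono H"
  then have "mono (\<lambda>i. \<Phi> (H i)) \<or> antimono (\<lambda>i. \<Phi> (H i))"
    unfolding monotone_def by (metis mono)
  then have "finite {i. \<Phi> (H i) \<noteq> \<Phi> (H (Suc i))}"
    using H sub by (intro chain_finiteD[OF fin]) auto
  moreover have "H i \<noteq> H (Suc i) \<Longrightarrow> \<Phi> (H i) \<noteq> \<Phi> (H (Suc i))" for i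
    using m H inj[of "H i" "H (Suc i)"] inj[of "H (Suc i)" "H i"]
    by (auto simp: monotone_def)
  then have "{i. H i \<noteq> H (Suc i)} \<subseteq> {i. \<Phi> (H i) \<noteq> \<Phi> (H (Suc i))}" by blast
  ultimately show "finite {i. H i \<noteq> H (Suc i)}" using finite_subset by blast
qed

text \<open>Only the values A and C occur, so a monotone or antimonotone sequence changes at most
  once.\<close>

lemma chain_finite_simple:
  assumes no: "\<not> (\<exists>H. submodule H R M \<and> A \<subset> H \<and> H \<subset> C)"
  shows "chain_finite R M A C"
  unfolding chain_finite_def
proof (intro allI impI, elim conjE)
  fix H :: "nat \<Rightarrow> _ set"
  assume H: "\<forall>i. submodule (H i) R M \<and> A \<subseteq> H i \<and> H i \<subseteq> C" and m: "mono H \<or> antimono H"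
  have AC: "H i = A \<or> H i = C" for i using H no by blast
  have le: "j \<le> i" if i: "H i \<noteq> H (Suc i)" and j: "H j \<noteq> H (Suc j)" for i j
  proof (rule ccontr)
    assume "\<not> j \<le> i"
    then have "i \<le> Suc i" "Suc i \<le> j" "j \<le> Suc j" by auto
    then show False using m AC[of i] AC[of "Suc i"] AC[of j] AC[of "Suc j"] i j
      unfolding monotone_def by (metis subset_antisym)
  qed
  show "finite {i. H i \<noteq> H (Suc i)}"
  proof (cases "\<exists>i. H i \<noteq> H (Suc i)")
    case True
    then obtain i where "H i \<noteq> H (Suc i)" by blast
    then have "{i. H i \<noteq> H (Suc i)} \<subseteq> {..i}" using le by blast
    then show ?thesis using finite_subset by blast
  qed simp
qed

context left_module
begin

text \<open>By the modular law, nested submodules with the same intersection with B and the same sum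
  with B coincide. So each step of a chain is a step of the intersections, which lie between A and
  B, or of the sums, which lie between B and C; both are finite in number.\<close>

lemma chain_finite_trans:
  assumes B: "submodule B R M" and C: "submodule C R M" and sub: "A \<subseteq> B" "B \<subseteq> C"
    and fin: "chain_finite R M A B" "chain_finite R M B C"
  shows "chain_finite R M A C"
  unfolding chain_finite_def
proof (intro allI impI, elim conjE)
  fix H :: "nat \<Rightarrow> 'b set"
  assume H: "\<forall>i. submodule (H i) R M \<and> A \<subseteq> H i \<and> H i \<subseteq> C" and m: "mono H \<or> antimono H"
  note c = submodule_closed
  have "mono (\<lambda>i. H i \<inter> B) \<or> antimono (\<lambda>i. H i \<inter> B)" using m by (auto simp: monotone_def)
  then have 1: "finite {i. H i \<inter> B \<noteq> H (Suc i) \<inter> B}"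
    using H sub B by (intro chain_finiteD[OF fin(1)]) (auto intro: submodule_Int)
  have "mono (\<lambda>i. H i <+>\<^bsub>M\<^esub> B) \<or> antimono (\<lambda>i. H i <+>\<^bsub>M\<^esub> B)"
    using m by (auto simp: monotone_def set_add_def') blast+
  then have 2: "finite {i. H i <+>\<^bsub>M\<^esub> B \<noteq> H (Suc i) <+>\<^bsub>M\<^esub> B}"
    using H sub B set_add_upper set_add_least[OF C]
    by (intro chain_finiteD[OF fin(2)]) (auto intro: submodule_set_add)
  have mod: "H' \<subseteq> H''"
    if "submodule H' R M" "submodule H'' R M" "H'' \<subseteq> H'"
      and e: "H' \<inter> B = H'' \<inter> B" "H' <+>\<^bsub>M\<^esub> B = H'' <+>\<^bsub>M\<^esub> B" for H' H''
  proof
    fix x assume x: "x \<in> H'"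
    then have "x \<in> H'' <+>\<^bsub>M\<^esub> B" using set_add_upper(1)[OF that(1) B] e(2) by blast
    then obtain h b where hb: "h \<in> H''" "b \<in> B" "x = h \<oplus>\<^bsub>M\<^esub> b" by (auto simp: set_add_def')
    then have "b = x \<ominus>\<^bsub>M\<^esub> h"
      using c(1)[OF that(2)] c(1)[OF B] by (simp add: M.add.m_comm a_minus_def M.r_neg1 M.add.m_lcomm M.r_neg)
    then have "b \<in> H'" using c(4)[OF that(1)] x hb(1) that(3) by blast
    then have "b \<in> H''" using hb e(1) by blast
    then show "x \<in> H''" using c(3)[OF that(2)] hb by blast
  qed
  have "{i. H i \<noteq> H (Suc i)} \<subseteq> {i. H i \<inter> B \<noteq> H (Suc i) \<inter> B} \<union> {i. H i <+>\<^bsub>M\<^esub> B \<noteq> H (Suc i) <+>\<^bsub>M\<^esub> B}"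
  proof (rule subsetI, rule ccontr)
    fix i assume i: "i \<in> {i. H i \<noteq> H (Suc i)}"
      and "i \<notin> {i. H i \<inter> B \<noteq> H (Suc i) \<inter> B} \<union> {i. H i <+>\<^bsub>M\<^esub> B \<noteq> H (Suc i) <+>\<^bsub>M\<^esub> B}"
    then have e: "H i \<inter> B = H (Suc i) \<inter> B" "H i <+>\<^bsub>M\<^esub> B = H (Suc i) <+>\<^bsub>M\<^esub> B" by auto
    have "H i \<subseteq> H (Suc i) \<or> H (Suc i) \<subseteq> H i" using m unfolding monotone_def by (metis lessI less_imp_le)
    then show False using i H mod[of "H i" "H (Suc i)"] mod[of "H (Suc i)" "H i"] e by auto
  qed
  then show "finite {i. H i \<noteq> H (Suc i)}" using 1 2 finite_subset by blast
qed

text \<open>The simple factors of a composition series are glued by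
  \<open>chain_finite_trans\<close>. This consequence is the form in which finite length enters the
  rest of the proof.\<close>

lemma finite_length_chain_finite:
  assumes "finite_length R M"
  shows "chain_finite R M {\<zero>\<^bsub>M\<^esub>} (carrier M)"
proof -
  obtain n :: nat and N where N: "N 0 = {\<zero>\<^bsub>M\<^esub>}" "N n = carrier M" "\<forall>i\<le>n. submodule (N i) R M"
      "\<forall>i<n. N i \<subset> N (Suc i) \<and> \<not> (\<exists>H. submodule H R M \<and> N i \<subset> H \<and> H \<subset> N (Suc i))"
    using assms unfolding finite_length_def by (elim exE conjE) (rule that)
  have "chain_finite R M (N 0) (N k) \<and> N 0 \<subseteq> N k" if "k \<le> n" for k
    using that
  proof (induction k)
    case 0
    then show ?case by (simp add: chain_finite_refl)
  next
    case (Suc k)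
    then have "chain_finite R M (N k) (N (Suc k))" using N(4) by (intro chain_finite_simple) auto
    moreover have "submodule (N k) R M" "submodule (N (Suc k)) R M" "N k \<subset> N (Suc k)"
      using Suc.prems N(3,4) by (simp_all add: Suc_le_eq)
    moreover have "chain_finite R M (N 0) (N k)" "N 0 \<subseteq> N k" using Suc by auto
    ultimately show ?case using chain_finite_trans[of "N k" "N (Suc k)" "N 0"] by blast
  qed
  then have "chain_finite R M (N 0) (N n)" by blast
  then show ?thesis by (simp add: N(1,2))
qed

lemma quot_module_simps:
  assumes H: "submodule H R M"
  shows "carrier (quot_module M H) = (\<lambda>x. H +>\<^bsub>M\<^esub> x) ` carrier M"
    and "\<zero>\<^bsub>quot_module M H\<^esub> = H +>\<^bsub>M\<^esub> \<zero>\<^bsub>M\<^esub>"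
    and "\<And>x y. \<lbrakk>x \<in> carrier M; y \<in> carrier M\<rbrakk> \<Longrightarrow>
      (H +>\<^bsub>M\<^esub> x) \<oplus>\<^bsub>quot_module M H\<^esub> (H +>\<^bsub>M\<^esub> y) = H +>\<^bsub>M\<^esub> (x \<oplus>\<^bsub>M\<^esub> y)"
    and "\<And>a x. \<lbrakk>a \<in> carrier R; x \<in> carrier M\<rbrakk> \<Longrightarrow>
      a \<odot>\<^bsub>quot_module M H\<^esub> (H +>\<^bsub>M\<^esub> x) = H +>\<^bsub>M\<^esub> (a \<odot>\<^bsub>M\<^esub> x)"
    and "\<And>x y. \<lbrakk>x \<in> carrier M; y \<in> carrier M\<rbrakk> \<Longrightarrow> H +>\<^bsub>M\<^esub> x = H +>\<^bsub>M\<^esub> y \<longleftrightarrow> x \<ominus>\<^bsub>M\<^esub> y \<in> H"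
proof -
  note c = submodule_closed[OF H]
  have asg: "additive_subgroup H M"
    using H by (simp add: additive_subgroup_def submodule_def)
  interpret S: abelian_subgroup H M
    by (rule abelian_subgroupI3[OF asg M.abelian_group_axioms])
  show "carrier (quot_module M H) = (\<lambda>x. H +>\<^bsub>M\<^esub> x) ` carrier M"
    by (auto simp: quot_module_def A_RCOSETS_def')
  show "\<zero>\<^bsub>quot_module M H\<^esub> = H +>\<^bsub>M\<^esub> \<zero>\<^bsub>M\<^esub>"
    using S.a_subset M.a_coset_add_zero by (simp add: quot_module_def)
  show add: "(H +>\<^bsub>M\<^esub> x) \<oplus>\<^bsub>quot_module M H\<^esub> (H +>\<^bsub>M\<^esub> y) = H +>\<^bsub>M\<^esub> (x \<oplus>\<^bsub>M\<^esub> y)"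
    if "x \<in> carrier M" "y \<in> carrier M" for x y
    using that by (simp add: quot_module_def S.a_rcos_sum)
  show eq: "H +>\<^bsub>M\<^esub> x = H +>\<^bsub>M\<^esub> y \<longleftrightarrow> x \<ominus>\<^bsub>M\<^esub> y \<in> H" if "x \<in> carrier M" "y \<in> carrier M" for x y
  proof -
    have "x \<in> H +>\<^bsub>M\<^esub> y \<longleftrightarrow> x \<ominus>\<^bsub>M\<^esub> y \<in> H"
      unfolding a_minus_def using that by (intro S.a_rcos_module)
    moreover have "x \<in> H +>\<^bsub>M\<^esub> x" using S.a_rcos_self that by simp
    ultimately show ?thesis using S.a_repr_independence'[of x y] that by blast
  qed
  show "a \<odot>\<^bsub>quot_module M H\<^esub> (H +>\<^bsub>M\<^esub> x) = H +>\<^bsub>M\<^esub> (a \<odot>\<^bsub>M\<^esub> x)" if a: "a \<in> carrier R" "x \<in> carrier M" for a x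
  proof -
    have "H +>\<^bsub>M\<^esub> (a \<odot>\<^bsub>M\<^esub> z) = H +>\<^bsub>M\<^esub> (a \<odot>\<^bsub>M\<^esub> x)" if z: "z \<in> H +>\<^bsub>M\<^esub> x" for z
    proof -
      obtain h where h: "h \<in> H" "z = h \<oplus>\<^bsub>M\<^esub> x" using z unfolding a_r_coset_def' by blast
      then have "a \<odot>\<^bsub>M\<^esub> z \<ominus>\<^bsub>M\<^esub> a \<odot>\<^bsub>M\<^esub> x = a \<odot>\<^bsub>M\<^esub> h"
        using a c(1)[OF h(1)] by (simp add: smult_r_distr a_minus_def M.a_assoc M.r_neg)
      then have "a \<odot>\<^bsub>M\<^esub> z \<ominus>\<^bsub>M\<^esub> a \<odot>\<^bsub>M\<^esub> x \<in> H" using c(6)[OF a(1) h(1)] by simp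
      moreover have "z \<in> carrier M" using h c(1)[OF h(1)] a by simp
      ultimately show ?thesis using eq[of "a \<odot>\<^bsub>M\<^esub> z" "a \<odot>\<^bsub>M\<^esub> x"] a by simp
    qed
    moreover have "x \<in> H +>\<^bsub>M\<^esub> x" using S.a_rcos_self a by simp
    ultimately have "(\<Union>z\<in>H +>\<^bsub>M\<^esub> x. H +>\<^bsub>M\<^esub> (a \<odot>\<^bsub>M\<^esub> z)) = H +>\<^bsub>M\<^esub> (a \<odot>\<^bsub>M\<^esub> x)" by blast
    then show ?thesis by (simp add: quot_module_def)
  qed
qed

lemma left_module_quot:
  assumes H: "submodule H R M"
  shows "left_module R (quot_module M H)"
proof -
  note q = quot_module_simps[OF H]
  have "abelian_group (quot_module M H)"
  proof (rule abelian_groupI, goal_cases)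
    case (6 X)
    then obtain x where "x \<in> carrier M" "X = H +>\<^bsub>M\<^esub> x" by (auto simp: q)
    then show ?case by (intro bexI[of _ "H +>\<^bsub>M\<^esub> (\<ominus>\<^bsub>M\<^esub> x)"]) (auto simp: q M.l_neg)
  qed (auto simp: q M.add.m_ac)
  then show ?thesis
    using R.ring_axioms
    by (intro left_module.intro left_module_axioms.intro)
      (auto simp: q smult_l_distr smult_r_distr smult_assoc1)
qed

text \<open>The correspondence of submodules containing H with submodules of the quotient: L is
  recovered from its set of cosets because it contains H.\<close>

lemma finite_length_quot_chain_finite:
  assumes H: "submodule H R M" and fl: "finite_length R (quot_module M H)"
  shows "chain_finite R M H (carrier M)"
proof (rule chain_finite_transfer[where \<Phi> = "\<lambda>L. (\<lambda>x. H +>\<^bsub>M\<^esub> x) ` L"])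
  note q = quot_module_simps[OF H]
  interpret Q: left_module R "quot_module M H" by (rule left_module_quot[OF H])
  show "chain_finite R (quot_module M H) {\<zero>\<^bsub>quot_module M H\<^esub>} (carrier (quot_module M H))"
    by (rule Q.finite_length_chain_finite[OF fl])
  fix L assume L: "submodule L R M" "H \<subseteq> L"
  note c = submodule_closed[OF L(1)]
  have "submodule ((\<lambda>x. H +>\<^bsub>M\<^esub> x) ` L) R (quot_module M H)"
    by (rule Q.left_submoduleI) (auto simp: q c)
  then show "submodule ((\<lambda>x. H +>\<^bsub>M\<^esub> x) ` L) R (quot_module M H) \<and>
      {\<zero>\<^bsub>quot_module M H\<^esub>} \<subseteq> (\<lambda>x. H +>\<^bsub>M\<^esub> x) ` L \<and>
      (\<lambda>x. H +>\<^bsub>M\<^esub> x) ` L \<subseteq> carrier (quot_module M H)"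
    by (auto simp: q c)
  fix L' assume L': "L \<subseteq> L'" "submodule L' R M" "(\<lambda>x. H +>\<^bsub>M\<^esub> x) ` L = (\<lambda>x. H +>\<^bsub>M\<^esub> x) ` L'"
  have "x \<in> L" if x: "x \<in> L'" for x
  proof -
    have xc: "x \<in> carrier M" using submodule_closed(1)[OF L'(2) x] .
    obtain y where y: "y \<in> L" "H +>\<^bsub>M\<^esub> x = H +>\<^bsub>M\<^esub> y" using x L'(3) by blast
    then have "x \<ominus>\<^bsub>M\<^esub> y \<in> L" using q(5)[OF xc c(1)[OF y(1)]] L(2) by auto
    then have "(x \<ominus>\<^bsub>M\<^esub> y) \<oplus>\<^bsub>M\<^esub> y \<in> L" using y c(3) by blast
    then show ?thesis using xc c(1)[OF y(1)] by (simp add: a_minus_def M.a_assoc M.l_neg)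
  qed
  then show "L = L'" using L' by blast
qed blast

end

section \<open>The Fitting decomposition of a complete filtered module\<close>

definition fitting_im :: "('a, 'b, 'm) module_scheme \<Rightarrow> (nat \<Rightarrow> 'b set) \<Rightarrow> ('b \<Rightarrow> 'b) \<Rightarrow> 'b set"
  where "fitting_im M K f = (\<Inter>i k. (f ^^ k) ` carrier M <+>\<^bsub>M\<^esub> K i)"

definition fitting_ker :: "('a, 'b, 'm) module_scheme \<Rightarrow> (nat \<Rightarrow> 'b set) \<Rightarrow> ('b \<Rightarrow> 'b) \<Rightarrow> 'b set"
  where "fitting_ker M K f = (\<Inter>i. \<Union>k. {x \<in> carrier M. (f ^^ k) x \<in> K i})"

text \<open>Isolates what the Fitting argument uses of the adic filtration. In
  \<open>complete\<close> the y i form a compatible system of elements modulo the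
  \<open>K i\<close>, and z lifts the whole system; \<open>separated\<close> makes the lift
  unique.\<close>

locale filtered_module = left_module +
  fixes K :: "nat \<Rightarrow> 'c set"
  assumes K_submodule: "submodule (K i) R M"
    and K_decreasing: "K (Suc i) \<subseteq> K i"
    and separated: "\<lbrakk>x \<in> carrier M; \<And>i. x \<in> K i\<rbrakk> \<Longrightarrow> x = \<zero>\<^bsub>M\<^esub>"
    and complete: "\<lbrakk>\<And>i. y i \<in> carrier M; \<And>i. y (Suc i) \<ominus>\<^bsub>M\<^esub> y i \<in> K i\<rbrakk> \<Longrightarrow>
      \<exists>z\<in>carrier M. \<forall>i. z \<ominus>\<^bsub>M\<^esub> y i \<in> K i"
    and chains: "chain_finite R M (K i) (carrier M)"
begin

lemma minus_eq_zero_imp_eq: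
  assumes "x \<ominus>\<^bsub>M\<^esub> y = \<zero>\<^bsub>M\<^esub>" "x \<in> carrier M" "y \<in> carrier M"
  shows "x = y"
proof -
  have "(x \<ominus>\<^bsub>M\<^esub> y) \<oplus>\<^bsub>M\<^esub> y = x" using assms(2,3) by (simp add: a_minus_def M.a_assoc M.l_neg)
  then show ?thesis using assms by simp
qed

lemmas K_closed = submodule_closed[OF K_submodule]

text \<open>Each \<open>Q i\<close> is a coset of \<open>K i\<close>.\<close>

lemma nested_cosets:
  assumes Q: "\<And>i. Q i \<subseteq> carrier M" "\<And>i. Q i \<noteq> {}" "\<And>i. Q (Suc i) \<subseteq> Q i"
    and diff: "\<And>i x y. \<lbrakk>x \<in> Q i; y \<in> Q i\<rbrakk> \<Longrightarrow> x \<ominus>\<^bsub>M\<^esub> y \<in> K i"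
    and add: "\<And>i x y. \<lbrakk>x \<in> K i; y \<in> Q i\<rbrakk> \<Longrightarrow> x \<oplus>\<^bsub>M\<^esub> y \<in> Q i"
  shows "\<exists>z\<in>carrier M. \<forall>i. z \<in> Q i"
proof -
  have "\<forall>i. \<exists>y. y \<in> Q i" using Q(2) by blast
  then obtain y where y: "\<And>i. y i \<in> Q i" by (elim choice[elim_format] exE) blast
  have yc: "y i \<in> carrier M" for i using y Q(1) by blast
  have "y (Suc i) \<ominus>\<^bsub>M\<^esub> y i \<in> K i" for i using y Q(3) by (intro diff) blast+
  then obtain z where z: "z \<in> carrier M" "\<And>i. z \<ominus>\<^bsub>M\<^esub> y i \<in> K i" using complete yc by blast
  have "z \<in> Q i" for i
  proof -
    have "(z \<ominus>\<^bsub>M\<^esub> y i) \<oplus>\<^bsub>M\<^esub> y i \<in> Q i" using z y by (intro add)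
    then show ?thesis using z(1) yc by (simp add: a_minus_def M.a_assoc M.l_neg)
  qed
  then show ?thesis using z by blast
qed

text \<open>The solutions in \<open>H i\<close> of g y = x modulo \<open>K i\<close> form a coset of
  \<open>K i\<close>: differences of solutions are mapped into \<open>K i\<close>, hence lie in
  \<open>K i\<close> by the kernel hypothesis. These cosets are nested, and a common point solves
  the equation modulo every \<open>K i\<close>, hence exactly by separation.\<close>

lemma solve_levelwise:
  assumes g: "g \<in> left_hom R M M" "\<And>i x. x \<in> K i \<Longrightarrow> g x \<in> K i" and x: "x \<in> carrier M"
    and H: "\<And>i. submodule (H i) R M" "\<And>i. K i \<subseteq> H i" "\<And>i. H (Suc i) \<subseteq> H i"
    and ker: "\<And>i y. \<lbrakk>y \<in> H i; g y \<in> K i\<rbrakk> \<Longrightarrow> y \<in> K i"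
    and ex: "\<And>i. \<exists>y\<in>H i. g y \<ominus>\<^bsub>M\<^esub> x \<in> K i"
  shows "\<exists>y\<in>\<Inter>i. H i. g y = x"
proof -
  note Hc = submodule_closed[OF H(1)] and gD = left_homD[OF g(1)]
  have gminus: "g (y \<ominus>\<^bsub>M\<^esub> z) = g y \<ominus>\<^bsub>M\<^esub> g z" if "y \<in> carrier M" "z \<in> carrier M" for y z
  proof -
    have "g (y \<ominus>\<^bsub>M\<^esub> z) \<oplus>\<^bsub>M\<^esub> g z = g y"
      using that by (simp add: gD(2)[symmetric] a_minus_def M.a_assoc M.l_neg)
    then show ?thesis using that gD(1) by (simp add: M.minus_eq M.a_assoc M.r_neg flip: \<open>_ = g y\<close>)
  qed
  define Q where "Q i = {y \<in> H i. g y \<ominus>\<^bsub>M\<^esub> x \<in> K i}" for i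
  have "\<exists>z\<in>carrier M. \<forall>i. z \<in> Q i"
  proof (rule nested_cosets)
    show "Q i \<subseteq> carrier M" "Q i \<noteq> {}" for i using Hc(1)[of _ i] ex[of i] by (auto simp: Q_def)
    show "Q (Suc i) \<subseteq> Q i" for i using H(3) K_decreasing by (auto simp: Q_def)
    show "y \<ominus>\<^bsub>M\<^esub> z \<in> K i" if "y \<in> Q i" "z \<in> Q i" for i y z
    proof (rule ker)
      have c: "y \<in> H i" "z \<in> H i" "g y \<ominus>\<^bsub>M\<^esub> x \<in> K i" "g z \<ominus>\<^bsub>M\<^esub> x \<in> K i" "y \<in> carrier M" "z \<in> carrier M"
        using that Hc(1) by (auto simp: Q_def)
      show "y \<ominus>\<^bsub>M\<^esub> z \<in> H i" using c Hc(4) by blast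
      have "g (y \<ominus>\<^bsub>M\<^esub> z) = (g y \<ominus>\<^bsub>M\<^esub> x) \<ominus>\<^bsub>M\<^esub> (g z \<ominus>\<^bsub>M\<^esub> x)"
        unfolding gminus[OF c(5,6)] using c(5,6) x gD(1)[of y] gD(1)[of z]
        by (simp add: a_minus_def M.minus_add M.add.m_ac M.r_neg1 M.r_neg2 M.r_neg M.l_neg)
      then show "g (y \<ominus>\<^bsub>M\<^esub> z) \<in> K i" using K_closed(4) c by simp
    qed
    show "k \<oplus>\<^bsub>M\<^esub> y \<in> Q i" if "k \<in> K i" "y \<in> Q i" for i k y
    proof -
      have c: "y \<in> H i" "k \<in> H i" "g y \<ominus>\<^bsub>M\<^esub> x \<in> K i" "y \<in> carrier M" "k \<in> carrier M"
        using that Hc(1) H(2) K_closed(1) by (auto simp: Q_def)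
      have "g (k \<oplus>\<^bsub>M\<^esub> y) \<ominus>\<^bsub>M\<^esub> x = g k \<oplus>\<^bsub>M\<^esub> (g y \<ominus>\<^bsub>M\<^esub> x)"
        using c(4,5) x gD by (simp add: a_minus_def M.a_assoc)
      then have "g (k \<oplus>\<^bsub>M\<^esub> y) \<ominus>\<^bsub>M\<^esub> x \<in> K i" using K_closed(3) g(2) that(1) c(3) by simp
      then show ?thesis using Hc(3) c by (simp add: Q_def)
    qed
  qed
  then obtain z where z: "z \<in> carrier M" "\<And>i. z \<in> Q i" by blast
  have "g z \<ominus>\<^bsub>M\<^esub> x = \<zero>\<^bsub>M\<^esub>" using separated[of "g z \<ominus>\<^bsub>M\<^esub> x"] z gD(1) x by (simp add: Q_def)
  then have "g z = x" using z(1) x gD(1) by (metis minus_eq_zero_imp_eq)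
  then show ?thesis using z(2) by (auto simp: Q_def)
qed

section \<open>Fitting decomposition for one filtered endomorphism\<close>

context
  fixes f
  assumes f: "f \<in> left_hom R M M" and fK: "\<And>i x. x \<in> K i \<Longrightarrow> f x \<in> K i"
begin

private lemma fD: "x \<in> carrier M \<Longrightarrow> f x \<in> carrier M"
  "\<lbrakk>x \<in> carrier M; y \<in> carrier M\<rbrakk> \<Longrightarrow> f (x \<oplus>\<^bsub>M\<^esub> y) = f x \<oplus>\<^bsub>M\<^esub> f y"
  "\<lbrakk>a \<in> carrier R; x \<in> carrier M\<rbrakk> \<Longrightarrow> f (a \<odot>\<^bsub>M\<^esub> x) = a \<odot>\<^bsub>M\<^esub> f x"
  "x \<in> carrier M \<Longrightarrow> f (\<ominus>\<^bsub>M\<^esub> x) = \<ominus>\<^bsub>M\<^esub> f x"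
  "f \<zero>\<^bsub>M\<^esub> = \<zero>\<^bsub>M\<^esub>"
proof -
  note D = left_homD[OF f]
  show "x \<in> carrier M \<Longrightarrow> f x \<in> carrier M"
    "\<lbrakk>x \<in> carrier M; y \<in> carrier M\<rbrakk> \<Longrightarrow> f (x \<oplus>\<^bsub>M\<^esub> y) = f x \<oplus>\<^bsub>M\<^esub> f y"
    "\<lbrakk>a \<in> carrier R; x \<in> carrier M\<rbrakk> \<Longrightarrow> f (a \<odot>\<^bsub>M\<^esub> x) = a \<odot>\<^bsub>M\<^esub> f x"
    by (rule D; assumption)+
  show "f (\<ominus>\<^bsub>M\<^esub> x) = \<ominus>\<^bsub>M\<^esub> f x" if "x \<in> carrier M"
    using D(3)[of "\<ominus> \<one>" x] that D(1) by (simp add: smult_minus_one)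
  show "f \<zero>\<^bsub>M\<^esub> = \<zero>\<^bsub>M\<^esub>"
    by (rule left_hom_zero[OF left_module_axioms left_module_axioms f])
qed

private lemma funpow_closed: "x \<in> carrier M \<Longrightarrow> (f ^^ k) x \<in> carrier M"
  by (induction k) (auto simp: fD)

private lemma funpow_add:
  "\<lbrakk>x \<in> carrier M; y \<in> carrier M\<rbrakk> \<Longrightarrow> (f ^^ k) (x \<oplus>\<^bsub>M\<^esub> y) = (f ^^ k) x \<oplus>\<^bsub>M\<^esub> (f ^^ k) y"
  by (induction k) (auto simp: fD funpow_closed)

private lemma funpow_smult:
  "\<lbrakk>a \<in> carrier R; x \<in> carrier M\<rbrakk> \<Longrightarrow> (f ^^ k) (a \<odot>\<^bsub>M\<^esub> x) = a \<odot>\<^bsub>M\<^esub> (f ^^ k) x"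
  by (induction k) (auto simp: fD funpow_closed)

private lemma funpow_uminus: "x \<in> carrier M \<Longrightarrow> (f ^^ k) (\<ominus>\<^bsub>M\<^esub> x) = \<ominus>\<^bsub>M\<^esub> (f ^^ k) x"
  by (induction k) (auto simp: fD funpow_closed)

private lemma funpow_zero: "(f ^^ k) \<zero>\<^bsub>M\<^esub> = \<zero>\<^bsub>M\<^esub>"
  by (induction k) (auto simp: fD)

private lemma funpow_K: "x \<in> K i \<Longrightarrow> (f ^^ k) x \<in> K i"
  by (induction k) (auto simp: fK)

text \<open>\<open>A i k\<close> and \<open>B i k\<close> are the preimages in M of the image and of
  the kernel of the k-th power of f on M modulo \<open>K i\<close>; \<open>I i\<close> and
  \<open>N i\<close> are the preimages of the two Fitting components of that quotient. Working with
  preimages avoids quotient modules.\<close>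

private definition "A i k = (f ^^ k) ` carrier M <+>\<^bsub>M\<^esub> K i"
private definition "B i k = {x \<in> carrier M. (f ^^ k) x \<in> K i}"
private definition "I i = (\<Inter>k. A i k)"
private definition "N i = (\<Union>k. B i k)"

private lemma A_mem: "x \<in> A i k \<longleftrightarrow> (\<exists>u\<in>carrier M. \<exists>\<kappa>\<in>K i. x = (f ^^ k) u \<oplus>\<^bsub>M\<^esub> \<kappa>)"
  by (auto simp: A_def set_add_def')

private lemma A_submodule: "submodule (A i k) R M"
  unfolding A_def
proof (rule submodule_set_add[OF _ K_submodule], rule left_submoduleI)
  show "\<zero>\<^bsub>M\<^esub> \<in> (f ^^ k) ` carrier M" using funpow_zero by (metis M.zero_closed image_eqI)
  show "x \<oplus>\<^bsub>M\<^esub> y \<in> (f ^^ k) ` carrier M" if "x \<in> (f ^^ k) ` carrier M" "y \<in> (f ^^ k) ` carrier M" for x y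
    using that by (auto simp: funpow_add[symmetric])
  show "a \<odot>\<^bsub>M\<^esub> x \<in> (f ^^ k) ` carrier M" if "a \<in> carrier R" "x \<in> (f ^^ k) ` carrier M" for a x
    using that by (auto simp: funpow_smult[symmetric])
qed (auto simp: funpow_closed)

private lemma B_submodule: "submodule (B i k) R M"
  by (rule left_submoduleI) (auto simp: B_def funpow_zero funpow_add funpow_smult K_closed)

private lemma K_le_A: "K i \<subseteq> A i k"
proof
  fix x assume "x \<in> K i"
  then show "x \<in> A i k"
    unfolding A_mem by (intro bexI[of _ "\<zero>\<^bsub>M\<^esub>"] bexI[of _ x]) (auto simp: funpow_zero K_closed)
qed

private lemma K_le_B: "K i \<subseteq> B i k"
  by (auto simp: B_def funpow_K K_closed)

private lemma A_Suc: "A i (Suc k) \<subseteq> A i k"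
proof
  fix x assume "x \<in> A i (Suc k)"
  then obtain u \<kappa> where "u \<in> carrier M" "\<kappa> \<in> K i" "x = (f ^^ k) (f u) \<oplus>\<^bsub>M\<^esub> \<kappa>"
    by (auto simp: A_mem funpow_Suc_right simp del: funpow.simps)
  then show "x \<in> A i k" unfolding A_mem using fD by blast
qed

private lemma B_Suc: "B i k \<subseteq> B i (Suc k)"
  by (auto simp: B_def fK)

text \<open>The images descend and the kernels ascend between \<open>K i\<close> and M, so both
  become stationary; the maximum of the two indices serves both. It may grow with i.\<close>

private lemma stable: "\<exists>m. I i = A i m \<and> N i = B i m \<and> (\<forall>j\<ge>m. A i j = A i m \<and> B i j = B i m)"
proof -
  have am: "antimono (A i)" by (rule antimonoI, rule lift_Suc_antimono_le) (rule A_Suc)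
  have bm: "mono (B i)" by (rule monoI, rule lift_Suc_mono_le) (rule B_Suc)
  have le: "A i k \<subseteq> carrier M" "B i k \<subseteq> carrier M" for k
    using submodule_closed(1)[OF A_submodule] submodule_closed(1)[OF B_submodule] by blast+
  obtain m1 where m1: "\<forall>j\<ge>m1. A i j = A i m1"
    using chain_finite_stable[OF chains, of "A i" i] A_submodule K_le_A le am by blast
  obtain m2 where m2: "\<forall>j\<ge>m2. B i j = B i m2"
    using chain_finite_stable[OF chains, of "B i" i] B_submodule K_le_B le bm by blast
  define m where "m = max m1 m2"
  have m: "A i j = A i m \<and> B i j = B i m" if "j \<ge> m" for j
    using m1 m2 that unfolding m_def by (metis max.bounded_iff max.cobounded1 max.cobounded2)
  have "A i m \<subseteq> A i k" "B i k \<subseteq> B i m" for k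
    using m[of "max m k"] am bm unfolding monotone_def by (metis max.cobounded1 max.cobounded2)+
  then have "I i = A i m" "N i = B i m" unfolding I_def N_def by blast+
  then show ?thesis using m by blast
qed

private lemma I_submodule: "submodule (I i) R M"
  unfolding I_def by (rule submodule_INT) (rule A_submodule)

private lemma N_submodule: "submodule (N i) R M"
  using stable B_submodule by metis

private lemma K_le_I: "K i \<subseteq> I i" and K_le_N: "K i \<subseteq> N i"
  using K_le_A[of i] K_le_B[of i 0] unfolding I_def N_def by blast+

private lemma I_Suc: "I (Suc i) \<subseteq> I i" and N_Suc: "N (Suc i) \<subseteq> N i"
  using K_decreasing by (auto simp: I_def N_def A_mem B_def) blast+

private lemmas I_closed = submodule_closed[OF I_submodule]
private lemmas N_closed = submodule_closed[OF N_submodule]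

text \<open>Write x as the m-th power of f at u, up to \<open>K i\<close>. As x lies in
  \<open>B i m\<close>, u lies in \<open>B i (m + m)\<close>, which equals \<open>B i m\<close>; so
  x is in \<open>K i\<close>.\<close>

private lemma I_Int_N: "x \<in> K i" if x: "x \<in> I i" "x \<in> N i"
proof -
  obtain m where m: "I i = A i m" "N i = B i m" "\<forall>j\<ge>m. A i j = A i m \<and> B i j = B i m"
    using stable by blast
  obtain u \<kappa> where u: "u \<in> carrier M" "\<kappa> \<in> K i" "x = (f ^^ m) u \<oplus>\<^bsub>M\<^esub> \<kappa>"
    using x(1) by (auto simp: m(1) A_mem)
  have "(f ^^ m) ((f ^^ m) u) = (f ^^ m) (x \<ominus>\<^bsub>M\<^esub> \<kappa>)"
    using u by (simp add: a_minus_def M.a_assoc K_closed(1) funpow_closed M.r_neg)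
  also have "\<dots> = (f ^^ m) x \<ominus>\<^bsub>M\<^esub> (f ^^ m) \<kappa>"
    using u by (simp add: a_minus_def funpow_add funpow_uminus funpow_closed K_closed(1))
  also have "\<dots> \<in> K i" using x(2) u(2) by (auto simp: m(2) B_def intro!: K_closed(4) funpow_K)
  finally have "u \<in> B i (m + m)" using u(1) by (simp add: B_def Nat.funpow_add)
  then have "u \<in> B i m" using m(3) by (metis le_add1)
  then show "x \<in> K i" using u by (auto simp: B_def intro!: K_closed(3))
qed

text \<open>Since \<open>A i m\<close> equals \<open>A i (m + m)\<close>, the value of
  \<open>f ^^ m\<close> at x agrees modulo \<open>K i\<close> with the value of
  \<open>f ^^ (m + m)\<close> at some u. Take y to be \<open>(f ^^ m) u\<close>; then
  \<open>f ^^ m\<close> sends x - y into \<open>K i\<close>.\<close>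

private lemma I_add_N: "\<exists>y\<in>I i. x \<ominus>\<^bsub>M\<^esub> y \<in> N i" if x: "x \<in> carrier M"
proof -
  obtain m where m: "I i = A i m" "N i = B i m" "\<forall>j\<ge>m. A i j = A i m \<and> B i j = B i m"
    using stable by blast
  have "(f ^^ m) x \<in> A i m" unfolding A_mem
    using x by (intro bexI[of _ x] bexI[of _ "\<zero>\<^bsub>M\<^esub>"]) (auto simp: K_closed funpow_closed)
  then have "(f ^^ m) x \<in> A i (m + m)" using m(3) by (metis le_add1)
  then obtain u \<kappa> where u: "u \<in> carrier M" "\<kappa> \<in> K i" "(f ^^ m) x = (f ^^ m) ((f ^^ m) u) \<oplus>\<^bsub>M\<^esub> \<kappa>"
    unfolding A_mem Nat.funpow_add comp_def by blast
  have "(f ^^ m) u \<in> A i m" unfolding A_mem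
    using u by (intro bexI[of _ u] bexI[of _ "\<zero>\<^bsub>M\<^esub>"]) (auto simp: K_closed funpow_closed)
  moreover have "(f ^^ m) (x \<ominus>\<^bsub>M\<^esub> (f ^^ m) u) = \<kappa>"
    using u x K_closed(1)[OF u(2)]
    by (simp add: a_minus_def funpow_add funpow_uminus funpow_closed M.add.m_ac M.r_neg M.r_neg1 M.r_neg2)
  then have "x \<ominus>\<^bsub>M\<^esub> (f ^^ m) u \<in> B i m" using u x funpow_closed by (simp add: B_def)
  ultimately show ?thesis unfolding m(1,2) by blast
qed

private lemma f_I: "f x \<in> I i" if x: "x \<in> I i"
proof -
  have "f x \<in> A i k" for k
  proof -
    have "x \<in> A i k" using x by (simp add: I_def)
    then obtain u \<kappa> where u: "u \<in> carrier M" "\<kappa> \<in> K i" "x = (f ^^ k) u \<oplus>\<^bsub>M\<^esub> \<kappa>" by (auto simp: A_mem)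
    then have "f x = (f ^^ k) (f u) \<oplus>\<^bsub>M\<^esub> f \<kappa>"
      by (simp add: fD funpow_closed K_closed(1) flip: funpow_swap1)
    then show ?thesis unfolding A_mem using fD(1)[OF u(1)] fK[OF u(2)] by blast
  qed
  then show ?thesis by (simp add: I_def)
qed

private lemma f_N: "f x \<in> N i" if x: "x \<in> N i"
proof -
  obtain k where "x \<in> carrier M" "(f ^^ k) x \<in> K i" using x by (auto simp: N_def B_def)
  then have "f x \<in> B i k" using fK fD by (auto simp: B_def funpow_swap1[symmetric])
  then show ?thesis by (auto simp: N_def)
qed

text \<open>One application of f already puts x into \<open>N i\<close>, and \<open>I_Int_N\<close>
  applies.\<close>

private lemma f_reflects_K_I: "x \<in> K i" if "x \<in> I i" "f x \<in> K i"
proof -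
  have "x \<in> B i 1" using that I_closed(1) by (simp add: B_def)
  then show ?thesis using I_Int_N that by (auto simp: N_def)
qed

private lemma f_surj_I: "\<exists>y\<in>I i. f y \<ominus>\<^bsub>M\<^esub> x \<in> K i" if "x \<in> I i"
proof -
  obtain m where m: "I i = A i m" using stable by blast
  \<comment> \<open>One power beyond the stable index leaves a preimage of x under f that is still
    in the stable image.\<close>
  have "x \<in> A i (Suc m)" using that by (auto simp: I_def)
  then obtain u \<kappa> where u: "u \<in> carrier M" "\<kappa> \<in> K i" "x = f ((f ^^ m) u) \<oplus>\<^bsub>M\<^esub> \<kappa>" by (auto simp: A_mem)
  have "(f ^^ m) u \<in> A i m" unfolding A_mem
    using u by (intro bexI[of _ u] bexI[of _ "\<zero>\<^bsub>M\<^esub>"]) (auto simp: K_closed funpow_closed)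
  moreover have "f ((f ^^ m) u) \<ominus>\<^bsub>M\<^esub> x = \<ominus>\<^bsub>M\<^esub> \<kappa>"
    using u K_closed(1)[OF u(2)] by (simp add: a_minus_def M.minus_add fD funpow_closed M.r_neg1 M.r_neg2)
  ultimately show ?thesis unfolding m using K_closed(5)[OF u(2)] by (intro bexI[of _ "(f ^^ m) u"]) simp_all
qed

text \<open>Modulo \<open>K i\<close> the map f fixes x, hence so do all its powers, while some
  power kills x.\<close>

private lemma one_minus_f_reflects_K_N: "x \<in> K i" if x: "x \<in> N i" "x \<ominus>\<^bsub>M\<^esub> f x \<in> K i"
proof -
  have xc: "x \<in> carrier M" using x N_closed(1) by blast
  have *: "x \<ominus>\<^bsub>M\<^esub> (f ^^ k) x \<in> K i" for k
  proof (induction k)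
    case 0
    then show ?case using xc K_closed(2) by (simp add: a_minus_def M.r_neg)
  next
    case (Suc k)
    have "x \<ominus>\<^bsub>M\<^esub> f ((f ^^ k) x) = (x \<ominus>\<^bsub>M\<^esub> f x) \<oplus>\<^bsub>M\<^esub> f (x \<ominus>\<^bsub>M\<^esub> (f ^^ k) x)"
      using xc fD(1)[OF xc] fD(1)[OF funpow_closed[OF xc, of k]]
      by (simp add: a_minus_def fD funpow_closed M.a_assoc M.r_neg1)
    also have "\<dots> \<in> K i" using K_closed(3) x(2) Suc fK by blast
    finally show ?case by simp
  qed
  obtain k where "(f ^^ k) x \<in> K i" using x(1) by (auto simp: N_def B_def)
  then have "(x \<ominus>\<^bsub>M\<^esub> (f ^^ k) x) \<oplus>\<^bsub>M\<^esub> (f ^^ k) x \<in> K i" using * K_closed(3) by blast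
  then show ?thesis using xc funpow_closed by (simp add: a_minus_def M.a_assoc M.l_neg)
qed

text \<open>The solution is the finite geometric sum x + f x + ... +
  \<open>(f ^^ (k - 1)) x\<close>, where \<open>f ^^ k\<close> kills x modulo \<open>K i\<close>.
  The induction builds it from the inside: if y solves the equation for f x, then x + y solves it
  for x.\<close>

private lemma one_minus_f_surj_N:
  assumes "x \<in> N i"
  shows "\<exists>y\<in>N i. (y \<ominus>\<^bsub>M\<^esub> f y) \<ominus>\<^bsub>M\<^esub> x \<in> K i"
proof -
  have "\<exists>y\<in>N i. (y \<ominus>\<^bsub>M\<^esub> f y) \<ominus>\<^bsub>M\<^esub> x \<in> K i" if "x \<in> N i" "(f ^^ k) x \<in> K i" for k x
    using that
  proof (induction k arbitrary: x)
    case 0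
    then show ?case
      using N_closed(2) K_closed(5) N_closed(1)[of x]
      by (intro bexI[of _ "\<zero>\<^bsub>M\<^esub>"]) (simp_all add: fD a_minus_def M.r_neg)
  next
    case (Suc k)
    then obtain y where y: "y \<in> N i" "(y \<ominus>\<^bsub>M\<^esub> f y) \<ominus>\<^bsub>M\<^esub> f x \<in> K i"
      using Suc.IH[of "f x"] f_N by (metis funpow_Suc_right comp_apply)
    have c: "x \<in> carrier M" "y \<in> carrier M" using Suc.prems y N_closed(1) by blast+
    have "((x \<oplus>\<^bsub>M\<^esub> y) \<ominus>\<^bsub>M\<^esub> f (x \<oplus>\<^bsub>M\<^esub> y)) \<ominus>\<^bsub>M\<^esub> x = (y \<ominus>\<^bsub>M\<^esub> f y) \<ominus>\<^bsub>M\<^esub> f x"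
    proof -
      have "(x \<oplus>\<^bsub>M\<^esub> y) \<ominus>\<^bsub>M\<^esub> f (x \<oplus>\<^bsub>M\<^esub> y) = ((y \<ominus>\<^bsub>M\<^esub> f y) \<ominus>\<^bsub>M\<^esub> f x) \<oplus>\<^bsub>M\<^esub> x"
        using c fD(1)[OF c(1)] fD(1)[OF c(2)] by (simp add: a_minus_def fD M.minus_add M.add.m_ac)
      then show ?thesis
        using c fD(1)[OF c(1)] fD(1)[OF c(2)] by (simp add: a_minus_def M.a_assoc M.r_neg)
    qed
    then show ?case using y Suc.prems N_closed(3) by (intro bexI[of _ "x \<oplus>\<^bsub>M\<^esub> y"]) auto
  qed
  moreover obtain k where "(f ^^ k) x \<in> K i" using assms by (auto simp: N_def B_def)
  ultimately show ?thesis using assms by blast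
qed

private lemma im_eq: "fitting_im M K f = (\<Inter>i. I i)" and ker_eq: "fitting_ker M K f = (\<Inter>i. N i)"
  by (simp_all add: fitting_im_def fitting_ker_def I_def N_def A_def B_def)

lemma submodule_fitting: "submodule (fitting_im M K f) R M" "submodule (fitting_ker M K f) R M"
  unfolding im_eq ker_eq by (rule submodule_INT; rule I_submodule N_submodule)+

lemma fitting_Int: "fitting_im M K f \<inter> fitting_ker M K f = {\<zero>\<^bsub>M\<^esub>}"
proof -
  have "x = \<zero>\<^bsub>M\<^esub>" if "x \<in> fitting_im M K f" "x \<in> fitting_ker M K f" for x
  proof (rule separated)
    show "x \<in> K i" for i using that by (intro I_Int_N) (simp_all add: im_eq ker_eq)
    then show "x \<in> carrier M" by (rule K_closed(1))
  qed
  then show ?thesis using submodule_fitting[THEN submodule_closed(2)] by blast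
qed

text \<open>The y in \<open>I i\<close> with x - y in \<open>N i\<close> form a coset of
  \<open>K i\<close>, because \<open>K i\<close> lies in both components and contains their
  intersection. The components shrink with i, so the cosets are nested, and a common point
  decomposes x at all levels at once.\<close>

lemma fitting_sum:
  assumes x: "x \<in> carrier M"
  shows "\<exists>y\<in>fitting_im M K f. \<exists>z\<in>fitting_ker M K f. x = y \<oplus>\<^bsub>M\<^esub> z"
proof -
  have "\<exists>y\<in>carrier M. \<forall>i. y \<in> {y \<in> I i. x \<ominus>\<^bsub>M\<^esub> y \<in> N i}"
  proof (rule nested_cosets)
    show "{y \<in> I i. x \<ominus>\<^bsub>M\<^esub> y \<in> N i} \<noteq> {}" for i using I_add_N[OF x] by blast
    show "{y \<in> I (Suc i). x \<ominus>\<^bsub>M\<^esub> y \<in> N (Suc i)} \<subseteq> {y \<in> I i. x \<ominus>\<^bsub>M\<^esub> y \<in> N i}" for i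
      using I_Suc N_Suc by blast
    show "y \<ominus>\<^bsub>M\<^esub> z \<in> K i"
      if "y \<in> {y \<in> I i. x \<ominus>\<^bsub>M\<^esub> y \<in> N i}" "z \<in> {y \<in> I i. x \<ominus>\<^bsub>M\<^esub> y \<in> N i}" for i y z
    proof (rule I_Int_N)
      show "y \<ominus>\<^bsub>M\<^esub> z \<in> I i" using that I_closed(4) by blast
      have "y \<in> carrier M" "z \<in> carrier M" using that I_closed(1) by blast+
      then have "y \<ominus>\<^bsub>M\<^esub> z = (x \<ominus>\<^bsub>M\<^esub> z) \<ominus>\<^bsub>M\<^esub> (x \<ominus>\<^bsub>M\<^esub> y)"
        using x by (simp add: a_minus_def M.minus_add M.add.m_ac M.r_neg1 M.r_neg2 M.r_neg)
      then show "y \<ominus>\<^bsub>M\<^esub> z \<in> N i" using that N_closed(4) by auto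
    qed
    show "k \<oplus>\<^bsub>M\<^esub> y \<in> {y \<in> I i. x \<ominus>\<^bsub>M\<^esub> y \<in> N i}"
      if "k \<in> K i" "y \<in> {y \<in> I i. x \<ominus>\<^bsub>M\<^esub> y \<in> N i}" for i k y
    proof -
      have c: "k \<in> carrier M" "y \<in> carrier M" using that I_closed(1) K_closed(1) by blast+
      have "x \<ominus>\<^bsub>M\<^esub> (k \<oplus>\<^bsub>M\<^esub> y) = (x \<ominus>\<^bsub>M\<^esub> y) \<ominus>\<^bsub>M\<^esub> k"
        using x c by (simp add: a_minus_def M.minus_add M.add.m_ac)
      then show ?thesis using that K_le_I K_le_N I_closed(3)[of k i y] N_closed(4)[of "x \<ominus>\<^bsub>M\<^esub> y" i k] by auto
    qed
  qed (use I_closed(1) in blast)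
  then obtain y where y: "y \<in> carrier M" "\<And>i. y \<in> I i" "\<And>i. x \<ominus>\<^bsub>M\<^esub> y \<in> N i" by blast
  have "x = y \<oplus>\<^bsub>M\<^esub> (x \<ominus>\<^bsub>M\<^esub> y)" using x y(1) by (simp add: a_minus_def M.add.m_ac M.r_neg1 M.r_neg)
  then show ?thesis using y unfolding im_eq ker_eq by blast
qed

text \<open>Two elements with the same image differ by an element of every \<open>K i\<close>, hence
  by zero; preimages come from \<open>solve_levelwise\<close> with \<open>H\<close> taken to be
  \<open>I\<close>.\<close>

lemma fitting_im_bij: "bij_betw f (fitting_im M K f) (fitting_im M K f)"
proof (rule bij_betw_imageI)
  have c: "x \<in> carrier M" if "x \<in> fitting_im M K f" for x using that submodule_closed(1)[OF submodule_fitting(1)] by blast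
  show "inj_on f (fitting_im M K f)"
  proof (rule inj_onI)
    fix x y assume xy: "x \<in> fitting_im M K f" "y \<in> fitting_im M K f" "f x = f y"
    have "f (x \<ominus>\<^bsub>M\<^esub> y) = \<zero>\<^bsub>M\<^esub>" using xy(3) c[OF xy(1)] c[OF xy(2)] by (simp add: a_minus_def fD M.r_neg)
    moreover have "x \<ominus>\<^bsub>M\<^esub> y \<in> I i" for i
      by (rule I_closed(4)) (use xy in \<open>simp_all add: im_eq\<close>)
    ultimately have "x \<ominus>\<^bsub>M\<^esub> y \<in> K i" for i
      by (metis K_closed(2) f_reflects_K_I)
    then have "x \<ominus>\<^bsub>M\<^esub> y = \<zero>\<^bsub>M\<^esub>" using separated xy(1,2) c by simp
    then show "x = y" using xy(1,2) c by (metis minus_eq_zero_imp_eq)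
  qed
  show "f ` fitting_im M K f = fitting_im M K f"
  proof (intro equalityI subsetI)
    fix x assume x: "x \<in> fitting_im M K f"
    then have "\<exists>y\<in>\<Inter>i. I i. f y = x"
      using f fK c I_submodule K_le_I I_Suc f_reflects_K_I f_surj_I
      by (intro solve_levelwise) (auto simp: im_eq)
    then show "x \<in> f ` fitting_im M K f" by (auto simp: im_eq)
  qed (auto simp: im_eq f_I)
qed

lemma fitting_ker_bij: "bij_betw (\<lambda>x. x \<ominus>\<^bsub>M\<^esub> f x) (fitting_ker M K f) (fitting_ker M K f)"
proof (rule bij_betw_imageI)
  \<comment> \<open>The map 1 - f made extensional, as membership in \<open>left_hom\<close>
    requires; it agrees with the map in the statement on every \<open>N i\<close>.\<close>
  define g where "g = (\<lambda>x\<in>carrier M. x \<ominus>\<^bsub>M\<^esub> f x)"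
  have g: "g \<in> left_hom R M M"
    unfolding left_hom_def g_def
    by (auto simp: fD a_minus_def M.minus_add M.add.m_ac smult_r_distr smult_r_minus)
  have gK: "g x \<in> K i" if "x \<in> K i" for x i
    using that K_closed(1)[OF that] fK by (simp add: g_def K_closed(4))
  have c: "x \<in> carrier M" if "x \<in> fitting_ker M K f" for x using that submodule_closed(1)[OF submodule_fitting(2)] by blast
  show "inj_on (\<lambda>x. x \<ominus>\<^bsub>M\<^esub> f x) (fitting_ker M K f)"
  proof (rule inj_onI)
    fix x y assume xy: "x \<in> fitting_ker M K f" "y \<in> fitting_ker M K f" "x \<ominus>\<^bsub>M\<^esub> f x = y \<ominus>\<^bsub>M\<^esub> f y"
    have "(x \<ominus>\<^bsub>M\<^esub> y) \<ominus>\<^bsub>M\<^esub> f (x \<ominus>\<^bsub>M\<^esub> y) = (x \<ominus>\<^bsub>M\<^esub> f x) \<ominus>\<^bsub>M\<^esub> (y \<ominus>\<^bsub>M\<^esub> f y)"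
      using c[OF xy(1)] c[OF xy(2)] by (simp add: a_minus_def fD M.minus_add M.add.m_ac)
    then have "(x \<ominus>\<^bsub>M\<^esub> y) \<ominus>\<^bsub>M\<^esub> f (x \<ominus>\<^bsub>M\<^esub> y) = \<zero>\<^bsub>M\<^esub>" using xy(3) c[OF xy(2)] fD(1)[OF c[OF xy(2)]] by (simp add: a_minus_def M.r_neg)
    moreover have "x \<ominus>\<^bsub>M\<^esub> y \<in> N i" for i
      by (rule N_closed(4)) (use xy in \<open>simp_all add: ker_eq\<close>)
    ultimately have "x \<ominus>\<^bsub>M\<^esub> y \<in> K i" for i
      by (metis K_closed(2) one_minus_f_reflects_K_N)
    then have "x \<ominus>\<^bsub>M\<^esub> y = \<zero>\<^bsub>M\<^esub>" using separated xy(1,2) c by simp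
    then show "x = y" using xy(1,2) c by (metis minus_eq_zero_imp_eq)
  qed
  show "(\<lambda>x. x \<ominus>\<^bsub>M\<^esub> f x) ` fitting_ker M K f = fitting_ker M K f"
  proof (intro equalityI subsetI)
    fix x assume x: "x \<in> fitting_ker M K f"
    have gN: "g y = y \<ominus>\<^bsub>M\<^esub> f y" if "y \<in> N i" for y i using N_closed(1)[OF that] by (simp add: g_def)
    have "\<exists>y\<in>\<Inter>i. N i. g y = x"
    proof (rule solve_levelwise[OF g gK])
      show "\<exists>y\<in>N i. g y \<ominus>\<^bsub>M\<^esub> x \<in> K i" for i
        using one_minus_f_surj_N[of x i] x gN by (auto simp: ker_eq)
      show "y \<in> K i" if "y \<in> N i" "g y \<in> K i" for i y
        using one_minus_f_reflects_K_N that gN by auto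
    qed (use x c K_le_N N_Suc N_submodule in auto)
    then show "x \<in> (\<lambda>x. x \<ominus>\<^bsub>M\<^esub> f x) ` fitting_ker M K f"
      using gN by (auto simp: ker_eq image_iff)
  qed (auto simp: ker_eq intro: N_closed(4) f_N)
qed

end

end

text \<open>The map g intertwines all powers of f and f' and respects the filtrations, and the
  Fitting submodules are expressed by these data alone. It will be applied to the differentials of a
  complex.\<close>

lemma fitting_natural:
  assumes M: "left_module R M" and N: "left_module R N"
    and f: "f \<in> left_hom R M M" and f': "f' \<in> left_hom R N N" and g: "g \<in> left_hom R M N"
    and gK: "\<And>i x. x \<in> K i \<Longrightarrow> g x \<in> L i" and K: "\<And>i. K i \<subseteq> carrier M"
    and comm: "\<And>x. x \<in> carrier M \<Longrightarrow> g (f x) = f' (g x)"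
  shows "x \<in> fitting_im M K f \<Longrightarrow> g x \<in> fitting_im N L f'"
    and "x \<in> fitting_ker M K f \<Longrightarrow> g x \<in> fitting_ker N L f'"
proof -
  note fD = left_homD[OF f] and gD = left_homD[OF g]
  have cl: "(f ^^ k) x \<in> carrier M" if "x \<in> carrier M" for x k
    using that by (induction k) (auto simp: fD)
  have p: "g ((f ^^ k) x) = (f' ^^ k) (g x)" if "x \<in> carrier M" for x k
    using that by (induction k) (auto simp: comm cl)
  show "g x \<in> fitting_im N L f'" if x: "x \<in> fitting_im M K f"
    unfolding fitting_im_def
  proof (intro INT_I)
    fix i k
    obtain u \<kappa> where u: "u \<in> carrier M" "\<kappa> \<in> K i" "x = (f ^^ k) u \<oplus>\<^bsub>M\<^esub> \<kappa>"
      using x unfolding fitting_im_def set_add_def' by blast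
    then have "g x = (f' ^^ k) (g u) \<oplus>\<^bsub>N\<^esub> g \<kappa>" using gD(2)[OF cl[of u k], of \<kappa>] p[of u k] K[of i] by auto
    then show "g x \<in> (f' ^^ k) ` carrier N <+>\<^bsub>N\<^esub> L i"
      unfolding set_add_def' using u gK gD(1) by blast
  qed
  show "g x \<in> fitting_ker N L f'" if "x \<in> fitting_ker M K f"
    using that gK gD(1) unfolding fitting_ker_def by (auto simp flip: p) (metis p)
qed

section \<open>Finitely generated projective modules over an adically complete ring\<close>

lemma hom_finsum_gen:
  assumes M: "abelian_monoid M" and N: "abelian_monoid N"
    and h: "\<And>x. x \<in> carrier M \<Longrightarrow> h x \<in> carrier N"
    "\<And>x y. \<lbrakk>x \<in> carrier M; y \<in> carrier M\<rbrakk> \<Longrightarrow> h (x \<oplus>\<^bsub>M\<^esub> y) = h x \<oplus>\<^bsub>N\<^esub> h y" "h \<zero>\<^bsub>M\<^esub> = \<zero>\<^bsub>N\<^esub>"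
    and f: "f \<in> A \<rightarrow> carrier M"
  shows "h (finsum M f A) = finsum N (\<lambda>i. h (f i)) A"
  using comm_monoid.hom_finprod_gen[of "add_monoid M" "add_monoid N" h f A] assms
  by (simp add: finsum_def abelian_monoid_def)

lemma left_hom_comp:
  assumes "f \<in> left_hom R L M" "g \<in> left_hom R M N" "left_module R L"
  shows "(\<lambda>x\<in>carrier L. g (f x)) \<in> left_hom R L N"
proof -
  interpret L: left_module R L by fact
  show ?thesis
    using left_homD[OF assms(1)] left_homD[OF assms(2)] by (auto simp: left_hom_def)
qed

lemma left_hom_add:
  assumes "f \<in> left_hom R M N" "g \<in> left_hom R M N" "left_module R M" "left_module R N"
  shows "(\<lambda>x\<in>carrier M. f x \<oplus>\<^bsub>N\<^esub> g x) \<in> left_hom R M N"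
proof -
  interpret M: left_module R M by fact
  interpret N: left_module R N by fact
  show ?thesis
    using left_homD[OF assms(1)] left_homD[OF assms(2)]
    by (auto simp: left_hom_def N.M.add.m_ac N.smult_r_distr)
qed

lemma left_hom_uminus:
  assumes "f \<in> left_hom R M N" "left_module R M" "left_module R N"
  shows "(\<lambda>x\<in>carrier M. \<ominus>\<^bsub>N\<^esub> f x) \<in> left_hom R M N"
proof -
  interpret M: left_module R M by fact
  interpret N: left_module R N by fact
  show ?thesis
    using left_homD[OF assms(1)]
    by (auto simp: left_hom_def N.M.minus_add N.smult_r_minus)
qed

lemma left_hom_const_zero:
  assumes "left_module R M" "left_module R N"
  shows "(\<lambda>x\<in>carrier M. \<zero>\<^bsub>N\<^esub>) \<in> left_hom R M N"
proof -
  interpret M: left_module R M by fact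
  interpret N: left_module R N by fact
  show ?thesis by (auto simp: left_hom_def)
qed

lemma left_hom_id: "left_module R M \<Longrightarrow> (\<lambda>x\<in>carrier M. x) \<in> left_hom R M M"
proof -
  assume "left_module R M"
  then interpret M: left_module R M .
  show ?thesis by (auto simp: left_hom_def)
qed

lemma left_hom_a_inv:
  assumes "left_module R M" "left_module R N" "f \<in> left_hom R M N" "x \<in> carrier M"
  shows "f (\<ominus>\<^bsub>M\<^esub> x) = \<ominus>\<^bsub>N\<^esub> f x"
proof -
  interpret M: left_module R M by fact
  interpret N: left_module R N by fact
  show ?thesis
    using left_homD(3)[OF assms(3), of "\<ominus>\<^bsub>R\<^esub> \<one>\<^bsub>R\<^esub>" x] left_homD(1)[OF assms(3,4)] assms(4)
    by (simp add: M.smult_minus_one N.smult_minus_one)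
qed

lemma left_hom_finsum:
  assumes "left_module R M" "left_module R N" "f \<in> left_hom R M N" "a \<in> A \<rightarrow> carrier M"
  shows "f (finsum M a A) = finsum N (\<lambda>i. f (a i)) A"
proof -
  interpret M: left_module R M by fact
  interpret N: left_module R N by fact
  show ?thesis
    using left_homD[OF assms(3)] left_hom_zero[OF assms(1-3)] assms(4)
    by (intro hom_finsum_gen) (auto intro: M.M.abelian_monoid_axioms N.M.abelian_monoid_axioms)
qed

context left_module
begin

lemma smult_finsum:
  assumes "r \<in> carrier R" "a \<in> A \<rightarrow> carrier M"
  shows "r \<odot>\<^bsub>M\<^esub> finsum M a A = finsum M (\<lambda>i. r \<odot>\<^bsub>M\<^esub> a i) A"
  using assms by (intro hom_finsum_gen) (auto simp: smult_r_distr intro: M.abelian_monoid_axioms)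

lemma submodule_finsum:
  assumes "submodule H R M" "\<And>i. i \<in> A \<Longrightarrow> a i \<in> H"
  shows "finsum M a A \<in> H"
  using assms(2)
proof (induction A rule: infinite_finite_induct)
  case (insert i A)
  then have "a \<in> A \<rightarrow> carrier M" "a i \<in> carrier M" using submodule_closed(1)[OF assms(1)] by auto
  then show ?case using insert submodule_closed(3)[OF assms(1)] by simp
qed (simp_all add: submodule_closed(2)[OF assms(1)])

end

lemma finitely_generated_gen:
  assumes "\<Inter>{H. submodule H R M \<and> S \<subseteq> H} = carrier M" "submodule H R M" "S \<subseteq> H"
  shows "H = carrier M"
  using assms submodule_props(1)[OF assms(2)] by blast

lemma finitely_generatedI:
  assumes M: "left_module R M" and "finite S" "S \<subseteq> carrier M"
    and gen: "\<And>H. submodule H R M \<Longrightarrow> S \<subseteq> H \<Longrightarrow> carrier M \<subseteq> H"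
  shows "finitely_generated R M"
proof -
  interpret left_module R M by fact
  have "\<Inter>{H. submodule H R M \<and> S \<subseteq> H} = carrier M"
    using gen assms(3) submodule_carrier by blast
  then show ?thesis using assms(2,3) unfolding finitely_generated_def by blast
qed

lemma submodule_vimage:
  assumes M: "left_module R M" and N: "left_module R N" and f: "f \<in> left_hom R M N"
    and H: "submodule H R N"
  shows "submodule {x \<in> carrier M. f x \<in> H} R M"
proof -
  interpret M: left_module R M by fact
  show ?thesis
    using left_homD[OF f] left_hom_zero[OF M N f] submodule_props[OF H]
    by (intro M.left_submoduleI) auto
qed

text \<open>The case of a retract of \<open>P1\<close> is included by taking \<open>P2 = P1\<close> and \<open>i2 = 0\<close>.\<close>

lemma fg_projective_sum:
  assumes P1: "fg_projective R P1" and P2: "fg_projective R P2" and Q: "left_module R Q"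
    and i: "i1 \<in> left_hom R P1 Q" "i2 \<in> left_hom R P2 Q"
    and p: "p1 \<in> left_hom R Q P1" "p2 \<in> left_hom R Q P2"
    and ip: "\<And>x. x \<in> carrier Q \<Longrightarrow> i1 (p1 x) \<oplus>\<^bsub>Q\<^esub> i2 (p2 x) = x"
  shows "fg_projective R Q"
proof -
  have m: "left_module R P1" "left_module R P2" using P1 P2 by (auto simp: fg_projective_def)
  obtain S1 where S1: "finite S1" "S1 \<subseteq> carrier P1" "\<Inter>{H. submodule H R P1 \<and> S1 \<subseteq> H} = carrier P1"
    using P1 unfolding fg_projective_def finitely_generated_def by blast
  obtain S2 where S2: "finite S2" "S2 \<subseteq> carrier P2" "\<Inter>{H. submodule H R P2 \<and> S2 \<subseteq> H} = carrier P2"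
    using P2 unfolding fg_projective_def finitely_generated_def by blast
  have fg: "finitely_generated R Q"
  proof (rule finitely_generatedI[OF Q])
    show "finite (i1 ` S1 \<union> i2 ` S2)" using S1 S2 by simp
    show "i1 ` S1 \<union> i2 ` S2 \<subseteq> carrier Q" using S1 S2 left_homD(1)[OF i(1)] left_homD(1)[OF i(2)] by blast
    fix H assume H: "submodule H R Q" "i1 ` S1 \<union> i2 ` S2 \<subseteq> H"
    have 1: "{x \<in> carrier P1. i1 x \<in> H} = carrier P1"
      using H(2) S1(2) by (intro finitely_generated_gen[OF S1(3) submodule_vimage[OF m(1) Q i(1) H(1)]]) auto
    have 2: "{x \<in> carrier P2. i2 x \<in> H} = carrier P2"
      using H(2) S2(2) by (intro finitely_generated_gen[OF S2(3) submodule_vimage[OF m(2) Q i(2) H(1)]]) auto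
    show "carrier Q \<subseteq> H"
    proof
      fix x assume x: "x \<in> carrier Q"
      then have "i1 (p1 x) \<in> H" "i2 (p2 x) \<in> H"
        using 1 2 left_homD(1)[OF p(1)] left_homD(1)[OF p(2)] by blast+
      then show "x \<in> H" using submodule_props(3)[OF H(1)] ip[OF x] by metis
    qed
  qed
  show ?thesis
    unfolding fg_projective_def
  proof (intro conjI Q fg allI impI, elim conjE)
    fix N L :: "('a, nat \<Rightarrow> 'a) module" and g f
    assume N: "left_module R N" and L: "left_module R L" and g: "g \<in> left_hom R N L"
      "g ` carrier N = carrier L" and f: "f \<in> left_hom R Q L"
    obtain h1 where h1: "h1 \<in> left_hom R P1 N" "\<And>x. x \<in> carrier P1 \<Longrightarrow> g (h1 x) = f (i1 x)"
      using fg_projective_lift[OF P1 N L g left_hom_comp[OF i(1) f m(1)]] by auto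
    obtain h2 where h2: "h2 \<in> left_hom R P2 N" "\<And>x. x \<in> carrier P2 \<Longrightarrow> g (h2 x) = f (i2 x)"
      using fg_projective_lift[OF P2 N L g left_hom_comp[OF i(2) f m(2)]] by auto
    let ?h = "\<lambda>x\<in>carrier Q. (\<lambda>x\<in>carrier Q. h1 (p1 x)) x \<oplus>\<^bsub>N\<^esub> (\<lambda>x\<in>carrier Q. h2 (p2 x)) x"
    have "?h \<in> left_hom R Q N"
      by (intro left_hom_add left_hom_comp[OF p(1) h1(1)] left_hom_comp[OF p(2) h2(1)] Q N)
    moreover have "g (?h x) = f x" if x: "x \<in> carrier Q" for x
    proof -
      have c: "p1 x \<in> carrier P1" "p2 x \<in> carrier P2" using x left_homD(1)[OF p(1)] left_homD(1)[OF p(2)] by auto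
      then have "g (?h x) = f (i1 (p1 x)) \<oplus>\<^bsub>L\<^esub> f (i2 (p2 x))"
        using x left_homD(2)[OF g(1)] left_homD(1)[OF h1(1)] left_homD(1)[OF h2(1)] h1(2) h2(2) by simp
      also have "\<dots> = f x"
        using c x left_homD(2)[OF f] left_homD(1)[OF i(1)] left_homD(1)[OF i(2)] ip by metis
      finally show ?thesis .
    qed
    ultimately show "\<exists>h\<in>left_hom R Q N. \<forall>x\<in>carrier Q. g (h x) = f x" by blast
  qed
qed

lemma fg_projective_retract:
  assumes P: "fg_projective R P" and Q: "left_module R Q"
    and i: "i \<in> left_hom R Q P" and p: "p \<in> left_hom R P Q"
    and pi: "\<And>x. x \<in> carrier Q \<Longrightarrow> p (i x) = x"
  shows "fg_projective R Q"
proof -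
  interpret Q: left_module R Q by fact
  have m: "left_module R P" using P by (simp add: fg_projective_def)
  show ?thesis
    using left_hom_const_zero[OF m Q] left_homD(1)[OF i] pi
    by (intro fg_projective_sum[OF P P Q p _ i i]) auto
qed

lemma fg_projective_zero:
  assumes Z: "left_module R Z" "carrier Z = {\<zero>\<^bsub>Z\<^esub>}"
  shows "fg_projective R Z"
proof -
  interpret Z: left_module R Z by fact
  have "finitely_generated R Z"
    using Z submodule_props(2) by (intro finitely_generatedI[of R Z "{}"]) auto
  moreover have "\<exists>h\<in>left_hom R Z N. \<forall>x\<in>carrier Z. g (h x) = f x"
    if h: "left_module R N" "left_module R L" "g \<in> left_hom R N L" "f \<in> left_hom R Z L"
    for N L :: "('a, nat \<Rightarrow> 'a) module" and g f
    using left_hom_const_zero[OF Z(1) h(1)] left_hom_zero[OF h(1-3)] left_hom_zero[OF Z(1) h(2,4)] Z(2)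
    by (intro bexI[of _ "\<lambda>x\<in>carrier Z. \<zero>\<^bsub>N\<^esub>"]) auto
  ultimately show ?thesis using Z(1) by (auto simp: fg_projective_def)
qed

context ring
begin

lemma left_module_regular: "left_module R (regular_module R)"
proof -
  have "abelian_group (regular_module R)"
    by (rule abelian_groupI) (auto simp: regular_module_def add.m_ac intro: l_neg)
  then show ?thesis
    by (intro left_module.intro left_module_axioms.intro)
      (auto simp: regular_module_def l_distr r_distr m_assoc intro: ring_axioms)
qed

text \<open>Tuples of length n, padded with zeros so that equality of functions is equality of
  tuples and one carrier type serves all n.\<close>

definition free_module :: "nat \<Rightarrow> ('a, nat \<Rightarrow> 'a) module"
  where "free_module n = \<lparr>carrier = {c. (\<forall>i<n. c i \<in> carrier R) \<and> (\<forall>i\<ge>n. c i = \<zero>)},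
    mult = undefined, one = undefined, zero = (\<lambda>_. \<zero>), add = (\<lambda>c d i. c i \<oplus> d i),
    smult = (\<lambda>a c i. a \<otimes> c i)\<rparr>"

lemma free_module_nth: "c \<in> carrier (free_module n) \<Longrightarrow> c i \<in> carrier R"
  by (cases "i < n") (auto simp: free_module_def)

lemma left_module_free: "left_module R (free_module n)"
proof -
  note c = free_module_nth[of _ n]
  have "abelian_group (free_module n)"
  proof (rule abelian_groupI, goal_cases)
    case (6 x)
    then show ?case
      by (intro bexI[of _ "\<lambda>i. \<ominus> x i"]) (auto simp: free_module_def l_neg fun_eq_iff c[OF 6])
  next
    case (3 x y z)
    then show ?case by (auto simp: free_module_def fun_eq_iff c[OF 3(1)] c[OF 3(2)] c[OF 3(3)] a_assoc)
  next
    case (4 x y)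
    then show ?case by (auto simp: free_module_def fun_eq_iff c[OF 4(1)] c[OF 4(2)] a_comm)
  next
    case (5 x)
    then show ?case by (auto simp: free_module_def fun_eq_iff c[OF 5])
  qed (auto simp: free_module_def)
  moreover have "x i \<in> carrier R" if "\<forall>i<n. x i \<in> carrier R" "\<forall>i\<ge>n. x i = \<zero>" for x i
    using that by (cases "i < n") auto
  ultimately show ?thesis
    using ring_axioms
    by (intro left_module.intro left_module_axioms.intro)
      (simp_all add: free_module_def fun_eq_iff l_distr r_distr m_assoc)
qed

text \<open>Generators of P give a surjection g from a free module. Projectivity lifts the identity
  of P to a section h of g, and the \<phi> j are the coordinates of h. Through these coordinates,
  statements about P reduce to statements about the ring.\<close>

lemma fg_projective_dual_basis:
  assumes P: "fg_projective R P"
  shows "\<exists>n p \<phi>. (\<forall>j<n. p j \<in> carrier P \<and> \<phi> j \<in> left_hom R P (regular_module R)) \<and>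
    (\<forall>x\<in>carrier P. x = finsum P (\<lambda>j. \<phi> j x \<odot>\<^bsub>P\<^esub> p j) {..<n::nat})"
proof -
  interpret P: left_module R P using P by (simp add: fg_projective_def)
  obtain S where S: "finite S" "S \<subseteq> carrier P" "\<Inter>{H. submodule H R P \<and> S \<subseteq> H} = carrier P"
    using P unfolding fg_projective_def finitely_generated_def by blast
  obtain n :: nat and p where p: "S = p ` {i. i < n}" using finite_imp_nat_seg_image_inj_on[OF S(1)] by blast
  have pc: "p j \<in> carrier P" if "j < n" for j using S(2) p that by auto
  let ?F = "free_module n"
  interpret F: left_module R ?F by (rule left_module_free)
  define g where "g = (\<lambda>c\<in>carrier ?F. finsum P (\<lambda>j. c j \<odot>\<^bsub>P\<^esub> p j) {..<n})"
  have Fs: "(c \<oplus>\<^bsub>?F\<^esub> d) j = c j \<oplus> d j" "(a \<odot>\<^bsub>?F\<^esub> c) j = a \<otimes> c j" for a c d j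
    by (simp_all add: free_module_def)
  have g: "g \<in> left_hom R ?F P"
  proof -
    have t: "c j \<odot>\<^bsub>P\<^esub> p j \<in> carrier P" if "c \<in> carrier ?F" "j < n" for c j
      using free_module_nth[OF that(1)] pc[OF that(2)] by simp
    have "g c \<in> carrier P" if "c \<in> carrier ?F" for c
      using t[OF that] that by (auto simp: g_def intro!: P.M.finsum_closed)
    moreover have "g (c \<oplus>\<^bsub>?F\<^esub> d) = g c \<oplus>\<^bsub>P\<^esub> g d" if cd: "c \<in> carrier ?F" "d \<in> carrier ?F" for c d
    proof -
      have "g c \<oplus>\<^bsub>P\<^esub> g d = finsum P (\<lambda>j. c j \<odot>\<^bsub>P\<^esub> p j \<oplus>\<^bsub>P\<^esub> d j \<odot>\<^bsub>P\<^esub> p j) {..<n}"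
        unfolding g_def using t[OF cd(1)] t[OF cd(2)] cd by (subst P.M.finsum_addf) auto
      also have "\<dots> = finsum P (\<lambda>j. (c \<oplus>\<^bsub>?F\<^esub> d) j \<odot>\<^bsub>P\<^esub> p j) {..<n}"
        using t[OF F.M.a_closed[OF cd]] free_module_nth[OF cd(1)] free_module_nth[OF cd(2)] pc
        by (intro P.M.finsum_cong') (auto simp: Fs P.smult_l_distr)
      finally show ?thesis using cd by (simp add: g_def)
    qed
    moreover have "g (a \<odot>\<^bsub>?F\<^esub> c) = a \<odot>\<^bsub>P\<^esub> g c" if ac: "a \<in> carrier R" "c \<in> carrier ?F" for a c
    proof -
      have "a \<odot>\<^bsub>P\<^esub> g c = finsum P (\<lambda>j. a \<odot>\<^bsub>P\<^esub> (c j \<odot>\<^bsub>P\<^esub> p j)) {..<n}"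
        unfolding g_def using t[OF ac(2)] ac by (subst P.smult_finsum[symmetric]) auto
      also have "\<dots> = finsum P (\<lambda>j. (a \<odot>\<^bsub>?F\<^esub> c) j \<odot>\<^bsub>P\<^esub> p j) {..<n}"
        using t[OF F.smult_closed[OF ac]] free_module_nth[OF ac(2)] pc ac(1)
        by (intro P.M.finsum_cong') (auto simp: Fs P.smult_assoc1)
      finally show ?thesis using ac by (simp add: g_def)
    qed
    ultimately show ?thesis by (auto simp: left_hom_def g_def)
  qed
  have surj: "g ` carrier ?F = carrier P"
  proof (rule finitely_generated_gen[OF S(3)])
    show "submodule (g ` carrier ?F) R P"
    proof (rule P.left_submoduleI)
      show "g ` carrier ?F \<subseteq> carrier P" using left_homD(1)[OF g] by blast
      show "\<zero>\<^bsub>P\<^esub> \<in> g ` carrier ?F"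
        using left_hom_zero[OF F.left_module_axioms P.left_module_axioms g] by (metis F.M.zero_closed imageI)
      show "x \<oplus>\<^bsub>P\<^esub> y \<in> g ` carrier ?F" if "x \<in> g ` carrier ?F" "y \<in> g ` carrier ?F" for x y
        using that by (elim imageE) (simp add: left_homD(2)[OF g, symmetric])
      show "a \<odot>\<^bsub>P\<^esub> x \<in> g ` carrier ?F" if "a \<in> carrier R" "x \<in> g ` carrier ?F" for a x
        using that by (elim imageE) (simp add: left_homD(3)[OF g, symmetric])
    qed
    show "S \<subseteq> g ` carrier ?F"
    proof
      fix s assume "s \<in> S"
      then obtain k where k: "k < n" "s = p k" using p by auto
      define c where "c = (\<lambda>i. if i = k then \<one> else \<zero>)"
      have c: "c \<in> carrier ?F" using k by (auto simp: c_def free_module_def)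
      have "g c = finsum P (\<lambda>j. if k = j then p j else \<zero>\<^bsub>P\<^esub>) {..<n}"
        using c pc by (auto simp: g_def c_def intro!: P.M.finsum_cong')
      also have "\<dots> = p k" using k pc by (intro P.M.finsum_singleton) auto
      finally show "s \<in> g ` carrier ?F" using c k by (metis imageI)
    qed
  qed
  obtain h where h: "h \<in> left_hom R P ?F" "\<And>x. x \<in> carrier P \<Longrightarrow> g (h x) = x"
    using fg_projective_lift[OF P F.left_module_axioms P.left_module_axioms g surj left_hom_id[OF P.left_module_axioms]]
    by auto
  note hD = left_homD[OF h(1)]
  define \<phi> where "\<phi> j = (\<lambda>x\<in>carrier P. h x j)" for j
  have "\<phi> j \<in> left_hom R P (regular_module R)" for j
    unfolding left_hom_def \<phi>_def
    using free_module_nth[OF hD(1), of _ j] by (auto simp: hD(2,3) Fs) (auto simp: regular_module_def)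
  moreover have "x = finsum P (\<lambda>j. \<phi> j x \<odot>\<^bsub>P\<^esub> p j) {..<n}" if "x \<in> carrier P" for x
    using h(2)[OF that] hD(1)[OF that] that by (simp add: g_def \<phi>_def)
  ultimately show ?thesis using pc by blast
qed

end

text \<open>
  For a finitely generated projective \<open>P\<close> this is \<open>I\<^sup>i P\<close>, by a dual basis. In terms of
  functionals it is evidently natural in \<open>P\<close>.
\<close>

definition adic_filtration :: "('a, 'r) ring_scheme \<Rightarrow> 'a set \<Rightarrow> ('a, 'b, 'm) module_scheme \<Rightarrow> nat \<Rightarrow> 'b set"
  where "adic_filtration R I P i =
    {x \<in> carrier P. \<forall>\<phi>\<in>left_hom R P (regular_module R). \<phi> x \<in> ideal_pow R I i}"

text \<open>Composing a functional on Q with g gives a functional on P.\<close>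

lemma adic_filtration_hom:
  assumes "left_module R P" "g \<in> left_hom R P Q" "x \<in> adic_filtration R I P i"
  shows "g x \<in> adic_filtration R I Q i"
proof -
  have "\<phi> (g x) \<in> ideal_pow R I i" if "\<phi> \<in> left_hom R Q (regular_module R)" for \<phi>
    using left_hom_comp[OF assms(2) that assms(1)] assms(3) by (force simp: adic_filtration_def)
  then show ?thesis using left_homD(1)[OF assms(2)] assms(3) by (auto simp: adic_filtration_def)
qed

locale complete_adic_ring = ring +
  fixes I
  assumes I_ideal: "ideal I R"
    and finite_length_quot: "\<And>i. i \<ge> 1 \<Longrightarrow> finite_length R (quot_module (regular_module R) (ideal_pow R I i))"
    and adic_complete: "adic_complete R I"
begin

abbreviation "J \<equiv> ideal_pow R I"

lemma J_ideal: "ideal (J i) R"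
  by (induction i) (auto simp: oneideal intro: ideal_prod_is_ideal I_ideal)

lemma J_carrier: "x \<in> J i \<Longrightarrow> x \<in> carrier R"
  using J_ideal ideal.Icarr by metis

lemma J_Suc: "J (Suc i) \<subseteq> J i"
  using ideal_prod_inter[OF J_ideal I_ideal] by auto

lemma J_closed:
  "\<zero> \<in> J i" "\<lbrakk>x \<in> J i; y \<in> J i\<rbrakk> \<Longrightarrow> x \<oplus> y \<in> J i"
  "\<lbrakk>a \<in> carrier R; x \<in> J i\<rbrakk> \<Longrightarrow> a \<otimes> x \<in> J i" "\<lbrakk>a \<in> carrier R; x \<in> J i\<rbrakk> \<Longrightarrow> x \<otimes> a \<in> J i"
proof -
  interpret ideal "J i" R by (rule J_ideal)
  show "\<zero> \<in> J i" "\<lbrakk>x \<in> J i; y \<in> J i\<rbrakk> \<Longrightarrow> x \<oplus> y \<in> J i"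
  "\<lbrakk>a \<in> carrier R; x \<in> J i\<rbrakk> \<Longrightarrow> a \<otimes> x \<in> J i" "\<lbrakk>a \<in> carrier R; x \<in> J i\<rbrakk> \<Longrightarrow> x \<otimes> a \<in> J i"
    by (auto intro: I_l_closed I_r_closed)
qed

sublocale reg: left_module R "regular_module R"
  by (rule left_module_regular)

lemma J_submodule: "submodule (J i) R (regular_module R)"
  by (rule reg.left_submoduleI) (auto simp: regular_module_def J_closed J_carrier)

lemma J_coset_eq:
  assumes "x \<in> carrier R" "y \<in> carrier R"
  shows "J i +> x = J i +> y \<longleftrightarrow> x \<ominus> y \<in> J i"
proof -
  interpret J: ideal "J i" R by (rule J_ideal)
  have "x \<in> J i +> y \<longleftrightarrow> x \<ominus> y \<in> J i"
    unfolding a_minus_def using assms by (intro J.a_rcos_module)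
  moreover have "x \<in> J i +> x" using J.a_rcos_self assms by simp
  ultimately show ?thesis using J.a_repr_independence'[of x y] assms by blast
qed

text \<open>Injectivity of the canonical map to \<open>adic_limit\<close>: x and zero have the same
  coset at every level.\<close>

lemma adic_separated:
  assumes "x \<in> carrier R" "\<And>i. x \<in> J i"
  shows "x = \<zero>"
proof -
  have "inj_on (\<lambda>r i. J i +> r) (carrier R)"
    using adic_complete by (auto simp: adic_complete_def ring_iso_def bij_betw_def)
  moreover have "J i +> x = J i +> \<zero>" for i using assms J_coset_eq by (simp add: a_minus_def)
  ultimately show ?thesis using assms(1) by (auto dest: inj_onD)
qed

text \<open>Surjectivity of the canonical map to \<open>adic_limit\<close>: the cosets of the r i
  form a point of the limit, and s is a preimage of it.\<close>

lemma adic_cauchy: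
  assumes r: "\<And>i. r i \<in> carrier R" "\<And>i. r (Suc i) \<ominus> r i \<in> J i"
  shows "\<exists>s\<in>carrier R. \<forall>i. s \<ominus> r i \<in> J i"
proof -
  have surj: "(\<lambda>r i. J i +> r) ` carrier R = carrier (adic_limit R I)"
    using adic_complete by (auto simp: adic_complete_def ring_iso_def bij_betw_def)
  have "(\<lambda>i. J i +> r i) \<in> carrier (adic_limit R I)"
  proof -
    \<comment> \<open>The transition map replaces \<open>J (Suc i)\<close> by \<open>J i\<close>,
      since their sum is \<open>J i\<close>; the two representatives agree modulo
      \<open>J i\<close>.\<close>
    have "J i <+> (J (Suc i) +> r (Suc i)) = J i +> r i" for i
    proof -
      interpret J: ideal "J i" R by (rule J_ideal)
      have "J i <+> J (Suc i) = J i"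
      proof
        show "J i <+> J (Suc i) \<subseteq> J i" using J_Suc J_closed(2) by (auto simp: set_add_def')
        show "J i \<subseteq> J i <+> J (Suc i)"
        proof
          fix x assume "x \<in> J i"
          then show "x \<in> J i <+> J (Suc i)" unfolding set_add_def'
            using J_closed(1)[of "Suc i"] J_carrier by (intro UN_I[of x] UN_I[of \<zero>]) simp_all
        qed
      qed
      moreover have "J i <+> (J (Suc i) +> r (Suc i)) = (J i <+> J (Suc i)) +> r (Suc i)"
        using J_carrier r(1) by (intro a_setmult_rcos_assoc) blast+
      ultimately show ?thesis using J_coset_eq[OF r(1) r(1)] r(2) by simp
    qed
    moreover have "J i +> r i \<in> carrier (R Quot J i)" for i
      using r(1) by (auto simp: FactRing_def A_RCOSETS_def')
    ultimately show ?thesis by (simp add: adic_limit_def)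
  qed
  then obtain s where s: "s \<in> carrier R" "(\<lambda>i. J i +> r i) = (\<lambda>i. J i +> s)" using surj by (auto simp: image_iff)
  then have "J i +> s = J i +> r i" for i by (metis (mono_tags))
  then show ?thesis using s(1) r(1) J_coset_eq by blast
qed

lemma chain_finite_J: "chain_finite R (regular_module R) (J i) (carrier R)"
proof (cases i)
  \<comment> \<open>\<open>J 0\<close> is the whole ring, so the interval is trivial; finite length
    is assumed from i = 1 on.\<close>
  case 0
  then show ?thesis by (simp add: chain_finite_refl)
next
  case (Suc k)
  then show ?thesis
    using reg.finite_length_quot_chain_finite[OF J_submodule finite_length_quot, of i]
    by (simp add: regular_module_def)
qed

context
  fixes P :: "('a, 'c, 'd) module_scheme"
  assumes P: "fg_projective R P"
begin

interpretation P: left_module R P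
  using P by (simp add: fg_projective_def)

private abbreviation "K \<equiv> adic_filtration R I P"

lemma adic_filtration_submodule: "submodule (K i) R P"
proof (rule P.left_submoduleI)
  have "\<phi> \<zero>\<^bsub>P\<^esub> \<in> J i" if "\<phi> \<in> left_hom R P (regular_module R)" for \<phi>
    using left_hom_zero[OF P.left_module_axioms reg.left_module_axioms that] J_closed(1)
    by (simp add: regular_module_def)
  then show "\<zero>\<^bsub>P\<^esub> \<in> K i" by (simp add: adic_filtration_def)
  show "x \<oplus>\<^bsub>P\<^esub> y \<in> K i" if "x \<in> K i" "y \<in> K i" for x y
    using that J_closed(2) by (auto simp: adic_filtration_def left_homD) (simp add: regular_module_def)
  show "a \<odot>\<^bsub>P\<^esub> x \<in> K i" if "a \<in> carrier R" "x \<in> K i" for a x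
    using that J_closed(3) by (auto simp: adic_filtration_def left_homD) (simp add: regular_module_def)
qed (auto simp: adic_filtration_def)

text \<open>A functional sends a x to a times its value at x, so \<open>J i\<close> has to absorb a
  factor on the right; this uses that the ideal is two-sided.\<close>

lemma smult_adic_filtration:
  assumes "a \<in> J i" "x \<in> carrier P"
  shows "a \<odot>\<^bsub>P\<^esub> x \<in> K i"
proof -
  have "\<phi> (a \<odot>\<^bsub>P\<^esub> x) \<in> J i" if "\<phi> \<in> left_hom R P (regular_module R)" for \<phi>
  proof -
    have "\<phi> (a \<odot>\<^bsub>P\<^esub> x) = a \<otimes> \<phi> x" "\<phi> x \<in> carrier R"
      using left_homD[OF that] assms J_carrier by (auto simp: regular_module_def)
    then show ?thesis using J_closed(4) assms(1) by simp
  qed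
  then show ?thesis using assms J_carrier by (auto simp: adic_filtration_def)
qed

text \<open>A dual basis reduces each property to the ring: an element is zero if its coordinates
  are, and limits are taken coordinatewise. For the chain condition, P is reached from
  \<open>K i\<close> by adjoining the finitely many generators one at a time.\<close>

lemma filtered_module_adic: "filtered_module R P K"
proof -
  obtain n :: nat and p \<phi> where p: "\<And>j. j < n \<Longrightarrow> p j \<in> carrier P"
    and \<phi>: "\<And>j. j < n \<Longrightarrow> \<phi> j \<in> left_hom R P (regular_module R)"
    and db: "\<And>x. x \<in> carrier P \<Longrightarrow> x = finsum P (\<lambda>j. \<phi> j x \<odot>\<^bsub>P\<^esub> p j) {..<n}"
    using fg_projective_dual_basis[OF P] by blast
  have \<phi>c: "\<phi> j x \<in> carrier R" if "j < n" "x \<in> carrier P" for j x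
    using left_homD(1)[OF \<phi>] that by (auto simp: regular_module_def)
  have \<phi>K: "\<phi> j x \<in> J i" if "j < n" "x \<in> K i" for j x i
    using \<phi> that by (auto simp: adic_filtration_def)
  have \<phi>minus: "\<phi> j (x \<ominus>\<^bsub>P\<^esub> y) = \<phi> j x \<ominus> \<phi> j y" if "j < n" "x \<in> carrier P" "y \<in> carrier P" for j x y
  proof -
    have "\<phi> j (x \<ominus>\<^bsub>P\<^esub> y) \<oplus> \<phi> j y = \<phi> j x"
      using left_homD(2)[OF \<phi>[OF that(1)], of "x \<ominus>\<^bsub>P\<^esub> y" y] that
      by (simp add: regular_module_def a_minus_def P.M.a_assoc P.M.l_neg)
    then show ?thesis using \<phi>c[OF that(1)] that(2,3)
      by (metis P.M.minus_closed add.inv_solve_right' a_minus_def)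
  qed
  show ?thesis
  proof (intro filtered_module.intro filtered_module_axioms.intro)
    show "left_module R P" by (rule P.left_module_axioms)
    show "submodule (K i) R P" for i by (rule adic_filtration_submodule)
    show "K (Suc i) \<subseteq> K i" for i using J_Suc by (force simp: adic_filtration_def)
    show "x = \<zero>\<^bsub>P\<^esub>" if x: "x \<in> carrier P" "\<And>i. x \<in> K i" for x
    proof -
      have "\<phi> j x = \<zero>" if "j < n" for j using adic_separated \<phi>c \<phi>K that x by blast
      then have "finsum P (\<lambda>j. \<phi> j x \<odot>\<^bsub>P\<^esub> p j) {..<n} = \<zero>\<^bsub>P\<^esub>"
        using p by (intro P.M.add.finprod_one_eqI) simp
      then show ?thesis using db[OF x(1)] by simp
    qed
    show "\<exists>z\<in>carrier P. \<forall>i. z \<ominus>\<^bsub>P\<^esub> y i \<in> K i"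
      if y: "\<And>i. y i \<in> carrier P" "\<And>i. y (Suc i) \<ominus>\<^bsub>P\<^esub> y i \<in> K i" for y
    proof -
      have "\<exists>s\<in>carrier R. \<forall>i. s \<ominus> \<phi> j (y i) \<in> J i" if "j < n" for j
        using \<phi>c[OF that y(1)] \<phi>K[OF that y(2)] by (intro adic_cauchy) (simp_all add: \<phi>minus that y(1))
      then obtain s where s: "\<And>j. j < n \<Longrightarrow> s j \<in> carrier R" "\<And>j i. j < n \<Longrightarrow> s j \<ominus> \<phi> j (y i) \<in> J i"
        by metis
      \<comment> \<open>The s j are the limits of the coordinates of the y i, so z - y i is a
        combination of the generators with coefficients in \<open>J i\<close>.\<close>
      define z where "z = finsum P (\<lambda>j. s j \<odot>\<^bsub>P\<^esub> p j) {..<n}"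
      have z: "z \<in> carrier P" using s p by (auto simp: z_def intro!: P.M.finsum_closed)
      have "z \<ominus>\<^bsub>P\<^esub> y i \<in> K i" for i
      proof -
        define d where "d = finsum P (\<lambda>j. (s j \<ominus> \<phi> j (y i)) \<odot>\<^bsub>P\<^esub> p j) {..<n}"
        have d: "d \<in> K i" unfolding d_def
          using s p by (intro P.submodule_finsum[OF adic_filtration_submodule] smult_adic_filtration) auto
        have dc: "d \<in> carrier P" using d by (simp add: adic_filtration_def)
        have "d \<oplus>\<^bsub>P\<^esub> y i = d \<oplus>\<^bsub>P\<^esub> finsum P (\<lambda>j. \<phi> j (y i) \<odot>\<^bsub>P\<^esub> p j) {..<n}"
          using db[OF y(1)] by simp
        also have "\<dots> = finsum P (\<lambda>j. (s j \<ominus> \<phi> j (y i)) \<odot>\<^bsub>P\<^esub> p j \<oplus>\<^bsub>P\<^esub> \<phi> j (y i) \<odot>\<^bsub>P\<^esub> p j) {..<n}"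
          unfolding d_def using s p \<phi>c y(1) by (intro P.M.finsum_addf[symmetric]) auto
        also have "\<dots> = z"
          unfolding z_def using s p \<phi>c y(1)
          by (intro P.M.finsum_cong') (auto simp: P.smult_l_distr[symmetric] a_minus_def a_assoc l_neg)
        finally have "z = d \<oplus>\<^bsub>P\<^esub> y i" by simp
        then have "z \<ominus>\<^bsub>P\<^esub> y i = d" using dc y(1) by (simp add: a_minus_def P.M.a_assoc P.M.r_neg)
        then show ?thesis using d by simp
      qed
      then show ?thesis using z by blast
    qed
    show "chain_finite R P (K i) (carrier P)" for i
    proof -
      \<comment> \<open>\<open>D j\<close> is \<open>K i\<close> plus the submodule generated by the
        first j generators, which divides the interval from \<open>K i\<close> to P into n cyclic
        steps.\<close>
      define D where "D = rec_nat (K i) (\<lambda>j D. {x \<oplus>\<^bsub>P\<^esub> a \<odot>\<^bsub>P\<^esub> p j | x a. x \<in> D \<and> a \<in> carrier R})"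
      have D0: "D 0 = K i" and DSuc: "D (Suc j) = {x \<oplus>\<^bsub>P\<^esub> a \<odot>\<^bsub>P\<^esub> p j | x a. x \<in> D j \<and> a \<in> carrier R}" for j
        by (simp_all add: D_def)
      have Dsub: "submodule (D j) R P \<and> K i \<subseteq> D j" if "j \<le> n" for j
        using that
      proof (induction j)
        case 0
        then show ?case using adic_filtration_submodule by (simp add: D0)
      next
        case (Suc j)
        then have IH: "submodule (D j) R P" "K i \<subseteq> D j" and pj: "p j \<in> carrier P" using p by auto
        note c = P.submodule_closed[OF IH(1)]
        have "submodule (D (Suc j)) R P"
        proof (rule P.left_submoduleI)
          show "D (Suc j) \<subseteq> carrier P" using c(1) pj by (auto simp: DSuc)
          show "\<zero>\<^bsub>P\<^esub> \<in> D (Suc j)" unfolding DSuc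
            using c(2) pj by (intro CollectI exI[of _ "\<zero>\<^bsub>P\<^esub>"] exI[of _ "\<zero>"]) simp
          fix x y assume "x \<in> D (Suc j)" "y \<in> D (Suc j)"
          then obtain u a v b where e: "x = u \<oplus>\<^bsub>P\<^esub> a \<odot>\<^bsub>P\<^esub> p j" "y = v \<oplus>\<^bsub>P\<^esub> b \<odot>\<^bsub>P\<^esub> p j"
            "u \<in> D j" "v \<in> D j" "a \<in> carrier R" "b \<in> carrier R" by (auto simp: DSuc)
          then have "x \<oplus>\<^bsub>P\<^esub> y = (u \<oplus>\<^bsub>P\<^esub> v) \<oplus>\<^bsub>P\<^esub> (a \<oplus> b) \<odot>\<^bsub>P\<^esub> p j"
            using pj c(1) by (simp add: P.smult_l_distr P.M.add.m_ac)
          then show "x \<oplus>\<^bsub>P\<^esub> y \<in> D (Suc j)" unfolding DSuc using e(5,6) c(3)[OF e(3,4)] by blast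
        next
          fix r x assume r: "r \<in> carrier R" "x \<in> D (Suc j)"
          then obtain u a where e: "x = u \<oplus>\<^bsub>P\<^esub> a \<odot>\<^bsub>P\<^esub> p j" "u \<in> D j" "a \<in> carrier R" by (auto simp: DSuc)
          then have "r \<odot>\<^bsub>P\<^esub> x = r \<odot>\<^bsub>P\<^esub> u \<oplus>\<^bsub>P\<^esub> (r \<otimes> a) \<odot>\<^bsub>P\<^esub> p j"
            using pj c(1) r(1) by (simp add: P.smult_r_distr P.smult_assoc1)
          then show "r \<odot>\<^bsub>P\<^esub> x \<in> D (Suc j)" unfolding DSuc using r(1) e(3) c(6)[OF r(1) e(2)] by blast
        qed
        moreover have "D j \<subseteq> D (Suc j)"
        proof
          fix x assume "x \<in> D j"
          then show "x \<in> D (Suc j)" unfolding DSuc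
            using c(1) pj by (intro CollectI exI[of _ x] exI[of _ "\<zero>"]) simp
        qed
        ultimately show ?case using IH by blast
      qed
      have Dmono: "D j \<subseteq> D (Suc j)" if "j < n" for j
      proof
        fix x assume "x \<in> D j"
        then show "x \<in> D (Suc j)" unfolding DSuc
          using P.submodule_closed(1)[of "D j"] Dsub[of j] that p[OF that]
          by (intro CollectI exI[of _ x] exI[of _ "\<zero>"]) simp
      qed
      \<comment> \<open>Modulo \<open>D j\<close> the submodule \<open>D (Suc j)\<close> is
        generated by p j, so H is determined by the left ideal of all a that carry p j into H. This
        left ideal contains \<open>J i\<close>, because \<open>J i\<close> carries p j into
        \<open>K i\<close>, so the chain condition of the ring modulo \<open>J i\<close>
        applies.\<close>
      have step: "chain_finite R P (D j) (D (Suc j))" if j: "j < n" for j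
      proof (rule chain_finite_transfer[OF chain_finite_J[of i], where \<Phi> = "\<lambda>H. {a \<in> carrier R. a \<odot>\<^bsub>P\<^esub> p j \<in> H}"])
        have pj: "p j \<in> carrier P" using p j by simp
        fix H assume H: "submodule H R P" "D j \<subseteq> H"
        note c = P.submodule_closed[OF H(1)]
        have "submodule {a \<in> carrier R. a \<odot>\<^bsub>P\<^esub> p j \<in> H} R (regular_module R)"
          by (rule reg.left_submoduleI)
            (auto simp: regular_module_def c P.smult_l_distr P.smult_assoc1 pj)
        moreover have "J i \<subseteq> {a \<in> carrier R. a \<odot>\<^bsub>P\<^esub> p j \<in> H}"
        proof -
          have "K i \<subseteq> H" using Dsub[of j] j H(2) by auto
          then show ?thesis using smult_adic_filtration[OF _ pj] J_carrier by blast
        qed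
        ultimately show "submodule {a \<in> carrier R. a \<odot>\<^bsub>P\<^esub> p j \<in> H} R (regular_module R) \<and>
          J i \<subseteq> {a \<in> carrier R. a \<odot>\<^bsub>P\<^esub> p j \<in> H} \<and> {a \<in> carrier R. a \<odot>\<^bsub>P\<^esub> p j \<in> H} \<subseteq> carrier R" by blast
        fix H' assume H': "H \<subseteq> H'" "H' \<subseteq> D (Suc j)" "submodule H' R P"
          "{a \<in> carrier R. a \<odot>\<^bsub>P\<^esub> p j \<in> H} = {a \<in> carrier R. a \<odot>\<^bsub>P\<^esub> p j \<in> H'}"
        have "x \<in> H" if x: "x \<in> H'" for x
        proof -
          obtain u a where e: "x = u \<oplus>\<^bsub>P\<^esub> a \<odot>\<^bsub>P\<^esub> p j" "u \<in> D j" "a \<in> carrier R"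
            using x H'(2) by (auto simp: DSuc)
          have u: "u \<in> H" "u \<in> carrier P" using e(2) H(2) c(1) by auto
          have "x \<ominus>\<^bsub>P\<^esub> u \<in> H'" using P.submodule_closed(4)[OF H'(3)] x u(1) H'(1) by blast
          moreover have "x \<ominus>\<^bsub>P\<^esub> u = a \<odot>\<^bsub>P\<^esub> p j"
            using e u(2) pj by (simp add: a_minus_def P.M.a_comm[of u] P.M.a_assoc P.M.r_neg)
          ultimately have "a \<odot>\<^bsub>P\<^esub> p j \<in> H" using H'(4) e(3) by auto
          then show ?thesis using c(3) u(1) e(1) by blast
        qed
        then show "H = H'" using H'(1) by blast
      qed blast
      have "chain_finite R P (K i) (D j) \<and> K i \<subseteq> D j" if "j \<le> n" for j
        using that
      proof (induction j)
        case 0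
        then show ?case by (simp add: D0 chain_finite_refl)
      next
        case (Suc j)
        then show ?case
          using P.chain_finite_trans[of "D j" "D (Suc j)" "K i"] step[of j] Dsub[of j] Dsub[of "Suc j"] Dmono[of j]
          by simp
      qed
      moreover have "D n = carrier P"
      proof
        show "D n \<subseteq> carrier P" using P.submodule_closed(1) Dsub by blast
        show "carrier P \<subseteq> D n"
        proof
          fix x assume x: "x \<in> carrier P"
          have "finsum P (\<lambda>j. \<phi> j x \<odot>\<^bsub>P\<^esub> p j) {..<k} \<in> D k" if "k \<le> n" for k
            using that
          proof (induction k)
            case 0
            then show ?case using P.submodule_closed(2)[OF adic_filtration_submodule] by (simp add: D0)
          next
            case (Suc k)
            have c: "(\<lambda>j. \<phi> j x \<odot>\<^bsub>P\<^esub> p j) \<in> {..<k} \<rightarrow> carrier P" "\<phi> k x \<odot>\<^bsub>P\<^esub> p k \<in> carrier P"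
              using Suc.prems \<phi>c x p by auto
            have "finsum P (\<lambda>j. \<phi> j x \<odot>\<^bsub>P\<^esub> p j) {..<Suc k} =
                finsum P (\<lambda>j. \<phi> j x \<odot>\<^bsub>P\<^esub> p j) {..<k} \<oplus>\<^bsub>P\<^esub> \<phi> k x \<odot>\<^bsub>P\<^esub> p k"
              using c by (simp add: lessThan_Suc P.M.a_comm)
            moreover have "finsum P (\<lambda>j. \<phi> j x \<odot>\<^bsub>P\<^esub> p j) {..<k} \<in> D k" "\<phi> k x \<in> carrier R"
              using Suc \<phi>c x by auto
            ultimately show ?case unfolding DSuc by blast
          qed
          then show "x \<in> D n" using db[OF x] by (metis order_refl)
        qed
      qed
      ultimately show ?thesis by force
    qed
  qed
qed

text \<open>If g x has its coordinates in \<open>J i\<close>, then g x = g (g x) is the combination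
  of the g (p j) with these coordinates as coefficients. As every functional takes g (p j) into I, g
  x lies one level deeper. So g x lies in all levels and vanishes by separation.\<close>

lemma adic_nakayama:
  assumes g: "g \<in> left_hom R P P" and idem: "\<And>x. x \<in> carrier P \<Longrightarrow> g (g x) = g x"
    and small: "\<And>x. x \<in> carrier P \<Longrightarrow> g x \<in> K 1" and x: "x \<in> carrier P"
  shows "g x = \<zero>\<^bsub>P\<^esub>"
proof -
  interpret F: filtered_module R P K by (rule filtered_module_adic)
  obtain n :: nat and p \<phi> where p: "\<And>j. j < n \<Longrightarrow> p j \<in> carrier P"
    and \<phi>: "\<And>j. j < n \<Longrightarrow> \<phi> j \<in> left_hom R P (regular_module R)"
    and db: "\<And>x. x \<in> carrier P \<Longrightarrow> x = finsum P (\<lambda>j. \<phi> j x \<odot>\<^bsub>P\<^esub> p j) {..<n}"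
    using fg_projective_dual_basis[OF P] by blast
  note gD = left_homD[OF g]
  have "g x \<in> K i" for i
  proof (induction i)
    case 0
    have "\<phi> (g x) \<in> carrier R" if "\<phi> \<in> left_hom R P (regular_module R)" for \<phi>
      using left_homD(1)[OF that gD(1)[OF x]] by (simp add: regular_module_def)
    then show ?case using gD(1)[OF x] by (simp add: adic_filtration_def)
  next
    case (Suc i)
    have \<phi>J: "\<phi> j (g x) \<in> J i" if "j < n" for j using Suc \<phi> that by (auto simp: adic_filtration_def)
    have c: "(\<lambda>j. \<phi> j (g x) \<odot>\<^bsub>P\<^esub> p j) \<in> {..<n} \<rightarrow> carrier P" using J_carrier[OF \<phi>J] p by auto
    have "g x = g (finsum P (\<lambda>j. \<phi> j (g x) \<odot>\<^bsub>P\<^esub> p j) {..<n})"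
      using idem[OF x] db[OF gD(1)[OF x]] by simp
    also have "\<dots> = finsum P (\<lambda>j. g (\<phi> j (g x) \<odot>\<^bsub>P\<^esub> p j)) {..<n}"
      by (rule left_hom_finsum[OF P.left_module_axioms P.left_module_axioms g c])
    also have "\<dots> \<in> K (Suc i)"
    proof (rule P.submodule_finsum[OF adic_filtration_submodule])
      fix j assume "j \<in> {..<n}"
      then have j: "j < n" by simp
      have e: "g (\<phi> j (g x) \<odot>\<^bsub>P\<^esub> p j) = \<phi> j (g x) \<odot>\<^bsub>P\<^esub> g (p j)" and cl: "\<phi> j (g x) \<odot>\<^bsub>P\<^esub> g (p j) \<in> carrier P"
        using gD \<phi>J[OF j] J_carrier p[OF j] by auto
      have "\<psi> (\<phi> j (g x) \<odot>\<^bsub>P\<^esub> g (p j)) \<in> J (Suc i)" if \<psi>: "\<psi> \<in> left_hom R P (regular_module R)" for \<psi>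
      proof -
        have "\<psi> (g (p j)) \<in> J 1" using small[OF p[OF j]] \<psi> by (auto simp: adic_filtration_def)
        \<comment> \<open>\<open>J 1\<close> is by definition the product of the whole ring with I,
          hence contained in I.\<close>
        then have "\<psi> (g (p j)) \<in> I"
          using ideal_prod_inter[OF oneideal I_ideal] by auto
        then have "\<phi> j (g x) \<otimes> \<psi> (g (p j)) \<in> J (Suc i)" using \<phi>J[OF j] by (auto intro: ideal_prod.prod)
        moreover have "\<psi> (\<phi> j (g x) \<odot>\<^bsub>P\<^esub> g (p j)) = \<phi> j (g x) \<otimes> \<psi> (g (p j))"
          using left_homD(3)[OF \<psi>, of "\<phi> j (g x)" "g (p j)"] \<phi>J[OF j] J_carrier gD(1)[OF p[OF j]]
          by (auto simp: regular_module_def)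
        ultimately show ?thesis by simp
      qed
      then show "g (\<phi> j (g x) \<odot>\<^bsub>P\<^esub> p j) \<in> K (Suc i)" using e cl by (simp add: adic_filtration_def)
    qed
    finally show ?case .
  qed
  then show ?thesis using F.separated gD(1)[OF x] by blast
qed

end

end

section \<open>The category of bounded complexes\<close>

lemma bounded_proj_complexD:
  assumes "bounded_proj_complex R X"
  shows "fg_projective R (ob X n)" "left_module R (ob X n)"
    "diff X n \<in> left_hom R (ob X n) (ob X (n + 1))"
    "x \<in> carrier (ob X n) \<Longrightarrow> diff X n x \<in> carrier (ob X (n + 1))"
    "x \<in> carrier (ob X n) \<Longrightarrow> diff X (n + 1) (diff X n x) = \<zero>\<^bsub>ob X (n + 2)\<^esub>"
  using assms left_homD(1)[of "diff X n" R "ob X n" "ob X (n + 1)"]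
  by (auto simp: bounded_proj_complex_def fg_projective_def)

lemma chain_mapsD:
  assumes "f \<in> chain_maps R X Y"
  shows "f n \<in> left_hom R (ob X n) (ob Y n)"
    "x \<in> carrier (ob X n) \<Longrightarrow> f n x \<in> carrier (ob Y n)"
    "\<lbrakk>x \<in> carrier (ob X n); y \<in> carrier (ob X n)\<rbrakk> \<Longrightarrow> f n (x \<oplus>\<^bsub>ob X n\<^esub> y) = f n x \<oplus>\<^bsub>ob Y n\<^esub> f n y"
    "x \<in> carrier (ob X n) \<Longrightarrow> diff Y n (f n x) = f (n + 1) (diff X n x)"
  using assms left_homD[of "f n" R "ob X n" "ob Y n"] by (auto simp: chain_maps_def)

text \<open>Components of chain maps are extensional, so agreement on the carriers is
  equality.\<close>

lemma chain_maps_eqI: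
  assumes "f \<in> chain_maps R X Y" "g \<in> chain_maps R X Y"
    and eq: "\<And>n x. x \<in> carrier (ob X n) \<Longrightarrow> f n x = g n x"
  shows "f = g"
proof
  fix n
  have "f n \<in> extensional (carrier (ob X n))" "g n \<in> extensional (carrier (ob X n))"
    using chain_mapsD(1)[OF assms(1)] chain_mapsD(1)[OF assms(2)] by (auto simp: left_hom_def PiE_def)
  then show "f n = g n" by (rule extensionalityI) (rule eq)
qed

lemma chain_maps_comp:
  assumes X: "bounded_proj_complex R X" and f: "f \<in> chain_maps R X Y" and g: "g \<in> chain_maps R Y Z"
  shows "(\<lambda>n. \<lambda>x\<in>carrier (ob X n). g n (f n x)) \<in> chain_maps R X Z"
  using left_hom_comp[OF chain_mapsD(1)[OF f] chain_mapsD(1)[OF g]] bounded_proj_complexD(2,4)[OF X]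
    chain_mapsD(2,4)[OF f] chain_mapsD(4)[OF g]
  by (simp add: chain_maps_def)

lemma chain_maps_id:
  assumes X: "bounded_proj_complex R X"
  shows "(\<lambda>n. \<lambda>x\<in>carrier (ob X n). x) \<in> chain_maps R X X"
  using left_hom_id[OF bounded_proj_complexD(2)[OF X]] bounded_proj_complexD(4)[OF X] by (simp add: chain_maps_def)

lemma chain_maps_zero:
  assumes X: "bounded_proj_complex R X" and Y: "bounded_proj_complex R Y"
  shows "(\<lambda>n. \<lambda>x\<in>carrier (ob X n). \<zero>\<^bsub>ob Y n\<^esub>) \<in> chain_maps R X Y"
  using left_hom_const_zero[OF bounded_proj_complexD(2)[OF X] bounded_proj_complexD(2)[OF Y]]
    bounded_proj_complexD(4)[OF X]
    left_hom_zero[OF bounded_proj_complexD(2)[OF Y] bounded_proj_complexD(2)[OF Y] bounded_proj_complexD(3)[OF Y]]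
  by (simp add: chain_maps_def)

lemma chain_maps_add:
  assumes X: "bounded_proj_complex R X" and Y: "bounded_proj_complex R Y"
    and f: "f \<in> chain_maps R X Y" and g: "g \<in> chain_maps R X Y"
  shows "(\<lambda>n. \<lambda>x\<in>carrier (ob X n). f n x \<oplus>\<^bsub>ob Y n\<^esub> g n x) \<in> chain_maps R X Y"
  using left_hom_add[OF chain_mapsD(1)[OF f] chain_mapsD(1)[OF g]]
    bounded_proj_complexD(2,4)[OF X] bounded_proj_complexD(2)[OF Y]
    left_homD(2)[OF bounded_proj_complexD(3)[OF Y]] chain_mapsD(2,4)[OF f] chain_mapsD(2,4)[OF g]
  by (simp add: chain_maps_def)

lemma chain_maps_uminus:
  assumes X: "bounded_proj_complex R X" and Y: "bounded_proj_complex R Y"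
    and f: "f \<in> chain_maps R X Y"
  shows "(\<lambda>n. \<lambda>x\<in>carrier (ob X n). \<ominus>\<^bsub>ob Y n\<^esub> f n x) \<in> chain_maps R X Y"
  using left_hom_uminus[OF chain_mapsD(1)[OF f]]
    bounded_proj_complexD(2,4)[OF X] bounded_proj_complexD(2)[OF Y]
    left_hom_a_inv[OF bounded_proj_complexD(2)[OF Y] bounded_proj_complexD(2)[OF Y] bounded_proj_complexD(3)[OF Y]]
    chain_mapsD(2,4)[OF f]
  by (simp add: chain_maps_def)

lemma Cb_proj_simps:
  "Obj (Cb_proj R) = {X. bounded_proj_complex R X}"
  "Hom (Cb_proj R) = chain_maps R"
  "Id (Cb_proj R) X = (\<lambda>n. \<lambda>x\<in>carrier (ob X n). x)"
  "Comp (Cb_proj R) X Y Z g f = (\<lambda>n. \<lambda>x\<in>carrier (ob X n). g n (f n x))"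
  "Add (Cb_proj R) X Y f g = (\<lambda>n. \<lambda>x\<in>carrier (ob X n). f n x \<oplus>\<^bsub>ob Y n\<^esub> g n x)"
  "Zero (Cb_proj R) X Y = (\<lambda>n. \<lambda>x\<in>carrier (ob X n). \<zero>\<^bsub>ob Y n\<^esub>)"
  by (simp_all add: Cb_proj_def)

lemma Cb_proj_preadditive: "preadditive_category (Cb_proj R)"
proof (rule preadditive_category.intro, unfold Cb_proj_simps mem_Collect_eq, goal_cases)
  case (6 X Y)
  then have X: "bounded_proj_complex R X" and Y: "bounded_proj_complex R Y" by auto
  interpret Y: left_module R "ob Y n" for n by (rule bounded_proj_complexD(2)[OF Y])
  note add = chain_maps_add[OF X Y] and zero = chain_maps_zero[OF X Y] and inv = chain_maps_uminus[OF X Y]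
  show ?case
  proof (rule comm_groupI, unfold hom_group_def partial_object.simps monoid.simps Cb_proj_simps)
    show "\<exists>g\<in>chain_maps R X Y. (\<lambda>n. \<lambda>x\<in>carrier (ob X n). g n x \<oplus>\<^bsub>ob Y n\<^esub> f n x) =
        (\<lambda>n. \<lambda>x\<in>carrier (ob X n). \<zero>\<^bsub>ob Y n\<^esub>)" if f: "f \<in> chain_maps R X Y" for f
      by (rule bexI[OF _ inv[OF f]], rule chain_maps_eqI[OF add[OF inv[OF f] f] zero])
        (simp add: chain_mapsD(2)[OF f] Y.M.l_neg)
    show "(\<lambda>n. \<lambda>x\<in>carrier (ob X n). (\<lambda>x\<in>carrier (ob X n). f n x \<oplus>\<^bsub>ob Y n\<^esub> g n x) x \<oplus>\<^bsub>ob Y n\<^esub> h n x) =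
      (\<lambda>n. \<lambda>x\<in>carrier (ob X n). f n x \<oplus>\<^bsub>ob Y n\<^esub> (\<lambda>x\<in>carrier (ob X n). g n x \<oplus>\<^bsub>ob Y n\<^esub> h n x) x)"
      if f: "f \<in> chain_maps R X Y" and g: "g \<in> chain_maps R X Y" and h: "h \<in> chain_maps R X Y" for f g h
      by (rule chain_maps_eqI[OF add[OF add[OF f g] h] add[OF f add[OF g h]]])
        (simp add: chain_mapsD(2)[OF f] chain_mapsD(2)[OF g] chain_mapsD(2)[OF h] Y.M.a_assoc)
    show "(\<lambda>n. \<lambda>x\<in>carrier (ob X n). f n x \<oplus>\<^bsub>ob Y n\<^esub> g n x) =
      (\<lambda>n. \<lambda>x\<in>carrier (ob X n). g n x \<oplus>\<^bsub>ob Y n\<^esub> f n x)"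
      if f: "f \<in> chain_maps R X Y" and g: "g \<in> chain_maps R X Y" for f g
      by (rule chain_maps_eqI[OF add[OF f g] add[OF g f]])
        (simp add: chain_mapsD(2)[OF f] chain_mapsD(2)[OF g] Y.M.a_comm)
    show "(\<lambda>n. \<lambda>x\<in>carrier (ob X n). (\<lambda>x\<in>carrier (ob X n). \<zero>\<^bsub>ob Y n\<^esub>) x \<oplus>\<^bsub>ob Y n\<^esub> f n x) = f"
      if f: "f \<in> chain_maps R X Y" for f
      by (rule chain_maps_eqI[OF add[OF zero f] f]) (simp add: chain_mapsD(2)[OF f])
  qed (use zero add in auto)
next
  case (3 W X Y Z f g h)
  then show ?case by (auto simp: fun_eq_iff chain_mapsD(2))
next
  case (4 X Y f)
  then show ?case
    by (intro chain_maps_eqI[OF chain_maps_comp[OF _ _ chain_maps_id]]) (auto simp: chain_mapsD(2))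
next
  case (5 X Y f)
  then show ?case
    by (intro chain_maps_eqI[OF chain_maps_comp[OF _ chain_maps_id]]) auto
qed (auto simp: fun_eq_iff chain_mapsD(2,3) intro: chain_maps_id chain_maps_comp)

interpretation Cb: preadditive_category "Cb_proj R" for R
  by (rule Cb_proj_preadditive)

lemma Cb_biproductI:
  assumes X1: "bounded_proj_complex R X1" and X2: "bounded_proj_complex R X2" and X: "bounded_proj_complex R X"
    and i: "i1 \<in> chain_maps R X1 X" "i2 \<in> chain_maps R X2 X"
    and p: "p1 \<in> chain_maps R X X1" "p2 \<in> chain_maps R X X2"
    and pi: "\<And>n x. x \<in> carrier (ob X1 n) \<Longrightarrow> p1 n (i1 n x) = x \<and> p2 n (i1 n x) = \<zero>\<^bsub>ob X2 n\<^esub>"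
      "\<And>n x. x \<in> carrier (ob X2 n) \<Longrightarrow> p2 n (i2 n x) = x \<and> p1 n (i2 n x) = \<zero>\<^bsub>ob X1 n\<^esub>"
    and ip: "\<And>n x. x \<in> carrier (ob X n) \<Longrightarrow> i1 n (p1 n x) \<oplus>\<^bsub>ob X n\<^esub> i2 n (p2 n x) = x"
  shows "is_biproduct (Cb_proj R) X1 X2 X"
  unfolding is_biproduct_def Cb_proj_simps mem_Collect_eq
  by (intro conjI X1 X2 X exI[of _ i1] exI[of _ i2] exI[of _ p1] exI[of _ p2] i p)
    (auto simp: fun_eq_iff pi ip)

lemma Cb_zero_iff:
  assumes X: "bounded_proj_complex R X"
  shows "Id (Cb_proj R) X = Zero (Cb_proj R) X X \<longleftrightarrow> (\<forall>n. carrier (ob X n) = {\<zero>\<^bsub>ob X n\<^esub>})"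
proof -
  interpret X: left_module R "ob X n" for n by (rule bounded_proj_complexD(2)[OF X])
  have "Id (Cb_proj R) X = Zero (Cb_proj R) X X \<longleftrightarrow> (\<forall>n. \<forall>x\<in>carrier (ob X n). x = \<zero>\<^bsub>ob X n\<^esub>)"
    by (auto simp: Cb_proj_simps fun_eq_iff restrict_def split: if_splits)
  also have "\<dots> \<longleftrightarrow> (\<forall>n. carrier (ob X n) = {\<zero>\<^bsub>ob X n\<^esub>})" using X.M.zero_closed by blast
  finally show ?thesis .
qed

lemma bij_left_hom_inv:
  assumes M: "left_module R M" and f: "f \<in> left_hom R M N" and b: "bij_betw f (carrier M) (carrier N)"
  shows "(\<lambda>y\<in>carrier N. inv_into (carrier M) f y) \<in> left_hom R N M"
proof -
  interpret M: left_module R M by fact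
  let ?g = "inv_into (carrier M) f"
  have g: "?g y \<in> carrier M" "f (?g y) = y" if "y \<in> carrier N" for y
    using b that by (auto simp: bij_betw_def intro: inv_into_into f_inv_into_f)
  have gf: "?g (f x) = x" if "x \<in> carrier M" for x
    using b that by (auto simp: bij_betw_def)
  have N: "x \<oplus>\<^bsub>N\<^esub> y = f (?g x \<oplus>\<^bsub>M\<^esub> ?g y)" if "x \<in> carrier N" "y \<in> carrier N" for x y
    using that g left_homD(2)[OF f] by simp
  have N': "a \<odot>\<^bsub>N\<^esub> y = f (a \<odot>\<^bsub>M\<^esub> ?g y)" if "a \<in> carrier R" "y \<in> carrier N" for a y
    using that g left_homD(3)[OF f] by simp
  show ?thesis
    unfolding left_hom_def using left_homD(1)[OF f] by (auto simp: N N' g gf)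
qed

text \<open>The degreewise inverses commute with the differentials because f does, so they form a
  chain map.\<close>

lemma Cb_unitI:
  assumes X: "bounded_proj_complex R X" and f: "f \<in> chain_maps R X X"
    and b: "\<And>n. bij_betw (f n) (carrier (ob X n)) (carrier (ob X n))"
  shows "f \<in> Units (End_ring (Cb_proj R) X)"
proof -
  define g where "g n = (\<lambda>y\<in>carrier (ob X n). inv_into (carrier (ob X n)) (f n) y)" for n
  have g: "g n y \<in> carrier (ob X n)" "f n (g n y) = y" if "y \<in> carrier (ob X n)" for n y
    using b[of n] that by (auto simp: bij_betw_def g_def intro: inv_into_into f_inv_into_f)
  have gf: "g n (f n x) = x" if "x \<in> carrier (ob X n)" for x n
    using b[of n] that chain_mapsD(2)[OF f] by (auto simp: bij_betw_def g_def)
  have "g \<in> chain_maps R X X"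
    unfolding chain_maps_def
  proof (intro CollectI conjI allI ballI)
    show "g n \<in> left_hom R (ob X n) (ob X n)" for n
      unfolding g_def by (rule bij_left_hom_inv[OF bounded_proj_complexD(2)[OF X] chain_mapsD(1)[OF f] b])
    fix n x assume x: "x \<in> carrier (ob X n)"
    have "f (n + 1) (diff X n (g n x)) = diff X n x"
      using chain_mapsD(4)[OF f g(1)[OF x]] g(2)[OF x] by simp
    then show "diff X n (g n x) = g (n + 1) (diff X n x)"
      using gf[OF bounded_proj_complexD(4)[OF X g(1)[OF x]]] by simp
  qed
  moreover have "(\<lambda>n. \<lambda>x\<in>carrier (ob X n). g n (f n x)) = (\<lambda>n. \<lambda>x\<in>carrier (ob X n). x)"
    "(\<lambda>n. \<lambda>x\<in>carrier (ob X n). f n (g n x)) = (\<lambda>n. \<lambda>x\<in>carrier (ob X n). x)"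
    using g gf by (auto simp: fun_eq_iff)
  ultimately show ?thesis using f by (auto simp: Units_def End_ring_def Cb_proj_simps)
qed

text \<open>The negative in \<open>End_ring\<close> is given by a definite description, so the
  values of 1 - f are recovered from the identity (1 - f) + f = 1.\<close>

lemma Cb_one_minus:
  assumes X: "bounded_proj_complex R X" and f: "f \<in> chain_maps R X X"
  shows "\<one>\<^bsub>End_ring (Cb_proj R) X\<^esub> \<ominus>\<^bsub>End_ring (Cb_proj R) X\<^esub> f \<in> chain_maps R X X"
    and "x \<in> carrier (ob X n) \<Longrightarrow>
      (\<one>\<^bsub>End_ring (Cb_proj R) X\<^esub> \<ominus>\<^bsub>End_ring (Cb_proj R) X\<^esub> f) n x = x \<ominus>\<^bsub>ob X n\<^esub> f n x"
proof -
  interpret E: ring "End_ring (Cb_proj R) X" using X by (intro Cb.ring_End) (simp add: Cb_proj_simps)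
  interpret X: left_module R "ob X n" for n by (rule bounded_proj_complexD(2)[OF X])
  let ?u = "\<one>\<^bsub>End_ring (Cb_proj R) X\<^esub> \<ominus>\<^bsub>End_ring (Cb_proj R) X\<^esub> f"
  have c: "carrier (End_ring (Cb_proj R) X) = chain_maps R X X" by (simp add: End_ring_def Cb_proj_simps)
  have fE: "f \<in> carrier (End_ring (Cb_proj R) X)" using f c by simp
  then show u: "?u \<in> chain_maps R X X" using E.minus_closed[OF E.one_closed] c by simp
  have "?u \<oplus>\<^bsub>End_ring (Cb_proj R) X\<^esub> f = \<one>\<^bsub>End_ring (Cb_proj R) X\<^esub>"
    using fE by (simp add: a_minus_def E.a_assoc E.l_neg)
  then have "(\<lambda>n. \<lambda>x\<in>carrier (ob X n). ?u n x \<oplus>\<^bsub>ob X n\<^esub> f n x) = (\<lambda>n. \<lambda>x\<in>carrier (ob X n). x)"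
    by (simp add: End_ring_def Cb_proj_simps)
  then have r: "(\<lambda>x\<in>carrier (ob X n). ?u n x \<oplus>\<^bsub>ob X n\<^esub> f n x) x = (\<lambda>x\<in>carrier (ob X n). x) x" for n x
    by (simp only: fun_eq_iff)
  have e: "?u n x \<oplus>\<^bsub>ob X n\<^esub> f n x = x" if "x \<in> carrier (ob X n)" for n x
    using r[of n x] that by (simp only: restrict_apply')
  show "?u n x = x \<ominus>\<^bsub>ob X n\<^esub> f n x" if x: "x \<in> carrier (ob X n)"
  proof -
    have "?u n x = (?u n x \<oplus>\<^bsub>ob X n\<^esub> f n x) \<ominus>\<^bsub>ob X n\<^esub> f n x"
      using chain_mapsD(2)[OF u x] chain_mapsD(2)[OF f x] by (simp add: a_minus_def X.M.a_assoc X.M.r_neg)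
    then show ?thesis using e[OF x] by simp
  qed
qed

subsection \<open>Direct sums\<close>

lemma left_module_prod:
  assumes M: "left_module R M" and N: "left_module R N"
  shows "left_module R \<lparr>carrier = carrier M \<times> carrier N, mult = undefined, one = undefined,
    zero = (\<zero>\<^bsub>M\<^esub>, \<zero>\<^bsub>N\<^esub>), add = (\<lambda>u v. (fst u \<oplus>\<^bsub>M\<^esub> fst v, snd u \<oplus>\<^bsub>N\<^esub> snd v)),
    smult = (\<lambda>a u. (a \<odot>\<^bsub>M\<^esub> fst u, a \<odot>\<^bsub>N\<^esub> snd u))\<rparr>" (is "left_module R ?W")
proof -
  interpret M: left_module R M by fact
  interpret N: left_module R N by fact
  have "abelian_group ?W"
  proof (rule abelian_groupI, goal_cases)
    case (6 u)
    then show ?case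
      by (intro bexI[of _ "(\<ominus>\<^bsub>M\<^esub> fst u, \<ominus>\<^bsub>N\<^esub> snd u)"]) (auto simp: M.M.l_neg N.M.l_neg)
  qed (auto simp: M.M.add.m_ac N.M.add.m_ac)
  then show ?thesis
    using M.R.ring_axioms
    by (intro left_module.intro left_module_axioms.intro)
      (auto simp: M.smult_l_distr M.smult_r_distr M.smult_assoc1
        N.smult_l_distr N.smult_r_distr N.smult_assoc1)
qed

text \<open>The product of the carriers lives in the type of pairs. For an infinite type 'b there is
  a bijection from pairs back to 'b, along which the product module is transported.\<close>

lemma module_biproduct:
  fixes M N :: "('a, 'b) module"
  assumes M: "left_module R M" and N: "left_module R N" and inf: "infinite (UNIV :: 'b set)"
  shows "\<exists>(Q :: ('a, 'b) module) i1 i2 p1 p2. left_module R Q \<and>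
    i1 \<in> left_hom R M Q \<and> i2 \<in> left_hom R N Q \<and> p1 \<in> left_hom R Q M \<and> p2 \<in> left_hom R Q N \<and>
    (\<forall>x\<in>carrier M. p1 (i1 x) = x \<and> p2 (i1 x) = \<zero>\<^bsub>N\<^esub>) \<and>
    (\<forall>x\<in>carrier N. p2 (i2 x) = x \<and> p1 (i2 x) = \<zero>\<^bsub>M\<^esub>) \<and>
    (\<forall>x\<in>carrier Q. i1 (p1 x) \<oplus>\<^bsub>Q\<^esub> i2 (p2 x) = x)"
proof -
  interpret M: left_module R M by fact
  interpret N: left_module R N by fact
  define W :: "('a, 'b \<times> 'b) module" where "W = \<lparr>carrier = carrier M \<times> carrier N, mult = undefined, one = undefined,
    zero = (\<zero>\<^bsub>M\<^esub>, \<zero>\<^bsub>N\<^esub>), add = (\<lambda>u v. (fst u \<oplus>\<^bsub>M\<^esub> fst v, snd u \<oplus>\<^bsub>N\<^esub> snd v)),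
    smult = (\<lambda>a u. (a \<odot>\<^bsub>M\<^esub> fst u, a \<odot>\<^bsub>N\<^esub> snd u))\<rparr>"
  interpret W: left_module R W unfolding W_def by (rule left_module_prod[OF M N])
  obtain e :: "'b \<times> 'b \<Rightarrow> 'b" where "bij e"
    using card_of_Times_same_infinite[OF inf] unfolding card_of_ordIso[symmetric] by auto
  then have e: "inj e" by (rule bij_is_inj)
  define d where "d = inv_into UNIV e"
  have de: "d (e w) = w" for w using e by (simp add: d_def)
  define Q :: "('a, 'b) module" where "Q = \<lparr>carrier = e ` carrier W, mult = undefined, one = undefined, zero = e \<zero>\<^bsub>W\<^esub>,
    add = (\<lambda>u v. e (d u \<oplus>\<^bsub>W\<^esub> d v)), smult = (\<lambda>a u. e (a \<odot>\<^bsub>W\<^esub> d u))\<rparr>"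
  have Q: "left_module R Q"
    unfolding Q_def using W.submodule_copy[OF W.submodule_carrier, of d e] de by simp
  have 1: "(\<lambda>x\<in>carrier M. e (x, \<zero>\<^bsub>N\<^esub>)) \<in> left_hom R M Q"
    and 2: "(\<lambda>x\<in>carrier N. e (\<zero>\<^bsub>M\<^esub>, x)) \<in> left_hom R N Q"
    and 3: "(\<lambda>x\<in>carrier Q. fst (d x)) \<in> left_hom R Q M"
    and 4: "(\<lambda>x\<in>carrier Q. snd (d x)) \<in> left_hom R Q N"
    by (auto simp: left_hom_def Q_def W_def de)
  show ?thesis
    by (intro exI conjI, rule Q, rule 1, rule 2, rule 3, rule 4) (auto simp: Q_def W_def de)
qed

text \<open>Biproducts are chosen degree by degree. The differential i1 d p1 + i2 d p2 turns all
  four structure maps into chain maps, so it squares to zero because its two components do.\<close>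

lemma Cb_biproduct_exists:
  fixes X1 X2 :: "('a, 'b) cochain_complex"
  assumes X1: "bounded_proj_complex R X1" and X2: "bounded_proj_complex R X2"
    and inf: "infinite (UNIV :: 'b set)"
  shows "\<exists>X. is_biproduct (Cb_proj R) X1 X2 X"
proof -
  note D1 = bounded_proj_complexD[OF X1] and D2 = bounded_proj_complexD[OF X2]
  have "\<forall>n. \<exists>(Q :: ('a, 'b) module) i1 i2 p1 p2. left_module R Q \<and>
    i1 \<in> left_hom R (ob X1 n) Q \<and> i2 \<in> left_hom R (ob X2 n) Q \<and>
    p1 \<in> left_hom R Q (ob X1 n) \<and> p2 \<in> left_hom R Q (ob X2 n) \<and>
    (\<forall>x\<in>carrier (ob X1 n). p1 (i1 x) = x \<and> p2 (i1 x) = \<zero>\<^bsub>ob X2 n\<^esub>) \<and>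
    (\<forall>x\<in>carrier (ob X2 n). p2 (i2 x) = x \<and> p1 (i2 x) = \<zero>\<^bsub>ob X1 n\<^esub>) \<and>
    (\<forall>x\<in>carrier Q. i1 (p1 x) \<oplus>\<^bsub>Q\<^esub> i2 (p2 x) = x)"
    by (intro allI module_biproduct[OF D1(2) D2(2) inf])
  then obtain Q :: "int \<Rightarrow> ('a, 'b) module" and i1 i2 p1 p2
    where *: "\<forall>n. left_module R (Q n) \<and>
    i1 n \<in> left_hom R (ob X1 n) (Q n) \<and> i2 n \<in> left_hom R (ob X2 n) (Q n) \<and>
    p1 n \<in> left_hom R (Q n) (ob X1 n) \<and> p2 n \<in> left_hom R (Q n) (ob X2 n) \<and>
    (\<forall>x\<in>carrier (ob X1 n). p1 n (i1 n x) = x \<and> p2 n (i1 n x) = \<zero>\<^bsub>ob X2 n\<^esub>) \<and>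
    (\<forall>x\<in>carrier (ob X2 n). p2 n (i2 n x) = x \<and> p1 n (i2 n x) = \<zero>\<^bsub>ob X1 n\<^esub>) \<and>
    (\<forall>x\<in>carrier (Q n). i1 n (p1 n x) \<oplus>\<^bsub>Q n\<^esub> i2 n (p2 n x) = x)"
    unfolding choice_iff by (elim exE) (rule that)
  interpret X1: left_module R "ob X1 n" for n by (rule D1(2))
  interpret X2: left_module R "ob X2 n" for n by (rule D2(2))
  interpret Q: left_module R "Q n" for n using * by blast
  have i1: "i1 n \<in> left_hom R (ob X1 n) (Q n)" and i2: "i2 n \<in> left_hom R (ob X2 n) (Q n)"
    and p1: "p1 n \<in> left_hom R (Q n) (ob X1 n)" and p2: "p2 n \<in> left_hom R (Q n) (ob X2 n)" for n
    using * by blast+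
  have pi: "x \<in> carrier (ob X1 n) \<Longrightarrow> p1 n (i1 n x) = x" "x \<in> carrier (ob X1 n) \<Longrightarrow> p2 n (i1 n x) = \<zero>\<^bsub>ob X2 n\<^esub>"
    "x \<in> carrier (ob X2 n) \<Longrightarrow> p2 n (i2 n x) = x" "x \<in> carrier (ob X2 n) \<Longrightarrow> p1 n (i2 n x) = \<zero>\<^bsub>ob X1 n\<^esub>"
    and ip: "x \<in> carrier (Q n) \<Longrightarrow> i1 n (p1 n x) \<oplus>\<^bsub>Q n\<^esub> i2 n (p2 n x) = x" for n x
    using * by blast+
  note i1D = left_homD[OF i1] and i2D = left_homD[OF i2] and p1D = left_homD[OF p1] and p2D = left_homD[OF p2]
  note dD1 = left_homD[OF D1(3)] and dD2 = left_homD[OF D2(3)]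
  have z: "i1 n \<zero>\<^bsub>ob X1 n\<^esub> = \<zero>\<^bsub>Q n\<^esub>" "i2 n \<zero>\<^bsub>ob X2 n\<^esub> = \<zero>\<^bsub>Q n\<^esub>"
     "diff X1 n \<zero>\<^bsub>ob X1 n\<^esub> = \<zero>\<^bsub>ob X1 (n + 1)\<^esub>" "diff X2 n \<zero>\<^bsub>ob X2 n\<^esub> = \<zero>\<^bsub>ob X2 (n + 1)\<^esub>" for n
    using left_hom_zero[OF D1(2) Q.left_module_axioms i1] left_hom_zero[OF D2(2) Q.left_module_axioms i2]
      left_hom_zero[OF D1(2) D1(2) D1(3)] left_hom_zero[OF D2(2) D2(2) D2(3)] by auto
  define \<delta> where "\<delta> n = (\<lambda>x\<in>carrier (Q n). i1 (n + 1) (diff X1 n (p1 n x)) \<oplus>\<^bsub>Q (n + 1)\<^esub> i2 (n + 1) (diff X2 n (p2 n x)))" for n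
  have \<delta>: "\<delta> n \<in> left_hom R (Q n) (Q (n + 1))" for n
    unfolding left_hom_def \<delta>_def
    by (auto simp: i1D i2D p1D p2D dD1 dD2 Q.M.add.m_ac Q.smult_r_distr)
  define X where "X = \<lparr>ob = Q, diff = \<delta>\<rparr>"
  have XQ: "ob X = Q" "diff X = \<delta>" by (simp_all add: X_def)
  have i1\<delta>: "\<delta> n (i1 n x) = i1 (n + 1) (diff X1 n x)" if "x \<in> carrier (ob X1 n)" for n x
    using that by (simp add: \<delta>_def i1D pi z dD1)
  have i2\<delta>: "\<delta> n (i2 n x) = i2 (n + 1) (diff X2 n x)" if "x \<in> carrier (ob X2 n)" for n x
    using that by (simp add: \<delta>_def i2D pi z dD2)
  have p1\<delta>: "p1 (n + 1) (\<delta> n x) = diff X1 n (p1 n x)" "p2 (n + 1) (\<delta> n x) = diff X2 n (p2 n x)"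
    if "x \<in> carrier (Q n)" for n x
    using that by (simp_all add: \<delta>_def i1D i2D p1D p2D dD1 dD2 pi)
  have X: "bounded_proj_complex R X"
    unfolding bounded_proj_complex_def XQ
  proof (intro conjI allI ballI)
    show "fg_projective R (Q n)" for n
      by (rule fg_projective_sum[OF D1(1) D2(1) Q.left_module_axioms i1 i2 p1 p2 ip])
    show "\<delta> n \<in> left_hom R (Q n) (Q (n + 1))" for n by (rule \<delta>)
    show "\<delta> (n + 1) (\<delta> n x) = \<zero>\<^bsub>Q (n + 2)\<^esub>" if x: "x \<in> carrier (Q n)" for n x
    proof -
      have "n + 1 + 1 = n + 2" by simp
      then have "\<delta> (n + 1) (\<delta> n x) = i1 (n + 2) (diff X1 (n + 1) (p1 (n + 1) (\<delta> n x))) \<oplus>\<^bsub>Q (n + 2)\<^esub>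
          i2 (n + 2) (diff X2 (n + 1) (p2 (n + 1) (\<delta> n x)))"
        using left_homD(1)[OF \<delta> x] by (simp only: \<delta>_def[of "n + 1"] restrict_apply')
      then show ?thesis
        using x D1(5)[OF p1D(1)[OF x]] D2(5)[OF p2D(1)[OF x]] by (simp add: p1\<delta> z)
    qed
    obtain b1 where b1: "\<And>n. b1 < \<bar>n\<bar> \<Longrightarrow> carrier (ob X1 n) = {\<zero>\<^bsub>ob X1 n\<^esub>}"
      using X1 by (auto simp: bounded_proj_complex_def)
    obtain b2 where b2: "\<And>n. b2 < \<bar>n\<bar> \<Longrightarrow> carrier (ob X2 n) = {\<zero>\<^bsub>ob X2 n\<^esub>}"
      using X2 by (auto simp: bounded_proj_complex_def)
    have "carrier (Q n) = {\<zero>\<^bsub>Q n\<^esub>}" if n: "max b1 b2 < \<bar>n\<bar>" for n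
    proof -
      have "x = \<zero>\<^bsub>Q n\<^esub>" if x: "x \<in> carrier (Q n)" for x
        using ip[OF x] p1D(1)[OF x] p2D(1)[OF x] b1[of n] b2[of n] n z(1,2)[of n] by auto
      then show ?thesis by blast
    qed
    then show "\<exists>b. \<forall>n. b < \<bar>n\<bar> \<longrightarrow> carrier (Q n) = {\<zero>\<^bsub>Q n\<^esub>}" by blast
  qed
  have "is_biproduct (Cb_proj R) X1 X2 X"
    by (rule Cb_biproductI[OF X1 X2 X, of i1 i2 p1 p2])
      (auto simp: chain_maps_def XQ i1 i2 p1 p2 i1\<delta> i2\<delta> p1\<delta> pi ip)
  then show ?thesis by blast
qed

lemma Cb_zero_exists:
  assumes "ring R"
  shows "\<exists>X :: ('a, 'b) cochain_complex. bounded_proj_complex R X \<and> (\<forall>n. carrier (ob X n) = {\<zero>\<^bsub>ob X n\<^esub>})"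
proof -
  define Z :: "('a, 'b) module" where "Z = \<lparr>carrier = {undefined}, mult = undefined, one = undefined,
    zero = undefined, add = (\<lambda>_ _. undefined), smult = (\<lambda>_ _. undefined)\<rparr>"
  have "abelian_group Z" by (rule abelian_groupI) (auto simp: Z_def)
  then have Z: "left_module R Z"
    using assms by (intro left_module.intro left_module_axioms.intro) (auto simp: Z_def)
  have Z0: "carrier Z = {\<zero>\<^bsub>Z\<^esub>}" by (simp add: Z_def)
  have "bounded_proj_complex R \<lparr>ob = \<lambda>_. Z, diff = \<lambda>_. \<lambda>x\<in>carrier Z. \<zero>\<^bsub>Z\<^esub>\<rparr>"
    unfolding bounded_proj_complex_def using fg_projective_zero[OF Z Z0] left_hom_const_zero[OF Z Z] Z0 by auto
  then show ?thesis using Z0 by (intro exI[of _ "\<lparr>ob = \<lambda>_. Z, diff = \<lambda>_. \<lambda>x\<in>carrier Z. \<zero>\<^bsub>Z\<^esub>\<rparr>"]) simp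
qed

subsection \<open>Summands\<close>

lemma left_module_submodule:
  assumes M: "left_module R M" and S: "submodule S R M"
  shows "left_module R (M\<lparr>carrier := S\<rparr>)"
proof -
  interpret M: left_module R M by fact
  note c = M.submodule_closed[OF S]
  have "abelian_group (M\<lparr>carrier := S\<rparr>)"
  proof (rule abelian_groupI, goal_cases)
    case (6 x)
    then show ?case using c(1,5) by (intro bexI[of _ "\<ominus>\<^bsub>M\<^esub> x"]) (auto simp: M.M.l_neg)
  qed (auto simp: c M.M.add.m_ac)
  then show ?thesis
    using M.R.ring_axioms
    by (intro left_module.intro left_module_axioms.intro)
      (auto simp: c M.smult_l_distr M.smult_r_distr M.smult_assoc1)
qed

text \<open>Because U and V meet in zero, the components of x are unique. So they can be defined by
  descriptions, and uniqueness also makes them linear.\<close>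

lemma complement_projections:
  assumes M: "left_module R M" and U: "submodule U R M" and V: "submodule V R M"
    and disj: "U \<inter> V = {\<zero>\<^bsub>M\<^esub>}"
    and sum: "\<And>x. x \<in> carrier M \<Longrightarrow> \<exists>u\<in>U. \<exists>v\<in>V. x = u \<oplus>\<^bsub>M\<^esub> v"
  shows "\<exists>e1 e2. e1 \<in> left_hom R M M \<and> e2 \<in> left_hom R M M \<and>
    (\<forall>x\<in>carrier M. e1 x \<in> U \<and> e2 x \<in> V \<and> e1 x \<oplus>\<^bsub>M\<^esub> e2 x = x) \<and>
    (\<forall>u\<in>U. e1 u = u \<and> e2 u = \<zero>\<^bsub>M\<^esub>) \<and> (\<forall>v\<in>V. e2 v = v \<and> e1 v = \<zero>\<^bsub>M\<^esub>)"
proof -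
  interpret M: left_module R M by fact
  note cU = M.submodule_closed[OF U] and cV = M.submodule_closed[OF V]
  have uniq: "u = u' \<and> v = v'"
    if uv: "u \<in> U" "u' \<in> U" "v \<in> V" "v' \<in> V" "u \<oplus>\<^bsub>M\<^esub> v = u' \<oplus>\<^bsub>M\<^esub> v'" for u u' v v'
  proof -
    have c: "u \<in> carrier M" "u' \<in> carrier M" "v \<in> carrier M" "v' \<in> carrier M" using uv cU(1) cV(1) by auto
    have "u \<ominus>\<^bsub>M\<^esub> u' = ((u \<oplus>\<^bsub>M\<^esub> v) \<ominus>\<^bsub>M\<^esub> v) \<ominus>\<^bsub>M\<^esub> u'"
      using c by (simp add: a_minus_def M.M.a_assoc M.M.r_neg)
    also have "\<dots> = (v' \<ominus>\<^bsub>M\<^esub> v) \<oplus>\<^bsub>M\<^esub> (u' \<ominus>\<^bsub>M\<^esub> u')"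
      unfolding uv(5) using c by (simp add: a_minus_def M.M.add.m_ac)
    also have "\<dots> = v' \<ominus>\<^bsub>M\<^esub> v"
      using c by (simp add: a_minus_def M.M.r_neg)
    finally have "u \<ominus>\<^bsub>M\<^esub> u' = v' \<ominus>\<^bsub>M\<^esub> v" .
    moreover have "u \<ominus>\<^bsub>M\<^esub> u' \<in> U" "v' \<ominus>\<^bsub>M\<^esub> v \<in> V" using cU(4) cV(4) uv by auto
    ultimately have "u \<ominus>\<^bsub>M\<^esub> u' = \<zero>\<^bsub>M\<^esub>" using disj by auto
    then have "(u \<ominus>\<^bsub>M\<^esub> u') \<oplus>\<^bsub>M\<^esub> u' = u'" using c by simp
    then have "u = u'" using c by (simp add: a_minus_def M.M.a_assoc M.M.l_neg)
    then show ?thesis using uv(5) c by simp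
  qed
  define e1 where "e1 = (\<lambda>x\<in>carrier M. THE u. u \<in> U \<and> (\<exists>v\<in>V. x = u \<oplus>\<^bsub>M\<^esub> v))"
  define e2 where "e2 = (\<lambda>x\<in>carrier M. THE v. v \<in> V \<and> (\<exists>u\<in>U. x = u \<oplus>\<^bsub>M\<^esub> v))"
  have e: "e1 (u \<oplus>\<^bsub>M\<^esub> v) = u" "e2 (u \<oplus>\<^bsub>M\<^esub> v) = v" if uv: "u \<in> U" "v \<in> V" for u v
  proof -
    have c: "u \<oplus>\<^bsub>M\<^esub> v \<in> carrier M" using uv cU(1) cV(1) by auto
    show "e1 (u \<oplus>\<^bsub>M\<^esub> v) = u" unfolding e1_def restrict_apply'[OF c]
      by (rule the_equality) (use uv uniq in blast)+
    show "e2 (u \<oplus>\<^bsub>M\<^esub> v) = v" unfolding e2_def restrict_apply'[OF c]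
      by (rule the_equality) (use uv uniq in blast)+
  qed
  have dec: "e1 x \<in> U \<and> e2 x \<in> V \<and> e1 x \<oplus>\<^bsub>M\<^esub> e2 x = x" if "x \<in> carrier M" for x
    using sum[OF that] e by fastforce
  have U': "e1 u = u \<and> e2 u = \<zero>\<^bsub>M\<^esub>" if "u \<in> U" for u
    using e[OF that cV(2)] cU(1)[OF that] by simp
  have V': "e2 v = v \<and> e1 v = \<zero>\<^bsub>M\<^esub>" if "v \<in> V" for v
    using e[OF cU(2) that] cV(1)[OF that] by simp
  have add: "e1 (x \<oplus>\<^bsub>M\<^esub> y) = e1 x \<oplus>\<^bsub>M\<^esub> e1 y" "e2 (x \<oplus>\<^bsub>M\<^esub> y) = e2 x \<oplus>\<^bsub>M\<^esub> e2 y"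
    if xy: "x \<in> carrier M" "y \<in> carrier M" for x y
  proof -
    have c: "e1 x \<in> U" "e1 y \<in> U" "e2 x \<in> V" "e2 y \<in> V" using dec xy by auto
    then have "(e1 x \<oplus>\<^bsub>M\<^esub> e1 y) \<oplus>\<^bsub>M\<^esub> (e2 x \<oplus>\<^bsub>M\<^esub> e2 y) = (e1 x \<oplus>\<^bsub>M\<^esub> e2 x) \<oplus>\<^bsub>M\<^esub> (e1 y \<oplus>\<^bsub>M\<^esub> e2 y)"
      using cU(1) cV(1) by (simp add: M.M.add.m_ac)
    then have "(e1 x \<oplus>\<^bsub>M\<^esub> e1 y) \<oplus>\<^bsub>M\<^esub> (e2 x \<oplus>\<^bsub>M\<^esub> e2 y) = x \<oplus>\<^bsub>M\<^esub> y" using dec xy by simp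
    then show "e1 (x \<oplus>\<^bsub>M\<^esub> y) = e1 x \<oplus>\<^bsub>M\<^esub> e1 y" "e2 (x \<oplus>\<^bsub>M\<^esub> y) = e2 x \<oplus>\<^bsub>M\<^esub> e2 y"
      using e[OF cU(3)[OF c(1,2)] cV(3)[OF c(3,4)]] by simp_all
  qed
  have smult: "e1 (a \<odot>\<^bsub>M\<^esub> x) = a \<odot>\<^bsub>M\<^esub> e1 x" "e2 (a \<odot>\<^bsub>M\<^esub> x) = a \<odot>\<^bsub>M\<^esub> e2 x"
    if ax: "a \<in> carrier R" "x \<in> carrier M" for a x
  proof -
    have c: "e1 x \<in> U" "e2 x \<in> V" using dec ax by auto
    then have "a \<odot>\<^bsub>M\<^esub> e1 x \<oplus>\<^bsub>M\<^esub> a \<odot>\<^bsub>M\<^esub> e2 x = a \<odot>\<^bsub>M\<^esub> (e1 x \<oplus>\<^bsub>M\<^esub> e2 x)"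
      using cU(1) cV(1) ax by (simp add: M.smult_r_distr)
    then have "a \<odot>\<^bsub>M\<^esub> e1 x \<oplus>\<^bsub>M\<^esub> a \<odot>\<^bsub>M\<^esub> e2 x = a \<odot>\<^bsub>M\<^esub> x" using dec ax by simp
    then show "e1 (a \<odot>\<^bsub>M\<^esub> x) = a \<odot>\<^bsub>M\<^esub> e1 x" "e2 (a \<odot>\<^bsub>M\<^esub> x) = a \<odot>\<^bsub>M\<^esub> e2 x"
      using e[OF cU(6)[OF ax(1) c(1)] cV(6)[OF ax(1) c(2)]] by simp_all
  qed
  have "e1 \<in> left_hom R M M"
    unfolding left_hom_def using dec cU(1) add(1) smult(1) by (auto simp: e1_def)
  moreover have "e2 \<in> left_hom R M M"
    unfolding left_hom_def using dec cV(1) add(2) smult(2) by (auto simp: e2_def)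
  ultimately show ?thesis using dec U' V' by blast
qed

text \<open>Operations are kept and only carriers shrink, so a subcomplex of a subcomplex is
  literally a subcomplex of X; the differential is restricted to stay extensional.\<close>

definition sub_complex :: "('a, 'b) cochain_complex \<Rightarrow> (int \<Rightarrow> 'b set) \<Rightarrow> ('a, 'b) cochain_complex"
  where "sub_complex X S = \<lparr>ob = \<lambda>n. (ob X n)\<lparr>carrier := S n\<rparr>, diff = \<lambda>n. \<lambda>x\<in>S n. diff X n x\<rparr>"

definition retraction :: "('a, 'r) ring_scheme \<Rightarrow> ('a, 'b, 'm) module_scheme \<Rightarrow> 'b set \<Rightarrow> ('b \<Rightarrow> 'b) \<Rightarrow> bool"
  where "retraction R M S e \<longleftrightarrow> e \<in> left_hom R M M \<and> (\<forall>x\<in>carrier M. e x \<in> S) \<and> (\<forall>x\<in>S. e x = x)"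

text \<open>The retractions are chosen degree by degree, without regard to the differential. They
  keep the terms projective and feed the Nakayama argument, and in this form the notion passes to
  nested summands.\<close>

definition summand_complex :: "('a, 'r) ring_scheme \<Rightarrow> ('a, 'b) cochain_complex \<Rightarrow> (int \<Rightarrow> 'b set) \<Rightarrow> bool"
  where "summand_complex R X S \<longleftrightarrow>
    (\<forall>n. submodule (S n) R (ob X n) \<and> (\<forall>x\<in>S n. diff X n x \<in> S (n + 1)) \<and> (\<exists>e. retraction R (ob X n) (S n) e))"

lemma sub_complex_simps:
  "ob (sub_complex X S) n = (ob X n)\<lparr>carrier := S n\<rparr>"
  "diff (sub_complex X S) n = (\<lambda>x\<in>S n. diff X n x)"
  by (simp_all add: sub_complex_def)

lemma bounded_sub_complex:
  assumes X: "bounded_proj_complex R X" and S: "summand_complex R X S"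
  shows "bounded_proj_complex R (sub_complex X S)"
  unfolding bounded_proj_complex_def sub_complex_simps
proof (intro conjI allI ballI)
  note D = bounded_proj_complexD[OF X]
  have Sub: "submodule (S n) R (ob X n)" for n using S by (simp add: summand_complex_def)
  have Sc: "x \<in> carrier (ob X n)" if "x \<in> S n" for n x using submodule_props(1)[OF Sub] that by blast
  note Sp = submodule_props(2-4)[OF Sub]
  have Sd: "diff X n x \<in> S (n + 1)" if "x \<in> S n" for n x using S that by (simp add: summand_complex_def)
  show "fg_projective R ((ob X n)\<lparr>carrier := S n\<rparr>)" for n
  proof -
    obtain e where e: "e \<in> left_hom R (ob X n) (ob X n)" "\<forall>x\<in>carrier (ob X n). e x \<in> S n" "\<forall>x\<in>S n. e x = x"
      using S unfolding summand_complex_def retraction_def by blast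
    have i: "(\<lambda>x\<in>S n. x) \<in> left_hom R ((ob X n)\<lparr>carrier := S n\<rparr>) (ob X n)"
      using Sc Sp by (auto simp: left_hom_def)
    have p: "e \<in> left_hom R (ob X n) ((ob X n)\<lparr>carrier := S n\<rparr>)"
      using e(1,2) by (auto simp: left_hom_def PiE_def)
    show ?thesis
      by (rule fg_projective_retract[OF D(1) left_module_submodule[OF D(2) Sub] i p]) (use e(3) in simp)
  qed
  show "(\<lambda>x\<in>S n. diff X n x) \<in> left_hom R ((ob X n)\<lparr>carrier := S n\<rparr>) ((ob X (n + 1))\<lparr>carrier := S (n + 1)\<rparr>)" for n
    using left_homD(2,3)[OF D(3)[of n]] Sd Sp Sc by (auto simp: left_hom_def)
  show "(\<lambda>x\<in>S (n + 1). diff X (n + 1) x) ((\<lambda>x\<in>S n. diff X n x) x) = \<zero>\<^bsub>(ob X (n + 2))\<lparr>carrier := S (n + 2)\<rparr>\<^esub>"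
    if "x \<in> carrier ((ob X n)\<lparr>carrier := S n\<rparr>)" for n x
    using that Sd[of x n] D(5)[OF Sc, of x n] by simp
  obtain b where "\<And>n. b < \<bar>n\<bar> \<Longrightarrow> carrier (ob X n) = {\<zero>\<^bsub>ob X n\<^esub>}"
    using X by (auto simp: bounded_proj_complex_def)
  then have "S n = {\<zero>\<^bsub>ob X n\<^esub>}" if "b < \<bar>n\<bar>" for n using Sc[of _ n] Sp(1)[of n] that by blast
  then show "\<exists>b. \<forall>n. b < \<bar>n\<bar> \<longrightarrow> carrier ((ob X n)\<lparr>carrier := S n\<rparr>) = {\<zero>\<^bsub>(ob X n)\<lparr>carrier := S n\<rparr>\<^esub>}"
    by auto
qed

lemma sub_complex_carrier:
  assumes X: "bounded_proj_complex R X"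
  shows "summand_complex R X (\<lambda>n. carrier (ob X n))" "sub_complex X (\<lambda>n. carrier (ob X n)) = X"
proof -
  note D = bounded_proj_complexD[OF X]
  interpret X: left_module R "ob X n" for n by (rule D(2))
  have "retraction R (ob X n) (carrier (ob X n)) (\<lambda>x\<in>carrier (ob X n). x)" for n
    using left_hom_id[OF D(2)] by (simp add: retraction_def)
  then show "summand_complex R X (\<lambda>n. carrier (ob X n))"
    using X.submodule_carrier D(4) unfolding summand_complex_def by blast
  have "diff X n \<in> extensional (carrier (ob X n))" for n using D(3)[of n] by (auto simp: left_hom_def PiE_def)
  then have "(\<lambda>x\<in>carrier (ob X n). diff X n x) = diff X n" for n by (rule extensional_restrict)
  then show "sub_complex X (\<lambda>n. carrier (ob X n)) = X" by (simp add: sub_complex_def)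
qed

lemma sub_sub_complex:
  assumes "\<And>n. U n \<subseteq> S n"
  shows "sub_complex (sub_complex X S) U = sub_complex X U"
proof -
  have "(\<lambda>x\<in>U n. (\<lambda>x\<in>S n. diff X n x) x) = (\<lambda>x\<in>U n. diff X n x)" for n
    using assms[of n] by (intro restrict_ext) auto
  then show ?thesis by (simp add: sub_complex_def)
qed

text \<open>A retraction onto S followed by one of S onto U is a retraction onto U. This keeps all
  summands that arise by repeated splitting inside one fixed X.\<close>

lemma summand_sub_complex:
  assumes X: "bounded_proj_complex R X" and S: "summand_complex R X S"
    and U: "summand_complex R (sub_complex X S) U"
  shows "summand_complex R X U" "\<And>n. U n \<subseteq> S n"
proof -
  note D = bounded_proj_complexD[OF X]
  interpret X: left_module R "ob X n" for n by (rule D(2))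
  have SubS: "submodule (S n) R (ob X n)" for n using S by (simp add: summand_complex_def)
  have SubU: "submodule (U n) R ((ob X n)\<lparr>carrier := S n\<rparr>)" for n
    using U by (simp add: summand_complex_def sub_complex_simps)
  show US: "U n \<subseteq> S n" for n using submodule_props(1)[OF SubU] by simp
  have Sc: "S n \<subseteq> carrier (ob X n)" for n by (rule submodule_props(1)[OF SubS])
  have "submodule (U n) R (ob X n)" for n
    using submodule_props(2-4)[OF SubU[of n]] US[of n] Sc[of n] by (intro X.left_submoduleI) auto
  moreover have "diff X n x \<in> U (n + 1)" if x: "x \<in> U n" for n x
  proof -
    have "diff (sub_complex X S) n x \<in> U (n + 1)" using U x by (simp add: summand_complex_def)
    then show ?thesis using x US[of n] by (auto simp: sub_complex_simps)
  qed
  moreover have "\<exists>e. retraction R (ob X n) (U n) e" for n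
  proof -
    obtain e where e: "e \<in> left_hom R (ob X n) (ob X n)" "\<forall>x\<in>carrier (ob X n). e x \<in> S n" "\<forall>x\<in>S n. e x = x"
      using S unfolding summand_complex_def retraction_def by blast
    obtain f where f: "f \<in> left_hom R ((ob X n)\<lparr>carrier := S n\<rparr>) ((ob X n)\<lparr>carrier := S n\<rparr>)"
        "\<forall>x\<in>S n. f x \<in> U n" "\<forall>x\<in>U n. f x = x"
    proof -
      have "\<exists>f. retraction R ((ob X n)\<lparr>carrier := S n\<rparr>) (U n) f"
        using U by (simp only: summand_complex_def sub_complex_simps)
      then show thesis using that by (auto simp: retraction_def)
    qed
    note fD = left_homD[OF f(1), simplified] and eD = left_homD[OF e(1)]
    have "(\<lambda>x\<in>carrier (ob X n). f (e x)) \<in> left_hom R (ob X n) (ob X n)"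
      using e(2) f(2) Sc[of n] US[of n] by (auto simp: left_hom_def eD fD)
    then have "retraction R (ob X n) (U n) (\<lambda>x\<in>carrier (ob X n). f (e x))"
      using e f Sc[of n] US[of n] by (auto simp: retraction_def)
    then show ?thesis by blast
  qed
  ultimately show "summand_complex R X U" unfolding summand_complex_def by blast
qed

text \<open>The differential preserves both U and V, so it respects the decomposition x = u + v, and
  the projections are chain maps.\<close>

lemma complement_biproduct:
  assumes Y: "bounded_proj_complex R Y"
    and U: "\<And>n. submodule (U n) R (ob Y n)" "\<And>n x. x \<in> U n \<Longrightarrow> diff Y n x \<in> U (n + 1)"
    and V: "\<And>n. submodule (V n) R (ob Y n)" "\<And>n x. x \<in> V n \<Longrightarrow> diff Y n x \<in> V (n + 1)"
    and disj: "\<And>n. U n \<inter> V n = {\<zero>\<^bsub>ob Y n\<^esub>}"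
    and sum: "\<And>n x. x \<in> carrier (ob Y n) \<Longrightarrow> \<exists>u\<in>U n. \<exists>v\<in>V n. x = u \<oplus>\<^bsub>ob Y n\<^esub> v"
  shows "summand_complex R Y U" "summand_complex R Y V"
    "is_biproduct (Cb_proj R) (sub_complex Y U) (sub_complex Y V) Y"
proof -
  note D = bounded_proj_complexD[OF Y]
  interpret Y: left_module R "ob Y n" for n by (rule D(2))
  have "\<forall>n. \<exists>e1 e2. e1 \<in> left_hom R (ob Y n) (ob Y n) \<and> e2 \<in> left_hom R (ob Y n) (ob Y n) \<and>
    (\<forall>x\<in>carrier (ob Y n). e1 x \<in> U n \<and> e2 x \<in> V n \<and> e1 x \<oplus>\<^bsub>ob Y n\<^esub> e2 x = x) \<and>
    (\<forall>u\<in>U n. e1 u = u \<and> e2 u = \<zero>\<^bsub>ob Y n\<^esub>) \<and> (\<forall>v\<in>V n. e2 v = v \<and> e1 v = \<zero>\<^bsub>ob Y n\<^esub>)"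
    by (intro allI complement_projections[OF D(2) U(1) V(1) disj sum])
  then obtain e1 e2 where *: "\<forall>n. e1 n \<in> left_hom R (ob Y n) (ob Y n) \<and> e2 n \<in> left_hom R (ob Y n) (ob Y n) \<and>
    (\<forall>x\<in>carrier (ob Y n). e1 n x \<in> U n \<and> e2 n x \<in> V n \<and> e1 n x \<oplus>\<^bsub>ob Y n\<^esub> e2 n x = x) \<and>
    (\<forall>u\<in>U n. e1 n u = u \<and> e2 n u = \<zero>\<^bsub>ob Y n\<^esub>) \<and> (\<forall>v\<in>V n. e2 n v = v \<and> e1 n v = \<zero>\<^bsub>ob Y n\<^esub>)"
    unfolding choice_iff by (elim exE) (rule that)
  have hom: "e1 n \<in> left_hom R (ob Y n) (ob Y n)" "e2 n \<in> left_hom R (ob Y n) (ob Y n)" for n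
    using * by blast+
  have dec: "e1 n x \<in> U n" "e2 n x \<in> V n" "e1 n x \<oplus>\<^bsub>ob Y n\<^esub> e2 n x = x" if "x \<in> carrier (ob Y n)" for n x
    using * that by blast+
  have onU: "e1 n u = u" "e2 n u = \<zero>\<^bsub>ob Y n\<^esub>" if "u \<in> U n" for n u using * that by blast+
  have onV: "e2 n v = v" "e1 n v = \<zero>\<^bsub>ob Y n\<^esub>" if "v \<in> V n" for n v using * that by blast+
  note cU = Y.submodule_closed[OF U(1)] and cV = Y.submodule_closed[OF V(1)]
  show SU: "summand_complex R Y U" unfolding summand_complex_def
  proof (intro allI conjI ballI)
    show "\<exists>e. retraction R (ob Y n) (U n) e" for n
      using hom(1) dec(1) onU(1) unfolding retraction_def by blast
  qed (use U in auto)
  show SV: "summand_complex R Y V" unfolding summand_complex_def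
  proof (intro allI conjI ballI)
    show "\<exists>e. retraction R (ob Y n) (V n) e" for n
      using hom(2) dec(2) onV(1) unfolding retraction_def by blast
  qed (use V in auto)
  have incl: "(\<lambda>n. \<lambda>x\<in>S n. x) \<in> chain_maps R (sub_complex Y S) Y" if S: "summand_complex R Y S" for S
  proof -
    have Sub: "submodule (S n) R (ob Y n)" for n using S by (simp add: summand_complex_def)
    have d: "x \<in> S n \<Longrightarrow> diff Y n x \<in> S (n + 1)" for n x using S by (simp add: summand_complex_def)
    show ?thesis
      using Y.submodule_closed(1,3,6)[OF Sub] d by (auto simp: chain_maps_def sub_complex_simps left_hom_def)
  qed
  have comm: "e1 (n + 1) (diff Y n x) = diff Y n (e1 n x)" "e2 (n + 1) (diff Y n x) = diff Y n (e2 n x)"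
    if x: "x \<in> carrier (ob Y n)" for n x
  proof -
    have c: "diff Y n (e1 n x) \<in> U (n + 1)" "diff Y n (e2 n x) \<in> V (n + 1)"
      using U(2) V(2) dec[OF x] by auto
    have c': "diff Y n (e1 n x) \<in> carrier (ob Y (n + 1))" "diff Y n (e2 n x) \<in> carrier (ob Y (n + 1))"
      using c cU(1) cV(1) by auto
    have "diff Y n x = diff Y n (e1 n x) \<oplus>\<^bsub>ob Y (n + 1)\<^esub> diff Y n (e2 n x)"
      using left_homD(2)[OF D(3), of "e1 n x" n "e2 n x"] dec[OF x] cU(1) cV(1) by simp
    then show "e1 (n + 1) (diff Y n x) = diff Y n (e1 n x)" "e2 (n + 1) (diff Y n x) = diff Y n (e2 n x)"
      using left_homD(2)[OF hom(1) c'] left_homD(2)[OF hom(2) c'] onU[OF c(1)] onV[OF c(2)] c' by simp_all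
  qed
  have p: "e1 \<in> chain_maps R Y (sub_complex Y U)" "e2 \<in> chain_maps R Y (sub_complex Y V)"
    using hom dec(1,2) comm by (auto simp: chain_maps_def sub_complex_simps left_hom_def PiE_def)
  show "is_biproduct (Cb_proj R) (sub_complex Y U) (sub_complex Y V) Y"
    by (rule Cb_biproductI[OF bounded_sub_complex[OF Y SU] bounded_sub_complex[OF Y SV] Y incl[OF SU] incl[OF SV] p])
      (auto simp: sub_complex_simps onU onV dec)
qed

subsection \<open>Decomposition into complexes with local endomorphism rings\<close>

context complete_adic_ring
begin

text \<open>Every endomorphism f produces a Fitting splitting of Y. If none of these is proper, each
  f or 1 - f is a unit, and \<open>local_ringI\<close> leaves locality or 1 = 0, the latter meaning
  that Y vanishes.\<close>

lemma complex_zero_local_or_splits: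
  assumes Y: "bounded_proj_complex R Y"
  shows "(\<forall>n. carrier (ob Y n) = {\<zero>\<^bsub>ob Y n\<^esub>}) \<or> local_ring (End_ring (Cb_proj R) Y) \<or>
    (\<exists>U V. summand_complex R Y U \<and> summand_complex R Y V \<and>
      U \<noteq> (\<lambda>n. carrier (ob Y n)) \<and> V \<noteq> (\<lambda>n. carrier (ob Y n)) \<and>
      is_biproduct (Cb_proj R) (sub_complex Y U) (sub_complex Y V) Y)"
proof (rule disjCI)
  let ?E = "End_ring (Cb_proj R) Y"
  note D = bounded_proj_complexD[OF Y]
  assume nosplit: "\<not> (local_ring ?E \<or> (\<exists>U V. summand_complex R Y U \<and> summand_complex R Y V \<and>
      U \<noteq> (\<lambda>n. carrier (ob Y n)) \<and> V \<noteq> (\<lambda>n. carrier (ob Y n)) \<and>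
      is_biproduct (Cb_proj R) (sub_complex Y U) (sub_complex Y V) Y))"
  interpret E: ring ?E using Y by (intro Cb.ring_End) (simp add: Cb_proj_simps)
  have "f \<in> Units ?E \<or> \<one>\<^bsub>?E\<^esub> \<ominus>\<^bsub>?E\<^esub> f \<in> Units ?E" if "f \<in> carrier ?E" for f
  proof -
    have f: "f \<in> chain_maps R Y Y" using that by (simp add: End_ring_def Cb_proj_simps)
    note fh = chain_mapsD(1)[OF f]
    define K where "K n = adic_filtration R I (ob Y n)" for n
    interpret F: filtered_module R "ob Y n" "K n" for n
      unfolding K_def by (rule filtered_module_adic[OF D(1)])
    have KK: "g x \<in> K m i" if "g \<in> left_hom R (ob Y n) (ob Y m)" "x \<in> K n i" for g n m x i
      using adic_filtration_hom[OF D(2) that(1)] that(2) by (simp add: K_def)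
    define U where "U n = fitting_im (ob Y n) (K n) (f n)" for n
    define V where "V n = fitting_ker (ob Y n) (K n) (f n)" for n
    note fit = F.submodule_fitting[OF fh KK[OF fh]] F.fitting_Int[OF fh KK[OF fh]]
      F.fitting_sum[OF fh KK[OF fh]] F.fitting_im_bij[OF fh KK[OF fh]] F.fitting_ker_bij[OF fh KK[OF fh]]
    \<comment> \<open>Naturality applied to the differential, which intertwines f in degrees n and n
      + 1.\<close>
    have d: "diff Y n x \<in> U (n + 1)" if "x \<in> U n" for n x
      using that chain_mapsD(4)[OF f] F.K_closed(1) unfolding U_def
      by (intro fitting_natural(1)[where K = "K n" and L = "K (n + 1)", OF D(2) D(2) fh fh D(3) KK[OF D(3)]]) auto
    have d': "diff Y n x \<in> V (n + 1)" if "x \<in> V n" for n x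
      using that chain_mapsD(4)[OF f] F.K_closed(1) unfolding V_def
      by (intro fitting_natural(2)[where K = "K n" and L = "K (n + 1)", OF D(2) D(2) fh fh D(3) KK[OF D(3)]]) auto
    have split: "summand_complex R Y U" "summand_complex R Y V"
      "is_biproduct (Cb_proj R) (sub_complex Y U) (sub_complex Y V) Y"
      by (rule complement_biproduct[OF Y fit(1)[folded U_def] d fit(2)[folded V_def] d'
            fit(3)[folded U_def V_def] fit(4)[folded U_def V_def]]; assumption)+
    \<comment> \<open>The families are compared as a whole, so the same alternative holds in all
      degrees and yields an invertible chain map.\<close>
    then consider "U = (\<lambda>n. carrier (ob Y n))" | "V = (\<lambda>n. carrier (ob Y n))" using nosplit by blast
    then show ?thesis
    proof cases
      case 1
      then have "fitting_im (ob Y n) (K n) (f n) = carrier (ob Y n)" for n unfolding U_def by metis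
      then have "bij_betw (f n) (carrier (ob Y n)) (carrier (ob Y n))" for n using fit(5)[of n] by simp
      then show ?thesis using Cb_unitI[OF Y f] by blast
    next
      case 2
      then have "fitting_ker (ob Y n) (K n) (f n) = carrier (ob Y n)" for n unfolding V_def by metis
      then have "bij_betw (\<lambda>x. x \<ominus>\<^bsub>ob Y n\<^esub> f n x) (carrier (ob Y n)) (carrier (ob Y n))" for n
        using fit(6)[of n] by simp
      then have "bij_betw ((\<one>\<^bsub>?E\<^esub> \<ominus>\<^bsub>?E\<^esub> f) n) (carrier (ob Y n)) (carrier (ob Y n))" for n
        using Cb_one_minus(2)[OF Y f] by (subst bij_betw_cong) auto
      then show ?thesis using Cb_unitI[OF Y Cb_one_minus(1)[OF Y f]] by blast
    qed
  qed
  then have "\<one>\<^bsub>?E\<^esub> = \<zero>\<^bsub>?E\<^esub>" using E.local_ringI nosplit by blast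
  then show "\<forall>n. carrier (ob Y n) = {\<zero>\<^bsub>ob Y n\<^esub>}"
    using Cb_zero_iff[OF Y] by (simp add: End_ring_def)
qed

text \<open>Consider g = (1 - e') e. As T lies in S, g maps into S, where e is the identity; as 1 -
  e' kills T, g is idempotent. Since S lies in T plus the first level of the filtration, g maps into
  that level. Nakayama gives g = 0, so e' fixes S and S lies in T.\<close>

lemma retract_eq_mod_filtration:
  assumes P: "fg_projective R P" and S: "submodule S R P" "retraction R P S e"
    and T: "submodule T R P" "retraction R P T e'"
    and TS: "T \<subseteq> S" and ST: "S \<subseteq> T <+>\<^bsub>P\<^esub> adic_filtration R I P 1"
  shows "T = S"
proof -
  have m: "left_module R P" using P by (simp add: fg_projective_def)
  interpret P: left_module R P by (rule m)
  have e: "e \<in> left_hom R P P" "\<And>x. x \<in> carrier P \<Longrightarrow> e x \<in> S" "\<And>x. x \<in> S \<Longrightarrow> e x = x"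
    and e': "e' \<in> left_hom R P P" "\<And>x. x \<in> carrier P \<Longrightarrow> e' x \<in> T" "\<And>x. x \<in> T \<Longrightarrow> e' x = x"
    using S(2) T(2) by (auto simp: retraction_def)
  note eD = left_homD[OF e(1)] and eD' = left_homD[OF e'(1)]
  define c where "c = (\<lambda>x\<in>carrier P. (\<lambda>x\<in>carrier P. x) x \<oplus>\<^bsub>P\<^esub> (\<lambda>x\<in>carrier P. \<ominus>\<^bsub>P\<^esub> e' x) x)"
  have c: "c \<in> left_hom R P P"
    unfolding c_def by (intro left_hom_add left_hom_id left_hom_uminus e' m)
  have cx: "c x = x \<ominus>\<^bsub>P\<^esub> e' x" if "x \<in> carrier P" for x using that by (simp add: c_def a_minus_def)
  define g where "g = (\<lambda>x\<in>carrier P. c (e x))"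
  have g: "g \<in> left_hom R P P" unfolding g_def by (rule left_hom_comp[OF e(1) c m])
  have gx: "g x = e x \<ominus>\<^bsub>P\<^esub> e' (e x)" if "x \<in> carrier P" for x
    using that eD(1) by (simp add: g_def cx)
  have c0: "c x = \<zero>\<^bsub>P\<^esub>" if "x \<in> T" for x
    using e'(3)[OF that] P.submodule_closed(1)[OF T(1) that] by (simp add: cx a_minus_def P.M.r_neg)
  have "g x = \<zero>\<^bsub>P\<^esub>" if "x \<in> carrier P" for x
  proof (rule adic_nakayama[OF P g _ _ that])
    fix x assume x: "x \<in> carrier P"
    have "g x \<in> S"
      unfolding gx[OF x] using e(2)[OF x] e'(2)[OF eD(1)[OF x]] TS P.submodule_closed(4)[OF S(1)] by blast
    then have "g (g x) = c (g x)" using left_homD(1)[OF g x] e(3) by (simp add: g_def)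
    also have "\<dots> = c (e x) \<ominus>\<^bsub>P\<^esub> c (e' (e x))"
      unfolding gx[OF x] using x eD(1) eD'(1) left_homD(2)[OF c] left_hom_a_inv[OF m m c] by (simp add: a_minus_def)
    also have "\<dots> = g x"
      using c0[OF e'(2)[OF eD(1)[OF x]]] x eD(1)[OF x] left_homD(1)[OF c] by (simp add: g_def a_minus_def)
    finally show "g (g x) = g x" .
    obtain t k where tk: "t \<in> T" "k \<in> adic_filtration R I P 1" "e x = t \<oplus>\<^bsub>P\<^esub> k"
      using e(2)[OF x] ST unfolding set_add_def' by blast
    have kc: "t \<in> carrier P" "k \<in> carrier P"
      using tk P.submodule_closed(1)[OF T(1)] by (auto simp: adic_filtration_def)
    have "g x = c k"
      using x tk(3) kc left_homD(1,2)[OF c] c0[OF tk(1)] by (simp add: g_def)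
    then show "g x \<in> adic_filtration R I P 1" using adic_filtration_hom[OF m c tk(2)] by simp
  qed
  then have "x = e' x" if "x \<in> S" for x
  proof -
    have xc: "x \<in> carrier P" using P.submodule_closed(1)[OF S(1) that] .
    have "x \<ominus>\<^bsub>P\<^esub> e' x = \<zero>\<^bsub>P\<^esub>" using \<open>\<And>x. x \<in> carrier P \<Longrightarrow> g x = \<zero>\<^bsub>P\<^esub>\<close>[OF xc] gx[OF xc] e(3)[OF that] by simp
    then have "(x \<ominus>\<^bsub>P\<^esub> e' x) \<oplus>\<^bsub>P\<^esub> e' x = e' x" using eD'(1)[OF xc] by simp
    then show ?thesis using xc eD'(1)[OF xc] by (simp add: a_minus_def P.M.a_assoc P.M.l_neg)
  qed
  then show ?thesis using TS e'(2) P.submodule_closed(1)[OF S(1)] by (metis subsetI subset_antisym)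
qed

text \<open>A strictly descending sequence changes at every index in some degree between -b and b.
  In a fixed degree each change is still visible after adding the first filtration level, so the
  chain condition allows finitely many changes. Finitely many degrees cannot account for infinitely
  many indices.\<close>

lemma wf_summand_complex:
  assumes X: "bounded_proj_complex R X"
  shows "wf {(S', S). summand_complex R X S' \<and> summand_complex R X S \<and> (\<forall>n. S' n \<subseteq> S n) \<and> S' \<noteq> S}"
  unfolding wf_iff_no_infinite_down_chain
proof
  note D = bounded_proj_complexD[OF X]
  assume "\<exists>H. \<forall>i. (H (Suc i), H i) \<in> {(S', S). summand_complex R X S' \<and> summand_complex R X S \<and>
    (\<forall>n. S' n \<subseteq> S n) \<and> S' \<noteq> S}"
  then obtain H where H: "\<And>i. summand_complex R X (H i)" "\<And>i n. H (Suc i) n \<subseteq> H i n" "\<And>i. H (Suc i) \<noteq> H i"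
    by auto
  have Sub: "submodule (H i n) R (ob X n)" for i n using H(1) by (simp add: summand_complex_def)
  obtain b where b: "\<And>n. b < \<bar>n\<bar> \<Longrightarrow> carrier (ob X n) = {\<zero>\<^bsub>ob X n\<^esub>}"
    using X by (auto simp: bounded_proj_complex_def)
  have zero: "H i n = {\<zero>\<^bsub>ob X n\<^esub>}" if "b < \<bar>n\<bar>" for i n
    using submodule_props(1,2)[OF Sub[of i n]] b[OF that] by blast
  have fin: "finite {i. H i n \<noteq> H (Suc i) n}" for n
  proof -
    interpret F: filtered_module R "ob X n" "adic_filtration R I (ob X n)"
      by (rule filtered_module_adic[OF D(1)])
    \<comment> \<open>Index 1, not 0: the filtration at 0 is the whole module and would hide every
      change.\<close>
    let ?K = "adic_filtration R I (ob X n) 1"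
    let ?G = "\<lambda>i. H i n <+>\<^bsub>ob X n\<^esub> ?K"
    have anti: "antimono ?G"
    proof (rule antimonoI)
      fix i j :: nat assume "i \<le> j"
      then have "H j n \<subseteq> H i n" by (rule lift_Suc_antimono_le[of "\<lambda>i. H i n", rotated]) (rule H(2))
      then show "?G j \<subseteq> ?G i" unfolding set_add_def' by blast
    qed
    have "finite {i. ?G i \<noteq> ?G (Suc i)}"
      using F.submodule_set_add[OF Sub F.K_submodule] F.set_add_upper[OF Sub F.K_submodule] anti
      by (intro chain_finiteD[OF F.chains[of 1]]) (auto dest: F.submodule_closed(1))
    moreover have "?G i \<noteq> ?G (Suc i)" if "H i n \<noteq> H (Suc i) n" for i
    proof
      assume "?G i = ?G (Suc i)"
      then have "H i n \<subseteq> ?G (Suc i)" using F.set_add_upper(1)[OF Sub F.K_submodule] by blast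
      moreover obtain e e' where "retraction R (ob X n) (H i n) e" "retraction R (ob X n) (H (Suc i) n) e'"
        using H(1) unfolding summand_complex_def by blast
      ultimately show False
        using retract_eq_mod_filtration[OF D(1) Sub _ Sub _ H(2)] that by blast
    qed
    then have "{i. H i n \<noteq> H (Suc i) n} \<subseteq> {i. ?G i \<noteq> ?G (Suc i)}" by blast
    ultimately show ?thesis using finite_subset by blast
  qed
  have "\<exists>n\<in>{-b..b}. H i n \<noteq> H (Suc i) n" for i
  proof -
    obtain n where n: "H i n \<noteq> H (Suc i) n" using H(3)[of i] unfolding fun_eq_iff by auto
    then have "\<not> b < \<bar>n\<bar>" using zero by auto
    then show ?thesis using n by (intro bexI[of _ n]) auto
  qed
  then have "(UNIV :: nat set) \<subseteq> (\<Union>n\<in>{-b..b}. {i. H i n \<noteq> H (Suc i) n})" by blast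
  then have "finite (UNIV :: nat set)" using fin finite_subset by blast
  then show False by simp
qed

text \<open>The repeated splitting, packaged for an arbitrary predicate so that it serves both
  categories: the rules speak of complexes and chain maps, while \<open>Pr\<close> may refer to the
  homotopy category.\<close>

lemma bounded_proj_complex_induct:
  assumes X: "bounded_proj_complex R X"
    and zero: "\<And>Y. \<lbrakk>bounded_proj_complex R Y; Id (Cb_proj R) Y = Zero (Cb_proj R) Y Y\<rbrakk> \<Longrightarrow> Pr Y"
    and local: "\<And>Y. \<lbrakk>bounded_proj_complex R Y; local_ring (End_ring (Cb_proj R) Y)\<rbrakk> \<Longrightarrow> Pr Y"
    and sum: "\<And>Y1 Y2 Y. \<lbrakk>is_biproduct (Cb_proj R) Y1 Y2 Y; Pr Y1; Pr Y2\<rbrakk> \<Longrightarrow> Pr Y"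
  shows "Pr X"
proof -
  \<comment> \<open>Generalised to all summands of a fixed X, since the well-founded relation
    compares families of subsets of X; the family of all carriers gives back X.\<close>
  have "summand_complex R X S \<longrightarrow> Pr (sub_complex X S)" for S
    using wf_summand_complex[OF X]
  proof (induction S rule: wf_induct_rule)
    case (less S)
    show ?case
    proof
      assume S: "summand_complex R X S"
      let ?Y = "sub_complex X S"
      have Y: "bounded_proj_complex R ?Y" by (rule bounded_sub_complex[OF X S])
      from complex_zero_local_or_splits[OF Y] show "Pr ?Y"
      proof (elim disjE exE conjE)
        fix U V assume UV: "summand_complex R ?Y U" "summand_complex R ?Y V"
          "U \<noteq> (\<lambda>n. carrier (ob ?Y n))" "V \<noteq> (\<lambda>n. carrier (ob ?Y n))"
          and bi: "is_biproduct (Cb_proj R) (sub_complex ?Y U) (sub_complex ?Y V) ?Y"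
        have eta: "(\<lambda>n. carrier (ob ?Y n)) = S" by (simp add: sub_complex_simps)
        have "Pr (sub_complex ?Y T)" if T: "summand_complex R ?Y T" "T \<noteq> S" for T
        proof -
          note s = summand_sub_complex[OF X S T(1)]
          have "Pr (sub_complex X T)" using less[of T] s S T(2) by blast
          then show ?thesis using sub_sub_complex[of T S X, OF s(2)] by simp
        qed
        then show "Pr ?Y" using sum[OF bi] UV unfolding eta by blast
      qed (use zero local Y Cb_zero_iff[OF Y] in auto)
    qed
  qed
  then show ?thesis using sub_complex_carrier[OF X] by metis
qed

end

section \<open>The homotopy category\<close>

text \<open>The condition of \<open>homotopy_rel\<close> with g moved to the other side: without
  subtraction, sums of homotopies are handled by associativity and commutativity alone.\<close>

definition is_homotopy ::
    "('a, 'r) ring_scheme \<Rightarrow> ('a, 'b) cochain_complex \<Rightarrow> ('a, 'b) cochain_complex \<Rightarrow>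
      (int \<Rightarrow> 'b \<Rightarrow> 'b) \<Rightarrow> (int \<Rightarrow> 'b \<Rightarrow> 'b) \<Rightarrow> (int \<Rightarrow> 'b \<Rightarrow> 'b) \<Rightarrow> bool"
  where "is_homotopy R X Y h f g \<longleftrightarrow> (\<forall>n. h n \<in> left_hom R (ob X n) (ob Y (n - 1))) \<and>
    (\<forall>n. \<forall>x\<in>carrier (ob X n).
      f n x = g n x \<oplus>\<^bsub>ob Y n\<^esub> (diff Y (n - 1) (h n x) \<oplus>\<^bsub>ob Y n\<^esub> h (n + 1) (diff X n x)))"

context
  fixes R :: "('a, 'r) ring_scheme" and X Y :: "('a, 'b) cochain_complex"
  assumes X: "bounded_proj_complex R X" and Y: "bounded_proj_complex R Y"
begin

interpretation Y: left_module R "ob Y n" for n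
  by (rule bounded_proj_complexD(2)[OF Y])

private lemma dX: "x \<in> carrier (ob X n) \<Longrightarrow> diff X n x \<in> carrier (ob X (n + 1))"
  by (rule bounded_proj_complexD(4)[OF X])

private lemma dY: "diff Y (n - 1) \<in> left_hom R (ob Y (n - 1)) (ob Y n)"
  using bounded_proj_complexD(3)[OF Y, of "n - 1"] by simp

private lemmas mX = bounded_proj_complexD(2)[OF X]
private lemmas mY = bounded_proj_complexD(2)[OF Y]

lemma homotopy_closed:
  assumes h: "\<And>n. h n \<in> left_hom R (ob X n) (ob Y (n - 1))" and x: "x \<in> carrier (ob X n)"
  shows "h n x \<in> carrier (ob Y (n - 1))" "diff Y (n - 1) (h n x) \<in> carrier (ob Y n)"
    "h (n + 1) (diff X n x) \<in> carrier (ob Y n)"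
  using left_homD(1)[OF h x] left_homD(1)[OF dY left_homD(1)[OF h x]] left_homD(1)[OF h dX[OF x]]
  by simp_all

lemma is_homotopyD:
  assumes "is_homotopy R X Y h f g"
  shows "h n \<in> left_hom R (ob X n) (ob Y (n - 1))"
    and "x \<in> carrier (ob X n) \<Longrightarrow>
      f n x = g n x \<oplus>\<^bsub>ob Y n\<^esub> (diff Y (n - 1) (h n x) \<oplus>\<^bsub>ob Y n\<^esub> h (n + 1) (diff X n x))"
    and "x \<in> carrier (ob X n) \<Longrightarrow> h n x \<in> carrier (ob Y (n - 1))"
    and "x \<in> carrier (ob X n) \<Longrightarrow> diff Y (n - 1) (h n x) \<in> carrier (ob Y n)"
    and "x \<in> carrier (ob X n) \<Longrightarrow> h (n + 1) (diff X n x) \<in> carrier (ob Y n)"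
  using assms homotopy_closed[of h x n] by (auto simp: is_homotopy_def)

lemma homotopy_rel_iff:
  "(f, g) \<in> homotopy_rel R X Y \<longleftrightarrow>
    f \<in> chain_maps R X Y \<and> g \<in> chain_maps R X Y \<and> (\<exists>h. is_homotopy R X Y h f g)"
proof -
  have iff: "a \<ominus>\<^bsub>ob Y n\<^esub> b = c \<longleftrightarrow> a = b \<oplus>\<^bsub>ob Y n\<^esub> c"
    if c: "a \<in> carrier (ob Y n)" "b \<in> carrier (ob Y n)" "c \<in> carrier (ob Y n)" for a b c n
  proof
    assume e: "a \<ominus>\<^bsub>ob Y n\<^esub> b = c"
    show "a = b \<oplus>\<^bsub>ob Y n\<^esub> c"
      unfolding e[symmetric] using c(1,2) by (simp add: a_minus_def Y.M.a_comm[of a] Y.M.r_neg2)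
  next
    assume e: "a = b \<oplus>\<^bsub>ob Y n\<^esub> c"
    show "a \<ominus>\<^bsub>ob Y n\<^esub> b = c"
      unfolding e using c(2,3) by (simp add: a_minus_def Y.M.a_comm[of b] Y.M.a_assoc Y.M.r_neg)
  qed
  have "f n x \<ominus>\<^bsub>ob Y n\<^esub> g n x = diff Y (n - 1) (h n x) \<oplus>\<^bsub>ob Y n\<^esub> h (n + 1) (diff X n x) \<longleftrightarrow>
      f n x = g n x \<oplus>\<^bsub>ob Y n\<^esub> (diff Y (n - 1) (h n x) \<oplus>\<^bsub>ob Y n\<^esub> h (n + 1) (diff X n x))"
    if "f \<in> chain_maps R X Y" "g \<in> chain_maps R X Y"
      "\<forall>n. h n \<in> left_hom R (ob X n) (ob Y (n - 1))" "x \<in> carrier (ob X n)" for h n x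
    using homotopy_closed(2,3)[OF that(3)[rule_format] that(4)]
    by (rule iff[OF chain_mapsD(2)[OF that(1,4)] chain_mapsD(2)[OF that(2,4)] Y.M.a_closed])
  then show ?thesis
    unfolding homotopy_rel_def is_homotopy_def mem_Collect_eq case_prod_conv
    by (intro conj_cong refl ex_cong1 all_cong1 ball_cong)
qed

lemma homotopyI:
  assumes "f \<in> chain_maps R X Y" "g \<in> chain_maps R X Y"
    and "\<And>n. h n \<in> left_hom R (ob X n) (ob Y (n - 1))"
    and "\<And>n x. x \<in> carrier (ob X n) \<Longrightarrow>
      f n x = g n x \<oplus>\<^bsub>ob Y n\<^esub> (diff Y (n - 1) (h n x) \<oplus>\<^bsub>ob Y n\<^esub> h (n + 1) (diff X n x))"
  shows "(f, g) \<in> homotopy_rel R X Y"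
  unfolding homotopy_rel_iff is_homotopy_def using assms by blast

text \<open>The witnesses are the zero homotopy, the negative of a homotopy and the sum of two
  homotopies.\<close>

lemma homotopy_equiv: "equiv (chain_maps R X Y) (homotopy_rel R X Y)"
proof (rule equivI)
  show "homotopy_rel R X Y \<subseteq> chain_maps R X Y \<times> chain_maps R X Y"
    by (auto simp: homotopy_rel_def)
  show "refl_on (chain_maps R X Y) (homotopy_rel R X Y)"
  proof (rule refl_onI)
    show "(f, f) \<in> homotopy_rel R X Y" if f: "f \<in> chain_maps R X Y" for f
      by (rule homotopyI[OF f f, where h = "\<lambda>n. \<lambda>x\<in>carrier (ob X n). \<zero>\<^bsub>ob Y (n - 1)\<^esub>"])
        (simp_all add: left_hom_const_zero mX mY dX left_hom_zero[OF mY mY dY] chain_mapsD(2)[OF f])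
  qed
  show "sym (homotopy_rel R X Y)"
  proof (rule symI)
    fix f g assume "(f, g) \<in> homotopy_rel R X Y"
    then obtain h where fg: "f \<in> chain_maps R X Y" "g \<in> chain_maps R X Y" "is_homotopy R X Y h f g"
      by (auto simp: homotopy_rel_iff)
    note h = is_homotopyD[OF fg(3)]
    show "(g, f) \<in> homotopy_rel R X Y"
    proof (rule homotopyI[OF fg(2,1), where h = "\<lambda>n. \<lambda>x\<in>carrier (ob X n). \<ominus>\<^bsub>ob Y (n - 1)\<^esub> h n x"])
      show "(\<lambda>x\<in>carrier (ob X n). \<ominus>\<^bsub>ob Y (n - 1)\<^esub> h n x) \<in> left_hom R (ob X n) (ob Y (n - 1))" for n
        by (rule left_hom_uminus[OF h(1) mX mY])
      fix n x assume x: "x \<in> carrier (ob X n)"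
      let ?s = "diff Y (n - 1) (h n x) \<oplus>\<^bsub>ob Y n\<^esub> h (n + 1) (diff X n x)"
      have "g n x = f n x \<oplus>\<^bsub>ob Y n\<^esub> \<ominus>\<^bsub>ob Y n\<^esub> ?s"
        unfolding h(2)[OF x] using chain_mapsD(2)[OF fg(2) x] h(4,5)[OF x] by (simp add: Y.M.a_assoc Y.M.r_neg)
      then show "g n x = f n x \<oplus>\<^bsub>ob Y n\<^esub> (diff Y (n - 1) ((\<lambda>x\<in>carrier (ob X n). \<ominus>\<^bsub>ob Y (n - 1)\<^esub> h n x) x) \<oplus>\<^bsub>ob Y n\<^esub>
          (\<lambda>x\<in>carrier (ob X (n + 1)). \<ominus>\<^bsub>ob Y (n + 1 - 1)\<^esub> h (n + 1) x) (diff X n x))"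
        using x dX[OF x] h(3-5)[OF x] by (simp add: left_hom_a_inv[OF mY mY dY] Y.M.minus_add)
    qed
  qed
  show "trans (homotopy_rel R X Y)"
  proof (rule transI)
    fix f g k assume "(f, g) \<in> homotopy_rel R X Y" "(g, k) \<in> homotopy_rel R X Y"
    then obtain h h' where fk: "f \<in> chain_maps R X Y" "k \<in> chain_maps R X Y"
      and "is_homotopy R X Y h f g" "is_homotopy R X Y h' g k"
      by (auto simp: homotopy_rel_iff)
    note h = is_homotopyD[OF \<open>is_homotopy R X Y h f g\<close>]
      and h' = is_homotopyD[OF \<open>is_homotopy R X Y h' g k\<close>]
    show "(f, k) \<in> homotopy_rel R X Y"
    proof (rule homotopyI[OF fk, where h = "\<lambda>n. \<lambda>x\<in>carrier (ob X n). h n x \<oplus>\<^bsub>ob Y (n - 1)\<^esub> h' n x"])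
      show "(\<lambda>x\<in>carrier (ob X n). h n x \<oplus>\<^bsub>ob Y (n - 1)\<^esub> h' n x) \<in> left_hom R (ob X n) (ob Y (n - 1))" for n
        by (rule left_hom_add[OF h(1) h'(1) mX mY])
      fix n x assume x: "x \<in> carrier (ob X n)"
      show "f n x = k n x \<oplus>\<^bsub>ob Y n\<^esub> (diff Y (n - 1) ((\<lambda>x\<in>carrier (ob X n). h n x \<oplus>\<^bsub>ob Y (n - 1)\<^esub> h' n x) x) \<oplus>\<^bsub>ob Y n\<^esub>
            (\<lambda>x\<in>carrier (ob X (n + 1)). h (n + 1) x \<oplus>\<^bsub>ob Y (n + 1 - 1)\<^esub> h' (n + 1) x) (diff X n x))"
        using x dX[OF x] h(3-5)[OF x] h'(3-5)[OF x] chain_mapsD(2)[OF fk(2) x]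
        by (simp add: left_homD(2)[OF dY] h(2) h'(2) Y.M.add.m_ac)
    qed
  qed
qed

lemma homotopy_add_cong:
  assumes f: "(f, f') \<in> homotopy_rel R X Y" and g: "(g, g') \<in> homotopy_rel R X Y"
  shows "(\<lambda>n. \<lambda>x\<in>carrier (ob X n). f n x \<oplus>\<^bsub>ob Y n\<^esub> g n x,
    \<lambda>n. \<lambda>x\<in>carrier (ob X n). f' n x \<oplus>\<^bsub>ob Y n\<^esub> g' n x) \<in> homotopy_rel R X Y"
proof -
  obtain h where f: "f \<in> chain_maps R X Y" "f' \<in> chain_maps R X Y" "is_homotopy R X Y h f f'"
    using f by (auto simp: homotopy_rel_iff)
  obtain k where g: "g \<in> chain_maps R X Y" "g' \<in> chain_maps R X Y" "is_homotopy R X Y k g g'"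
    using g by (auto simp: homotopy_rel_iff)
  note h = is_homotopyD[OF f(3)] and k = is_homotopyD[OF g(3)]
  show ?thesis
  proof (rule homotopyI[OF chain_maps_add[OF X Y f(1) g(1)] chain_maps_add[OF X Y f(2) g(2)],
        where h = "\<lambda>n. \<lambda>x\<in>carrier (ob X n). h n x \<oplus>\<^bsub>ob Y (n - 1)\<^esub> k n x"])
    show "(\<lambda>x\<in>carrier (ob X n). h n x \<oplus>\<^bsub>ob Y (n - 1)\<^esub> k n x) \<in> left_hom R (ob X n) (ob Y (n - 1))" for n
      by (rule left_hom_add[OF h(1) k(1) mX mY])
    fix n x assume x: "x \<in> carrier (ob X n)"
    show "(\<lambda>x\<in>carrier (ob X n). f n x \<oplus>\<^bsub>ob Y n\<^esub> g n x) x =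
      (\<lambda>x\<in>carrier (ob X n). f' n x \<oplus>\<^bsub>ob Y n\<^esub> g' n x) x \<oplus>\<^bsub>ob Y n\<^esub>
      (diff Y (n - 1) ((\<lambda>x\<in>carrier (ob X n). h n x \<oplus>\<^bsub>ob Y (n - 1)\<^esub> k n x) x) \<oplus>\<^bsub>ob Y n\<^esub>
        (\<lambda>x\<in>carrier (ob X (n + 1)). h (n + 1) x \<oplus>\<^bsub>ob Y (n + 1 - 1)\<^esub> k (n + 1) x) (diff X n x))"
      using x dX[OF x] h(3-5)[OF x] k(3-5)[OF x] chain_mapsD(2)[OF f(2) x] chain_mapsD(2)[OF g(2) x]
      by (simp add: left_homD(2)[OF dY] h(2) k(2) Y.M.add.m_ac)
  qed
qed

end

text \<open>\<open>g f - g' f' = (g - g') f + g' (f - f')\<close> is the boundary of \<open>k f + g' h\<close>.\<close>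

lemma homotopy_comp_cong:
  assumes X: "bounded_proj_complex R X" and Y: "bounded_proj_complex R Y" and Z: "bounded_proj_complex R Z"
    and f: "(f, f') \<in> homotopy_rel R X Y" and g: "(g, g') \<in> homotopy_rel R Y Z"
  shows "(\<lambda>n. \<lambda>x\<in>carrier (ob X n). g n (f n x), \<lambda>n. \<lambda>x\<in>carrier (ob X n). g' n (f' n x)) \<in> homotopy_rel R X Z"
proof -
  interpret Y: left_module R "ob Y n" for n by (rule bounded_proj_complexD(2)[OF Y])
  interpret Z: left_module R "ob Z n" for n by (rule bounded_proj_complexD(2)[OF Z])
  have dZ: "diff Z (n - 1) \<in> left_hom R (ob Z (n - 1)) (ob Z n)" for n
    using bounded_proj_complexD(3)[OF Z, of "n - 1"] by simp
  note dX = bounded_proj_complexD(4)[OF X] and mX = bounded_proj_complexD(2)[OF X]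
    and mZ = bounded_proj_complexD(2)[OF Z]
  obtain h where f: "f \<in> chain_maps R X Y" "f' \<in> chain_maps R X Y" "is_homotopy R X Y h f f'"
    using f by (auto simp: homotopy_rel_iff[OF X Y])
  obtain k where g: "g \<in> chain_maps R Y Z" "g' \<in> chain_maps R Y Z" "is_homotopy R Y Z k g g'"
    using g by (auto simp: homotopy_rel_iff[OF Y Z])
  note h = is_homotopyD[OF X Y f(3)] and k = is_homotopyD[OF Y Z g(3)]
  have kf: "(\<lambda>x\<in>carrier (ob X n). k n (f n x)) \<in> left_hom R (ob X n) (ob Z (n - 1))"
    and gh: "(\<lambda>x\<in>carrier (ob X n). g' (n - 1) (h n x)) \<in> left_hom R (ob X n) (ob Z (n - 1))" for n
    by (rule left_hom_comp[OF chain_mapsD(1)[OF f(1)] k(1) mX])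
      (rule left_hom_comp[OF h(1) chain_mapsD(1)[OF g(2)] mX])
  define s where "s n = (\<lambda>x\<in>carrier (ob X n). (\<lambda>x\<in>carrier (ob X n). k n (f n x)) x \<oplus>\<^bsub>ob Z (n - 1)\<^esub>
    (\<lambda>x\<in>carrier (ob X n). g' (n - 1) (h n x)) x)" for n
  show ?thesis
  proof (rule homotopyI[OF X Z chain_maps_comp[OF X f(1) g(1)] chain_maps_comp[OF X f(2) g(2)], where h = s])
    show "s n \<in> left_hom R (ob X n) (ob Z (n - 1))" for n
      unfolding s_def by (rule left_hom_add[OF kf gh mX mZ])
    fix n x assume x: "x \<in> carrier (ob X n)"
    have fx: "f n x \<in> carrier (ob Y n)" "f' n x \<in> carrier (ob Y n)"
      by (rule chain_mapsD(2)[OF f(1) x], rule chain_mapsD(2)[OF f(2) x])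
    have gc: "g' n y \<in> carrier (ob Z n)" if "y \<in> carrier (ob Y n)" for y n using chain_mapsD(2)[OF g(2) that] .
    have dgh: "diff Z (n - 1) (g' (n - 1) (h n x)) = g' n (diff Y (n - 1) (h n x))"
      using chain_mapsD(4)[OF g(2) h(3)[OF x]] by simp
    have sx: "diff Z (n - 1) (s n x) = diff Z (n - 1) (k n (f n x)) \<oplus>\<^bsub>ob Z n\<^esub> g' n (diff Y (n - 1) (h n x))"
      using x k(3)[OF fx(1)] gc[OF h(3)[OF x]] by (simp add: s_def left_homD(2)[OF dZ] dgh)
    have sd: "s (n + 1) (diff X n x) = k (n + 1) (diff Y n (f n x)) \<oplus>\<^bsub>ob Z n\<^esub> g' n (h (n + 1) (diff X n x))"
      using dX[OF x] chain_mapsD(4)[OF f(1) x] by (simp add: s_def)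
    have "g n (f n x) = g' n (f n x) \<oplus>\<^bsub>ob Z n\<^esub> (diff Z (n - 1) (k n (f n x)) \<oplus>\<^bsub>ob Z n\<^esub> k (n + 1) (diff Y n (f n x)))"
      by (rule k(2)[OF fx(1)])
    also have "g' n (f n x) = g' n (f' n x) \<oplus>\<^bsub>ob Z n\<^esub>
        (g' n (diff Y (n - 1) (h n x)) \<oplus>\<^bsub>ob Z n\<^esub> g' n (h (n + 1) (diff X n x)))"
      unfolding h(2)[OF x] using fx(2) h(4,5)[OF x] by (simp add: chain_mapsD(3)[OF g(2)])
    finally have "g n (f n x) = g' n (f' n x) \<oplus>\<^bsub>ob Z n\<^esub> (diff Z (n - 1) (s n x) \<oplus>\<^bsub>ob Z n\<^esub> s (n + 1) (diff X n x))"
      unfolding sx sd using gc[OF fx(2)] gc[OF h(4)[OF x]] gc[OF h(5)[OF x]] k(4,5)[OF fx(1)]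
      by (simp add: Z.M.add.m_ac)
    then show "(\<lambda>x\<in>carrier (ob X n). g n (f n x)) x = (\<lambda>x\<in>carrier (ob X n). g' n (f' n x)) x \<oplus>\<^bsub>ob Z n\<^esub>
        (diff Z (n - 1) (s n x) \<oplus>\<^bsub>ob Z n\<^esub> s (n + 1) (diff X n x))"
      using x by simp
  qed
qed

lemma Kb_proj_congruence: "category_congruence (Cb_proj R) (homotopy_rel R)"
  by (rule category_congruence.intro[OF Cb_proj_preadditive], rule category_congruence_axioms.intro,
      unfold Cb_proj_simps mem_Collect_eq)
    (rule homotopy_equiv homotopy_comp_cong homotopy_add_cong; assumption)+

lemma Kb_proj_quot_cat: "Kb_proj R = quot_cat (Cb_proj R) (homotopy_rel R)"
  by (simp add: Kb_proj_def quot_cat_def)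

theorem corollary4p6:
  fixes R :: "('a, 'r) ring_scheme" and \<mm> :: "'a set"
  assumes "ring R"
    and "ideal \<mm> R"
    and "\<And>i. i \<ge> 1 \<Longrightarrow> finite_length R (quot_module (regular_module R) (ideal_pow R \<mm> i))"
    and "adic_complete R \<mm>"
    and "infinite (UNIV :: 'b set)"
  shows "krull_schmidt (Cb_proj R :: (('a, 'b) cochain_complex, int \<Rightarrow> 'b \<Rightarrow> 'b) precat) \<and>
         krull_schmidt (Kb_proj R :: (('a, 'b) cochain_complex, (int \<Rightarrow> 'b \<Rightarrow> 'b) set) precat)"
proof -
  let ?C = "Cb_proj R :: (('a, 'b) cochain_complex, int \<Rightarrow> 'b \<Rightarrow> 'b) precat"
  interpret complete_adic_ring R \<mm>
    using assms by (intro complete_adic_ring.intro complete_adic_ring_axioms.intro) auto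
  interpret C: category_congruence ?C "homotopy_rel R" by (rule Kb_proj_congruence)
  interpret K: preadditive_category C.Q by (rule C.quot_cat_preadditive)
  obtain W where W: "W \<in> Obj ?C" "Id ?C W = Zero ?C W W"
    using Cb_zero_exists[OF assms(1)] Cb_zero_iff by (auto simp: Cb_proj_simps(1))
  have biproduct: "\<exists>X. is_biproduct ?C X1 X2 X" if "X1 \<in> Obj ?C" "X2 \<in> Obj ?C" for X1 X2
    using that Cb_biproduct_exists[OF _ _ assms(5)] by (simp add: Cb_proj_simps(1))
  have "additive_category ?C" using W biproduct by (intro Cb.additive_categoryI) blast+
  moreover have "additive_category C.Q"
  proof (rule K.additive_categoryI)
    show "\<exists>X\<in>Obj C.Q. Id C.Q X = Zero C.Q X X"
      using W by (intro bexI[of _ W]) (simp_all add: C.Q_id C.Q_zero)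
    show "\<exists>X. is_biproduct C.Q X1 X2 X" if "X1 \<in> Obj C.Q" "X2 \<in> Obj C.Q" for X1 X2
      using biproduct[of X1 X2] C.quot_cat_biproduct that by auto
  qed
  moreover have "ks_decomposable ?C X" if "X \<in> Obj ?C" for X :: "('a, 'b) cochain_complex"
    using that[unfolded Cb_proj_simps(1) mem_Collect_eq]
    by (rule bounded_proj_complex_induct)
      (auto simp: Cb_proj_simps(1)
        intro: Cb.ks_decomposable_zero Cb.ks_decomposable_local Cb.ks_decomposable_biproduct)
  \<comment> \<open>The induction still runs over complexes and chain maps; zero objects and
    biproducts are carried to the quotient as they are.\<close>
  moreover have "ks_decomposable C.Q X" if "X \<in> Obj ?C" for X :: "('a, 'b) cochain_complex"
    using that[unfolded Cb_proj_simps(1) mem_Collect_eq]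
  proof (rule bounded_proj_complex_induct)
    fix Y :: "('a, 'b) cochain_complex" assume Y: "bounded_proj_complex R Y"
    then have ob: "Y \<in> Obj ?C" by (simp add: Cb_proj_simps(1))
    show "ks_decomposable C.Q Y" if "Id ?C Y = Zero ?C Y Y"
      using that ob by (intro K.ks_decomposable_zero) (simp_all add: C.Q_id C.Q_zero)
    \<comment> \<open>The zero alternative is the case of a null-homotopic identity, where the empty
      decomposition is used.\<close>
    show "ks_decomposable C.Q Y" if "local_ring (End_ring ?C Y)"
      using C.quot_cat_local_or_zero[OF ob that] ob K.ks_decomposable_zero K.ks_decomposable_local by auto
  qed (use K.ks_decomposable_biproduct C.quot_cat_biproduct in blast)
  ultimately show ?thesis
    by (simp add: krull_schmidt_def Kb_proj_quot_cat ks_decomposable_def)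
qed

end
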